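(* Fix $\theta\in\mathbb{R}$. There exists $a_0>0$ such that for every $0<a<a_0$ and every $H\in C^\infty(\mathbb{T})$, the random variables $\mathtt{Y}^n(H)$ under the stationary measure $\mu^n_{\rm ss}$ of the Markov process with generator $L_n=n^2L_n^{\rm ex}+aL_n^{\rm G}$ converge in distribution, as $n\to\infty$, to $\langle H\rangle\,\mathtt{Y}^*$, where $\langle H\rangle=\int_{\mathbb{T}}H(u)\,du$ and $\mathtt{Y}^*$ is a real random variable with distribution $$\alpha^*(dy)=Z^{-1}e^{-2V(y)}\,dy,\qquad V(y)=\theta y^2+\tfrac12y^4,\qquad Z=\int_{\mathbb{R}}e^{-2V(y)}\,dy.$$
   Context: Throughout $n$ ranges over positive integers with $n>\theta^2$. $\mathbb{T}=\mathbb{R}/\mathbb{Z}$, $\mathbb{T}_n=\mathbb{Z}/n\mathbb{Z}$, $\Omega_n=\{0,1\}^{\mathbb{T}_n}$ with elements $\eta=(\eta(x))_{x\in\mathbb{T}_n}$, and $\sigma(x)=2\eta(x)-1$. Let $\gamma=\gamma_n=\frac12\left(1-\frac{\theta}{\sqrt n}\right)\in(0,1)$. For $f:\Omega_n\to\mathbb{R}$, $$L_n^{\rm ex}f(\eta)=\sum_{x\in\mathbb{T}_n}\{f(\eta^{x,x+1})-f(\eta)\},\qquad L_n^{\rm G}f(\eta)=\sum_{x\in\mathbb{T}_n}c_x(\eta)\{f(\eta^x)-f(\eta)\},$$ where $\eta^{x,x+1}$ is $\eta$ with the values at $x$ and $x+1$ exchanged, $\eta^x$ is $\eta$ with the value at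 $x$ replaced by $1-\eta(x)$, and $$c_x(\eta)=1-\gamma\sigma(x)(\sigma(x-1)+\sigma(x+1))+\gamma^2\sigma(x-1)\sigma(x+1).$$ For $a>0$, $L_n=n^2L_n^{\rm ex}+aL_n^{\rm G}$ generates an irreducible continuous-time Markov chain on the finite set $\Omega_n$; $\mu^n_{\rm ss}$ denotes its unique invariant probability measure. For $H\in C^\infty(\mathbb{T})$, $\mathtt{Y}^n(H)=n^{-3/4}\sum_{x\in\mathbb{T}_n}H(x/n)(\eta(x)-1/2)$. *)

theory Defs
  imports "HOL-Probability.Probability"
begin

text \<open>Sites of \<open>\<int>/n\<int>\<close> are represented by \<open>0, \<dots>, n - 1\<close>, with neighbours taken modulo \<open>n\<close>.
  Configurations are extensional functions on the sites with values in \<open>{0, 1}\<close>.\<close>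

type_synonym config = "int \<Rightarrow> nat"

definition torus :: "nat \<Rightarrow> int set" where
  "torus n = {0..<int n}"

definition right :: "nat \<Rightarrow> int \<Rightarrow> int" where
  "right n x = (x + 1) mod int n"

definition left :: "nat \<Rightarrow> int \<Rightarrow> int" where
  "left n x = (x - 1) mod int n"

definition configs :: "nat \<Rightarrow> config set" where
  "configs n = torus n \<rightarrow>\<^sub>E {0, 1}"

definition spin :: "config \<Rightarrow> int \<Rightarrow> real" where
  "spin \<eta> x = 2 * real (\<eta> x) - 1"

definition exchange :: "config \<Rightarrow> int \<Rightarrow> int \<Rightarrow> config" where
  "exchange \<eta> x y = \<eta>(x := \<eta> y, y := \<eta> x)"

definition flip :: "config \<Rightarrow> int \<Rightarrow> config" where
  "flip \<eta> x = \<eta>(x := 1 - \<eta> x)"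

definition gamma :: "real \<Rightarrow> nat \<Rightarrow> real" where
  "gamma \<theta> n = (1 - \<theta> / sqrt (real n)) / 2"

definition rate :: "real \<Rightarrow> nat \<Rightarrow> int \<Rightarrow> config \<Rightarrow> real" where
  "rate \<theta> n x \<eta> =
     1 - gamma \<theta> n * spin \<eta> x * (spin \<eta> (left n x) + spin \<eta> (right n x))
       + (gamma \<theta> n)\<^sup>2 * spin \<eta> (left n x) * spin \<eta> (right n x)"

definition gen_ex :: "nat \<Rightarrow> (config \<Rightarrow> real) \<Rightarrow> config \<Rightarrow> real" where
  "gen_ex n f \<eta> = (\<Sum>x\<in>torus n. f (exchange \<eta> x (right n x)) - f \<eta>)"

definition gen_G :: "real \<Rightarrow> nat \<Rightarrow> (config \<Rightarrow> real) \<Rightarrow> config \<Rightarrow> real" where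
  "gen_G \<theta> n f \<eta> = (\<Sum>x\<in>torus n. rate \<theta> n x \<eta> * (f (flip \<eta> x) - f \<eta>))"

definition gen :: "real \<Rightarrow> real \<Rightarrow> nat \<Rightarrow> (config \<Rightarrow> real) \<Rightarrow> config \<Rightarrow> real" where
  "gen \<theta> a n f \<eta> = (real n)\<^sup>2 * gen_ex n f \<eta> + a * gen_G \<theta> n f \<eta>"

text \<open>The Markov semigroup generated by \<open>L = gen \<theta> a n\<close>: since the state space is finite, it is
  \<open>exp (t L)\<close>, given by the exponential series, which converges at every configuration
  in \<^term>\<open>configs n\<close>.\<close>

definition markov_semigroup :: "real \<Rightarrow> real \<Rightarrow> nat \<Rightarrow> real \<Rightarrow> (config \<Rightarrow> real) \<Rightarrow> config \<Rightarrow> real" where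
  "markov_semigroup \<theta> a n t f \<eta> = (\<Sum>k. t ^ k / fact k * (gen \<theta> a n ^^ k) f \<eta>)"

definition invariant_law :: "real \<Rightarrow> real \<Rightarrow> nat \<Rightarrow> config pmf \<Rightarrow> bool" where
  "invariant_law \<theta> a n \<mu> \<longleftrightarrow>
     set_pmf \<mu> \<subseteq> configs n \<and>
     (\<forall>t\<ge>0. \<forall>f. measure_pmf.expectation \<mu> (markov_semigroup \<theta> a n t f) = measure_pmf.expectation \<mu> f)"

text \<open>For \<open>a > 0\<close> and \<open>n > \<theta>\<^sup>2\<close>, \<^term>\<open>gamma \<theta> n\<close> lies in \<open>(0, 1)\<close>, so all flip rates are positive and
  the chain on the finite set \<^term>\<open>configs n\<close> is irreducible: exactly one law is invariant.
  For the finitely many \<open>n \<le> \<theta>\<^sup>2\<close> the value is of no interest.\<close>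

definition mu_ss :: "real \<Rightarrow> real \<Rightarrow> nat \<Rightarrow> config pmf" where
  "mu_ss \<theta> a n = (THE \<mu>. invariant_law \<theta> a n \<mu>)"

text \<open>\<open>C\<^sup>\<infinity>\<close> functions on \<open>\<real>/\<int>\<close>, as smooth functions on \<open>\<real>\<close> of period \<open>1\<close>.\<close>

definition smooth_on_circle :: "(real \<Rightarrow> real) \<Rightarrow> bool" where
  "smooth_on_circle H \<longleftrightarrow>
     (\<forall>u. H (u + 1) = H u) \<and> (\<forall>k u. (deriv ^^ k) H field_differentiable at u)"

definition fluct :: "nat \<Rightarrow> (real \<Rightarrow> real) \<Rightarrow> config \<Rightarrow> real" where
  "fluct n H \<eta> =
     real n powr (-3/4) * (\<Sum>x\<in>torus n. H (real_of_int x / real n) * (real (\<eta> x) - 1/2))"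

definition potential :: "real \<Rightarrow> real \<Rightarrow> real" where
  "potential \<theta> y = \<theta> * y\<^sup>2 + y ^ 4 / 2"

definition partition_fn :: "real \<Rightarrow> real" where
  "partition_fn \<theta> = (\<integral>y. exp (- 2 * potential \<theta> y) \<partial>lborel)"

definition alpha_star :: "real \<Rightarrow> real measure" where
  "alpha_star \<theta> = density lborel (\<lambda>y. ennreal (exp (- 2 * potential \<theta> y) / partition_fn \<theta>))"

end

theory Submission
  imports Defs
begin

text \<open>Let \<open>e\<close> be \<open>n\<^sup>2\<close> times the Dirichlet form of the exchange dynamics at the square root of the stationary
  law \<open>\<mu>\<close>. An integration by parts for exchanges bounds the second moments of mean-zero linear and quadratic
  statistics under \<open>\<mu>\<close> by \<open>C n (1 + e)\<close>, because the error terms can be reabsorbed. Writing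
  \<open>\<sigma>(x) - m\<close>, with \<open>m\<close> the magnetization, as a sum of gradients, a second integration by parts replaces
  the sums over \<open>x\<close> of products of two or three neighbouring spins by \<open>n m\<^sup>2\<close> and \<open>n m\<^sup>3\<close> up to \<open>C (1 + e)\<close>.
  The entropy production relative to an exchangeable measure whose magnetization is reversible for the
  mean-field flip rates consists of such replacement errors, so \<open>e \<le> a C (1 + e)\<close>, and hence \<open>e \<le> 1\<close>
  for small \<open>a\<close>.

  Stationarity tested on \<open>m\<^sup>2\<close> then gives \<open>n E[m\<^sup>4] \<le> C\<close>, and tested on functions of
  \<open>Y = n\<^bsup>1/4\<^esup> m / 2\<close> it gives \<open>E[F'(Y) / 2 - V'(Y) F(Y)] \<rightarrow> 0\<close>; solving the Stein equation for compactly
  supported right-hand sides identifies the limit law of \<open>Y\<close>. Finally \<open>Y\<^sup>n(H) - \<langle>H\<rangle> Y\<close> vanishes by the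
  bound on mean-zero linear statistics.\<close>

section \<open>Configurations on the discrete torus\<close>

text \<open>No formula for the stationary law is used; everything is drawn from the single number
  \<open>energy\<close>. Its factor n^2 is what makes it strong: an average bond contributes only
  energy / n^3. Two integrations by parts are needed because one alone bounds local statistics by
  second moments of order n, while the sums of products must be replaced up to an error of order
  one, uniformly in n. The estimates look circular, since the errors are bounded by the energy and
  the energy by the errors; the factor a, carried by the flips only, is what opens the circle.

  The scale n^(1/4) and the quartic potential come from \<gamma> being close to 1 / 2. The linear
  restoring force 1 - 2 \<gamma> = \<theta> / sqrt n balances the cubic term \<gamma>^2 m^3 exactly
  when m has size n^(-1/4), and \<gamma>^2 tends to 1 / 4. The numerical constants are rounded up
  generously; what matters is that they depend neither on n nor on a.\<close>

lemma finite_torus [simp]: "finite (torus n)"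
  by (simp add: torus_def)

lemma card_torus [simp]: "card (torus n) = n"
  by (simp add: torus_def)

lemma finite_configs [simp]: "finite (configs n)"
  unfolding configs_def by (intro finite_PiE) auto

lemma mod_in_torus [simp]: "0 < n \<Longrightarrow> x mod int n \<in> torus n"
  by (simp add: torus_def)

lemma mod_torus [simp]: "x \<in> torus n \<Longrightarrow> x mod int n = x"
  by (simp add: torus_def)

lemma right_in_torus [simp]: "0 < n \<Longrightarrow> right n x \<in> torus n"
  by (simp add: right_def)

lemma left_in_torus [simp]: "0 < n \<Longrightarrow> left n x \<in> torus n"
  by (simp add: left_def)

lemma sum_torus_shift:
  fixes f :: "int \<Rightarrow> 'a::comm_monoid_add"
  assumes n: "0 < n" and per: "\<And>x. f (x mod int n) = f x"
  shows "(\<Sum>x\<in>torus n. f (x + k)) = (\<Sum>x\<in>torus n. f x)"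
proof -
  have "(\<Sum>x\<in>torus n. f (x + k)) = (\<Sum>x\<in>torus n. f ((x + k) mod int n))"
    using per by simp
  also have "\<dots> = (\<Sum>x\<in>torus n. f x)"
    by (rule sum.reindex_bij_witness[where i="\<lambda>x. (x - k) mod int n" and j = "\<lambda>x. (x + k) mod int n"])
      (use n in \<open>auto simp: mod_simps\<close>)
  finally show ?thesis .
qed

lemma sum_torus_reflect:
  fixes f :: "int \<Rightarrow> 'a::comm_monoid_add"
  assumes n: "0 < n" and per: "\<And>x. f (x mod int n) = f x"
  shows "(\<Sum>x\<in>torus n. f (k - x)) = (\<Sum>x\<in>torus n. f x)"
proof -
  have "(\<Sum>x\<in>torus n. f (k - x)) = (\<Sum>x\<in>torus n. f ((k - x) mod int n))"
    using per by simp
  also have "\<dots> = (\<Sum>x\<in>torus n. f x)"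
    by (rule sum.reindex_bij_witness[where i="\<lambda>x. (k - x) mod int n" and j = "\<lambda>x. (k - x) mod int n"])
      (use n in \<open>auto simp: mod_simps\<close>)
  finally show ?thesis .
qed

section \<open>Exchanges and flips as permutations of the configurations\<close>

lemma exchange_in_configs [simp]:
  "\<eta> \<in> configs n \<Longrightarrow> x \<in> torus n \<Longrightarrow> y \<in> torus n \<Longrightarrow> exchange \<eta> x y \<in> configs n"
  by (fastforce simp: configs_def exchange_def PiE_iff extensional_def)

lemma exchange_exchange [simp]: "exchange (exchange \<eta> x y) x y = \<eta>"
  by (auto simp: exchange_def)

lemma exchange_commute: "exchange \<eta> x y = exchange \<eta> y x"
  by (auto simp: exchange_def)

lemma exchange_same [simp]: "exchange \<eta> x x = \<eta>"
  by (simp add: exchange_def)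

lemma bij_exchange:
  "x \<in> torus n \<Longrightarrow> y \<in> torus n \<Longrightarrow> bij_betw (\<lambda>\<eta>. exchange \<eta> x y) (configs n) (configs n)"
  by (rule bij_betwI[where g="\<lambda>\<eta>. exchange \<eta> x y"]) auto

lemma sum_exchange:
  "x \<in> torus n \<Longrightarrow> y \<in> torus n \<Longrightarrow> (\<Sum>\<eta>\<in>configs n. f (exchange \<eta> x y)) = (\<Sum>\<eta>\<in>configs n. f \<eta>)"
  using sum.reindex_bij_betw[OF bij_exchange] .

lemma flip_in_configs [simp]: "\<eta> \<in> configs n \<Longrightarrow> x \<in> torus n \<Longrightarrow> flip \<eta> x \<in> configs n"
  by (fastforce simp: configs_def flip_def PiE_iff extensional_def)

lemma config_values: "\<eta> \<in> configs n \<Longrightarrow> x \<in> torus n \<Longrightarrow> \<eta> x = 0 \<or> \<eta> x = 1"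
  by (auto simp: configs_def PiE_iff)

lemma flip_flip [simp]: "\<eta> \<in> configs n \<Longrightarrow> x \<in> torus n \<Longrightarrow> flip (flip \<eta> x) x = \<eta>"
  using config_values[of \<eta> n x] by (auto simp: flip_def)

lemma sum_flip:
  assumes "x \<in> torus n"
  shows "(\<Sum>\<eta>\<in>configs n. f (flip \<eta> x)) = (\<Sum>\<eta>\<in>configs n. f \<eta>)"
proof -
  have "bij_betw (\<lambda>\<eta>. flip \<eta> x) (configs n) (configs n)"
    by (rule bij_betwI[where g="\<lambda>\<eta>. flip \<eta> x"]) (use assms in auto)
  from sum.reindex_bij_betw[OF this] show ?thesis .
qed

lemma spin_exchange:
  "spin (exchange \<eta> x y) w = (if w = y then spin \<eta> x else if w = x then spin \<eta> y else spin \<eta> w)"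
  by (auto simp: spin_def exchange_def)

lemma spin_values: "\<eta> \<in> configs n \<Longrightarrow> x \<in> torus n \<Longrightarrow> spin \<eta> x = 1 \<or> spin \<eta> x = -1"
  using config_values[of \<eta> n x] by (auto simp: spin_def)

text \<open>Reducing the site first turns neighbours into plain integer shifts, so that
  \<open>sum_torus_shift\<close> applies and the wrap-around stays hidden.\<close>

definition pspin :: "nat \<Rightarrow> config \<Rightarrow> int \<Rightarrow> real" where
  "pspin n \<eta> x = spin \<eta> (x mod int n)"

definition mag :: "nat \<Rightarrow> config \<Rightarrow> real" where
  "mag n \<eta> = (\<Sum>x\<in>torus n. spin \<eta> x) / real n"

lemma pspin_mod [simp]: "pspin n \<eta> (x mod int n) = pspin n \<eta> x"
  by (simp add: pspin_def)

lemma pspin_torus: "x \<in> torus n \<Longrightarrow> pspin n \<eta> x = spin \<eta> x"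
  by (simp add: pspin_def)

lemma spin_right: "spin \<eta> (right n x) = pspin n \<eta> (x + 1)"
  by (simp add: pspin_def right_def)

lemma spin_left: "spin \<eta> (left n x) = pspin n \<eta> (x - 1)"
  by (simp add: pspin_def left_def)

lemma pspin_values: "0 < n \<Longrightarrow> \<eta> \<in> configs n \<Longrightarrow> pspin n \<eta> x = 1 \<or> pspin n \<eta> x = -1"
  unfolding pspin_def by (intro spin_values) auto

lemma abs_pspin: "0 < n \<Longrightarrow> \<eta> \<in> configs n \<Longrightarrow> \<bar>pspin n \<eta> x\<bar> = 1"
  using pspin_values[of n \<eta> x] by auto

lemma pspin_mult_self: "0 < n \<Longrightarrow> \<eta> \<in> configs n \<Longrightarrow> pspin n \<eta> x * pspin n \<eta> x = 1"
  using pspin_values[of n \<eta> x] by auto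

lemma pspin_exchange:
  "pspin n (exchange \<eta> x y) w =
     (if w mod int n = y then spin \<eta> x else if w mod int n = x then spin \<eta> y else pspin n \<eta> w)"
  by (simp add: pspin_def spin_exchange)

lemma mag_pspin: "mag n \<eta> = (\<Sum>x\<in>torus n. pspin n \<eta> x) / real n"
  by (simp add: mag_def pspin_torus)

lemma sum_pspin: "0 < n \<Longrightarrow> (\<Sum>x\<in>torus n. pspin n \<eta> (x + k)) = real n * mag n \<eta>"
  by (simp add: sum_torus_shift[where f="pspin n \<eta>"] mag_pspin)

lemma abs_mag_le: "0 < n \<Longrightarrow> \<eta> \<in> configs n \<Longrightarrow> \<bar>mag n \<eta>\<bar> \<le> 1"
proof -
  assume a: "0 < n" "\<eta> \<in> configs n"
  have "\<bar>\<Sum>x\<in>torus n. pspin n \<eta> x\<bar> \<le> (\<Sum>x\<in>torus n. \<bar>pspin n \<eta> x\<bar>)" by (rule sum_abs)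
  also have "\<dots> = real n" using a by (simp add: abs_pspin)
  finally show ?thesis using a by (simp add: mag_pspin)
qed

lemma mag_exchange:
  assumes "x \<in> torus n" "y \<in> torus n"
  shows "mag n (exchange \<eta> x y) = mag n \<eta>"
proof -
  have "(\<Sum>w\<in>torus n. spin (exchange \<eta> x y) w) = (\<Sum>w\<in>torus n. spin \<eta> w)"
    by (rule sum.reindex_bij_witness[where i="\<lambda>w. if w = y then x else if w = x then y else w"
          and j="\<lambda>w. if w = y then x else if w = x then y else w"])
      (use assms in \<open>auto simp: spin_exchange\<close>)
  then show ?thesis by (simp add: mag_def)
qed

section \<open>Expectations and exchange Dirichlet forms under a positive law\<close>

locale positive_law =
  fixes n :: nat and p :: "config \<Rightarrow> real"
  assumes n5: "5 \<le> n"
    and p_pos: "\<And>\<eta>. \<eta> \<in> configs n \<Longrightarrow> 0 < p \<eta>"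
    and p_sum: "sum p (configs n) = 1"
begin

lemma n0 [simp]: "0 < n" and n0': "n \<noteq> 0" using n5 by auto

definition ev :: "(config \<Rightarrow> real) \<Rightarrow> real" where
  "ev f = (\<Sum>\<eta>\<in>configs n. p \<eta> * f \<eta>)"

text \<open>Dirichlet form of the single exchange x, y at the square root of p, with respect to
  counting measure, which every exchange preserves. The two sites need not be adjacent.\<close>

definition dir :: "int \<Rightarrow> int \<Rightarrow> real" where
  "dir x y = (\<Sum>\<eta>\<in>configs n. (sqrt (p \<eta>) - sqrt (p (exchange \<eta> x y)))\<^sup>2)"

definition energy :: real where
  "energy = (real n)\<^sup>2 * (\<Sum>z\<in>torus n. dir z (right n z))"

lemma ev_add: "ev (\<lambda>\<eta>. f \<eta> + g \<eta>) = ev f + ev g"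
  by (simp add: ev_def sum.distrib algebra_simps)

lemma ev_diff: "ev (\<lambda>\<eta>. f \<eta> - g \<eta>) = ev f - ev g"
  by (simp add: ev_def sum_subtractf algebra_simps)

lemma ev_cmult: "ev (\<lambda>\<eta>. c * f \<eta>) = c * ev f"
  by (simp add: ev_def sum_distrib_left algebra_simps)

lemma ev_sum: "ev (\<lambda>\<eta>. \<Sum>i\<in>I. f i \<eta>) = (\<Sum>i\<in>I. ev (f i))"
  by (simp add: ev_def sum_distrib_left sum.swap[of _ I])

lemma ev_const: "ev (\<lambda>\<eta>. c) = c"
  using p_sum by (simp add: ev_def sum_distrib_right[symmetric])

lemma ev_mono: "(\<And>\<eta>. \<eta> \<in> configs n \<Longrightarrow> f \<eta> \<le> g \<eta>) \<Longrightarrow> ev f \<le> ev g"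
  unfolding ev_def using p_pos by (intro sum_mono mult_left_mono) (auto intro: less_imp_le)

lemma ev_cong: "(\<And>\<eta>. \<eta> \<in> configs n \<Longrightarrow> f \<eta> = g \<eta>) \<Longrightarrow> ev f = ev g"
  unfolding ev_def by (intro sum.cong) auto

lemma abs_ev_le: "\<bar>ev f\<bar> \<le> ev (\<lambda>\<eta>. \<bar>f \<eta>\<bar>)"
proof -
  have "ev f \<le> ev (\<lambda>\<eta>. \<bar>f \<eta>\<bar>)" "ev (\<lambda>\<eta>. - 1 * f \<eta>) \<le> ev (\<lambda>\<eta>. \<bar>f \<eta>\<bar>)" by (rule ev_mono; simp)+
  then show ?thesis unfolding ev_cmult by simp
qed

lemma ev_nonneg: "(\<And>\<eta>. \<eta> \<in> configs n \<Longrightarrow> 0 \<le> f \<eta>) \<Longrightarrow> 0 \<le> ev f"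
  using ev_mono[of "\<lambda>_. 0" f] by (simp add: ev_const)

lemma ev_le_const: "(\<And>\<eta>. \<eta> \<in> configs n \<Longrightarrow> f \<eta> \<le> c) \<Longrightarrow> ev f \<le> c"
  using ev_mono[of f "\<lambda>_. c"] by (simp add: ev_const)

lemma dir_nonneg: "0 \<le> dir x y"
  by (simp add: dir_def sum_nonneg)

lemma energy_nonneg: "0 \<le> energy"
  by (simp add: energy_def sum_nonneg dir_nonneg)

text \<open>The gradient is odd under the exchange and g is even, so the expectation is half a sum
  of differences of p X across the exchange. Factoring the difference of p through square roots
  brings in the Dirichlet form; \<beta> weighs it against the second moment of X, and c pays for the
  variation of X.\<close>

lemma integration_by_parts:
  assumes x: "x \<in> torus n" and y: "y \<in> torus n" and \<beta>: "0 < \<beta>" and c: "0 \<le> c"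
    and g1: "\<And>\<eta>. \<eta> \<in> configs n \<Longrightarrow> \<bar>g \<eta>\<bar> \<le> 1"
    and g2: "\<And>\<eta>. \<eta> \<in> configs n \<Longrightarrow> g (exchange \<eta> x y) = g \<eta>"
    and X: "\<And>\<eta>. \<eta> \<in> configs n \<Longrightarrow> \<bar>X (exchange \<eta> x y) - X \<eta>\<bar> \<le> c"
  shows "\<bar>ev (\<lambda>\<eta>. g \<eta> * X \<eta> * (spin \<eta> x - spin \<eta> y))\<bar>
    \<le> \<beta> * dir x y + (2 * ev (\<lambda>\<eta>. (X \<eta>)\<^sup>2) + c\<^sup>2) / \<beta> + c"
proof -
  let ?C = "configs n"
  let ?e = "\<lambda>\<eta>. exchange \<eta> x y"
  let ?d = "\<lambda>\<eta>. spin \<eta> x - spin \<eta> y"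
  have d': "?d (?e \<eta>) = - ?d \<eta>" for \<eta> by (auto simp: spin_exchange)
  have gd: "\<bar>g \<eta> * ?d \<eta>\<bar> \<le> 2" if "\<eta> \<in> ?C" for \<eta>
  proof -
    have "\<bar>?d \<eta>\<bar> \<le> 2" using spin_values[OF that x] spin_values[OF that y] by auto
    then have "\<bar>g \<eta>\<bar> * \<bar>?d \<eta>\<bar> \<le> 1 * 2" using g1[OF that] by (intro mult_mono) auto
    then show ?thesis by (simp add: abs_mult)
  qed
  have "ev (\<lambda>\<eta>. g \<eta> * X \<eta> * ?d \<eta>) = (\<Sum>\<eta>\<in>?C. p (?e \<eta>) * (g (?e \<eta>) * X (?e \<eta>) * ?d (?e \<eta>)))"
    unfolding ev_def using sum_exchange[OF x y, where f="\<lambda>\<eta>. p \<eta> * (g \<eta> * X \<eta> * ?d \<eta>)"] by simp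
  also have "\<dots> = (\<Sum>\<eta>\<in>?C. - (p (?e \<eta>) * X (?e \<eta>) * (g \<eta> * ?d \<eta>)))"
    by (intro sum.cong) (simp_all only: d' g2, simp_all add: algebra_simps)
  finally have "2 * ev (\<lambda>\<eta>. g \<eta> * X \<eta> * ?d \<eta>) =
      (\<Sum>\<eta>\<in>?C. p \<eta> * (g \<eta> * X \<eta> * ?d \<eta>)) + (\<Sum>\<eta>\<in>?C. - (p (?e \<eta>) * X (?e \<eta>) * (g \<eta> * ?d \<eta>)))"
    unfolding ev_def by simp
  also have "\<dots> = (\<Sum>\<eta>\<in>?C. (p \<eta> * X \<eta> - p (?e \<eta>) * X (?e \<eta>)) * (g \<eta> * ?d \<eta>))"
    unfolding sum.distrib[symmetric] by (intro sum.cong) (simp_all add: algebra_simps)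
  finally have *: "2 * \<bar>ev (\<lambda>\<eta>. g \<eta> * X \<eta> * ?d \<eta>)\<bar> = \<bar>\<dots>\<bar>" by simp
  have "\<dots> \<le> (\<Sum>\<eta>\<in>?C. \<bar>(p \<eta> * X \<eta> - p (?e \<eta>) * X (?e \<eta>)) * (g \<eta> * ?d \<eta>)\<bar>)" by (rule sum_abs)
  also have "\<dots> \<le> (\<Sum>\<eta>\<in>?C. 2 * (\<beta> * (sqrt (p \<eta>) - sqrt (p (?e \<eta>)))\<^sup>2
       + (p \<eta> * (X \<eta>)\<^sup>2 + p (?e \<eta>) * (2 * (X (?e \<eta>))\<^sup>2 + 2 * c\<^sup>2)) / (2 * \<beta>) + p (?e \<eta>) * c))"
  proof (rule sum_mono)
    fix \<eta> assume \<eta>: "\<eta> \<in> ?C"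
    have \<eta>': "?e \<eta> \<in> ?C" using \<eta> x y by simp
    define u v X1 X2 where uv: "u = sqrt (p \<eta>)" "v = sqrt (p (?e \<eta>))" "X1 = X \<eta>" "X2 = X (?e \<eta>)"
    have u: "p \<eta> = u\<^sup>2" and v: "p (?e \<eta>) = v\<^sup>2" using p_pos[OF \<eta>] p_pos[OF \<eta>'] by (simp_all add: uv)
    have XX: "\<bar>X1 - X2\<bar> \<le> c" using X[OF \<eta>] by (simp add: uv abs_minus_commute)
    have "\<bar>u\<^sup>2 * X1 - v\<^sup>2 * X2\<bar> = \<bar>(u - v) * ((u + v) * X1) + v\<^sup>2 * (X1 - X2)\<bar>"
      by (simp add: power2_eq_square algebra_simps)
    also have "\<dots> \<le> \<bar>(u - v) * ((u + v) * X1)\<bar> + \<bar>v\<^sup>2 * (X1 - X2)\<bar>" by (rule abs_triangle_ineq)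
    also have "\<bar>v\<^sup>2 * (X1 - X2)\<bar> \<le> v\<^sup>2 * c" using XX by (simp add: abs_mult mult_left_mono)
    also have "\<bar>(u - v) * ((u + v) * X1)\<bar> \<le> \<beta> * (u - v)\<^sup>2 + ((u + v) * X1)\<^sup>2 / (4 * \<beta>)"
    proof -
      define s t where st: "s = \<bar>u - v\<bar>" "t = \<bar>(u + v) * X1\<bar>"
      have "0 \<le> (2 * \<beta> * s - t)\<^sup>2" by simp
      then have "4 * \<beta> * (s * t) \<le> 4 * \<beta> * (\<beta> * s\<^sup>2) + t\<^sup>2"
        by (simp add: power2_eq_square algebra_simps)
      then have "s * t \<le> \<beta> * s\<^sup>2 + t\<^sup>2 / (4 * \<beta>)" using \<beta> by (simp add: field_simps)
      then show ?thesis by (simp add: st abs_mult power_mult_distrib)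
    qed
    \<comment> \<open>The part weighted by v^2, the probability of the exchanged configuration, must
      carry X2 and not X1, so that reindexing turns it into an expectation.\<close>
    also have "((u + v) * X1)\<^sup>2 / (4 * \<beta>) \<le> (u\<^sup>2 * X1\<^sup>2 + v\<^sup>2 * (2 * X2\<^sup>2 + 2 * c\<^sup>2)) / (2 * \<beta>)"
    proof -
      have "0 \<le> (u - v)\<^sup>2" by simp
      then have "(u + v)\<^sup>2 \<le> 2 * (u\<^sup>2 + v\<^sup>2)" by (simp add: power2_eq_square algebra_simps)
      then have 1: "((u + v) * X1)\<^sup>2 \<le> 2 * (u\<^sup>2 * X1\<^sup>2 + v\<^sup>2 * X1\<^sup>2)"
        using mult_right_mono[of "(u + v)\<^sup>2" "2 * (u\<^sup>2 + v\<^sup>2)" "X1\<^sup>2"]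
        unfolding power_mult_distrib by (simp add: distrib_left distrib_right)
      have "(X1 - X2)\<^sup>2 \<le> c\<^sup>2" using XX c by (simp add: abs_le_square_iff[symmetric])
      moreover have "0 \<le> (X1 - 2 * X2)\<^sup>2" by simp
      ultimately have "X1\<^sup>2 \<le> 2 * X2\<^sup>2 + 2 * c\<^sup>2" by (simp add: power2_eq_square algebra_simps)
      then have "v\<^sup>2 * X1\<^sup>2 \<le> v\<^sup>2 * (2 * X2\<^sup>2 + 2 * c\<^sup>2)" by (intro mult_left_mono) auto
      with 1 have "((u + v) * X1)\<^sup>2 \<le> 2 * (u\<^sup>2 * X1\<^sup>2 + v\<^sup>2 * (2 * X2\<^sup>2 + 2 * c\<^sup>2))" by simp
      then show ?thesis using \<beta> by (simp add: field_simps)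
    qed
    finally have "\<bar>u\<^sup>2 * X1 - v\<^sup>2 * X2\<bar> \<le> \<beta> * (u - v)\<^sup>2 +
      (u\<^sup>2 * X1\<^sup>2 + v\<^sup>2 * (2 * X2\<^sup>2 + 2 * c\<^sup>2)) / (2 * \<beta>) + v\<^sup>2 * c" (is "_ \<le> ?r") by simp
    then have "\<bar>u\<^sup>2 * X1 - v\<^sup>2 * X2\<bar> * \<bar>g \<eta> * ?d \<eta>\<bar> \<le> ?r * 2"
      using gd[OF \<eta>] by (intro mult_mono) auto
    then show "\<bar>(p \<eta> * X \<eta> - p (?e \<eta>) * X (?e \<eta>)) * (g \<eta> * ?d \<eta>)\<bar> \<le> 2 * (\<beta> * (sqrt (p \<eta>) - sqrt (p (?e \<eta>)))\<^sup>2
       + (p \<eta> * (X \<eta>)\<^sup>2 + p (?e \<eta>) * (2 * (X (?e \<eta>))\<^sup>2 + 2 * c\<^sup>2)) / (2 * \<beta>) + p (?e \<eta>) * c)"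
      unfolding uv[symmetric] unfolding u v by (simp add: abs_mult mult.commute)
  qed
  also have "\<dots> = 2 * (\<beta> * dir x y + (ev (\<lambda>\<eta>. (X \<eta>)\<^sup>2) + ev (\<lambda>\<eta>. 2 * (X \<eta>)\<^sup>2 + 2 * c\<^sup>2)) / (2 * \<beta>) + ev (\<lambda>_. c))"
    unfolding sum_distrib_left[symmetric] sum.distrib sum_divide_distrib[symmetric] dir_def ev_def
    using sum_exchange[OF x y, where f="\<lambda>\<eta>. p \<eta> * (2 * (X \<eta>)\<^sup>2 + 2 * c\<^sup>2)"]
      sum_exchange[OF x y, where f="\<lambda>\<eta>. p \<eta> * c"] by simp
  also have "\<dots> = 2 * (\<beta> * dir x y + (3 * ev (\<lambda>\<eta>. (X \<eta>)\<^sup>2) + 2 * c\<^sup>2) / (2 * \<beta>) + c)"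
    by (simp add: ev_add ev_cmult ev_const)
  finally have fin: "2 * \<bar>ev (\<lambda>\<eta>. g \<eta> * X \<eta> * ?d \<eta>)\<bar> \<le> \<dots>" unfolding * .
  have "(3 * ev (\<lambda>\<eta>. (X \<eta>)\<^sup>2) + 2 * c\<^sup>2) / (2 * \<beta>) \<le> (2 * ev (\<lambda>\<eta>. (X \<eta>)\<^sup>2) + c\<^sup>2) / \<beta>"
    using \<beta> ev_nonneg[of "\<lambda>\<eta>. (X \<eta>)\<^sup>2"] by (simp add: field_simps)
  then show ?thesis using fin by argo
qed

lemma dir_commute: "dir x y = dir y x"
  by (simp add: dir_def exchange_commute[of _ x y])

lemma dir_L2: "sqrt (dir x y) = L2_set (\<lambda>\<eta>. sqrt (p \<eta>) - sqrt (p (exchange \<eta> x y))) (configs n)"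
  by (simp add: dir_def L2_set_def)

text \<open>The transposition of x and z is that of x and y conjugated by that of y and z. Since
  exchanges preserve counting measure, Minkowski's inequality charges one step across x, y and two
  across y, z.\<close>

lemma sqrt_dir_step:
  assumes "x \<in> torus n" "y \<in> torus n" "z \<in> torus n" "x \<noteq> y" "x \<noteq> z" "y \<noteq> z"
  shows "sqrt (dir x z) \<le> sqrt (dir x y) + 2 * sqrt (dir y z)"
proof -
  let ?f = "\<lambda>\<eta> x y. sqrt (p \<eta>) - sqrt (p (exchange \<eta> x y))"
  let ?a = "\<lambda>\<eta>. exchange \<eta> y z" and ?b = "\<lambda>\<eta>. exchange (exchange \<eta> y z) x y"
  have L2_inv: "L2_set (\<lambda>\<eta>. g (exchange \<eta> u v)) (configs n) = L2_set g (configs n)"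
    if "u \<in> torus n" "v \<in> torus n" for g u v
    unfolding L2_set_def using sum_exchange[OF that, of "\<lambda>\<eta>. (g \<eta>)\<^sup>2"] by simp
  have e: "exchange \<eta> x z = exchange (?b \<eta>) y z" for \<eta>
    using assms by (auto simp: exchange_def fun_eq_iff)
  have "sqrt (dir x z) = L2_set (\<lambda>\<eta>. ?f \<eta> y z + (?f (?a \<eta>) x y + ?f (?b \<eta>) y z)) (configs n)"
    unfolding dir_L2 by (intro L2_set_cong) (simp_all add: e)
  also have "\<dots> \<le> L2_set (\<lambda>\<eta>. ?f \<eta> y z) (configs n) +
      (L2_set (\<lambda>\<eta>. ?f (?a \<eta>) x y) (configs n) + L2_set (\<lambda>\<eta>. ?f (?b \<eta>) y z) (configs n))"
    using L2_set_triangle_ineq[of "\<lambda>\<eta>. ?f \<eta> y z" "\<lambda>\<eta>. ?f (?a \<eta>) x y + ?f (?b \<eta>) y z" "configs n"]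
      L2_set_triangle_ineq[of "\<lambda>\<eta>. ?f (?a \<eta>) x y" "\<lambda>\<eta>. ?f (?b \<eta>) y z" "configs n"] by linarith
  also have "\<dots> = sqrt (dir y z) + (sqrt (dir x y) + sqrt (dir y z))"
    using L2_inv[of y z "\<lambda>\<eta>. ?f \<eta> x y"] L2_inv[of y z "\<lambda>\<eta>. ?f (exchange \<eta> x y) y z"]
      L2_inv[of x y "\<lambda>\<eta>. ?f \<eta> y z"] assms by (simp add: dir_L2)
  finally show ?thesis by simp
qed

text \<open>A long exchange is built along a path of fewer than n bonds, never crossing the seam
  between n - 1 and 0. Each bond is charged at most twice, Cauchy-Schwarz gives 4 n times the sum of
  the bond forms, and the n^2 inside \<open>energy\<close> leaves 1 / n.\<close>

lemma dir_le_energy: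
  assumes x: "x \<in> torus n" and y: "y \<in> torus n"
  shows "dir x y \<le> 4 * energy / real n"
proof -
  have le: "dir x (x + int k) \<le> 4 * energy / real n" if x: "0 \<le> x" "x + int k < int n" for x k
  proof -
    have "sqrt (dir x (x + int k)) \<le> 2 * (\<Sum>z\<in>{x..<x + int k}. sqrt (dir z (right n z)))" using x(2)
    proof (induction k)
      case 0
      then show ?case by (simp add: dir_def)
    next
      case (Suc k)
      let ?y = "x + int k"
      have r: "right n ?y = x + int (Suc k)" using Suc.prems x by (simp add: right_def)
      have I: "{x..<x + int (Suc k)} = insert ?y {x..<?y}" by auto
      have "sqrt (dir x (x + int (Suc k))) \<le> sqrt (dir x ?y) + 2 * sqrt (dir ?y (x + int (Suc k)))"
      \<comment> \<open>\<open>sqrt_dir_step\<close> asks for three distinct sites, so the first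
        bond is separate.\<close>
      proof (cases "k = 0")
        case True
        then show ?thesis by (simp add: dir_nonneg)
      next
        case False
        then show ?thesis using Suc.prems x by (intro sqrt_dir_step) (auto simp: torus_def)
      qed
      also have "\<dots> \<le> 2 * (\<Sum>z\<in>{x..<x + int (Suc k)}. sqrt (dir z (right n z)))"
        using Suc.IH Suc.prems by (simp add: I r del: of_nat_Suc)
      finally show ?case .
    qed
    also have "\<dots> \<le> 2 * (\<Sum>z\<in>torus n. sqrt (dir z (right n z)))"
      using x by (intro mult_left_mono sum_mono2) (auto simp: torus_def dir_nonneg)
    finally have "(sqrt (dir x (x + int k)))\<^sup>2 \<le> (2 * (\<Sum>z\<in>torus n. sqrt (dir z (right n z))))\<^sup>2"
      by (intro power_mono) (auto simp: dir_nonneg)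
    then have "dir x (x + int k) \<le> 4 * (\<Sum>z\<in>torus n. sqrt (dir z (right n z)))\<^sup>2"
      by (simp add: dir_nonneg power_mult_distrib)
    also have "(\<Sum>z\<in>torus n. sqrt (dir z (right n z)))\<^sup>2 \<le> real n * (\<Sum>z\<in>torus n. (sqrt (dir z (right n z)))\<^sup>2)"
      using sum_squared_le_sum_of_squares[of "\<lambda>z. sqrt (dir z (right n z))" "torus n"]
      by (simp add: mult.commute)
    also have "\<dots> = energy / real n" by (simp add: dir_nonneg energy_def power2_eq_square n0')
    finally show ?thesis by simp
  qed
  show ?thesis
  proof (cases "x \<le> y")
    case True
    then show ?thesis using le[of x "nat (y - x)"] x y by (simp add: torus_def)
  next
    case False
    then show ?thesis using le[of y "nat (x - y)"] x y by (simp add: torus_def dir_commute)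
  qed
qed

end

section \<open>Second moments of mean-zero linear and quadratic statistics\<close>

context positive_law begin

text \<open>\<sigma>(x) - m is the average of \<sigma>(x) - \<sigma>(y) over y, so long exchanges
  control it. The constant 8 is the oscillation of a quadratic statistic under one exchange, and the
  exception at \<open>left n x\<close> lets \<open>g x\<close> be the left neighbour's spin. The
  quarter of the second moment on the right is meant to be absorbed when X is the sum
  itself.\<close>

lemma fluctuation_bound:
  assumes X: "\<And>\<eta> x y. \<eta> \<in> configs n \<Longrightarrow> x \<in> torus n \<Longrightarrow> y \<in> torus n \<Longrightarrow> \<bar>X (exchange \<eta> x y) - X \<eta>\<bar> \<le> 8"
    and \<phi>: "\<And>x. \<bar>\<phi> x\<bar> \<le> 1"
    and g1: "\<And>x \<eta>. \<eta> \<in> configs n \<Longrightarrow> \<bar>g x \<eta>\<bar> \<le> 1"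
    and g2: "\<And>x y \<eta>. \<eta> \<in> configs n \<Longrightarrow> x \<in> torus n \<Longrightarrow> y \<in> torus n \<Longrightarrow> y \<noteq> left n x \<Longrightarrow>
      g x (exchange \<eta> x y) = g x \<eta>"
  shows "\<bar>ev (\<lambda>\<eta>. X \<eta> * (\<Sum>x\<in>torus n. \<phi> x * g x \<eta> * (spin \<eta> x - mag n \<eta>)))\<bar>
    \<le> ev (\<lambda>\<eta>. (X \<eta>)\<^sup>2) / 4 + 64 * real n * (1 + energy)"
proof -
  define M where "M = ev (\<lambda>\<eta>. (X \<eta>)\<^sup>2)"
  define b where "b x y = ev (\<lambda>\<eta>. g x \<eta> * X \<eta> * (spin \<eta> x - spin \<eta> y))" for x y
  \<comment> \<open>Integration by parts with \<beta> = 16 n: summed over all pairs with weight 1 /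
    n, the second moment enters as M / 8.\<close>
  define B where "B = 16 * real n * (4 * energy / real n) + (2 * M + 8\<^sup>2) / (16 * real n) + 8"
  have M0: "0 \<le> M" unfolding M_def by (rule ev_nonneg) simp
  have B0: "0 \<le> B" unfolding B_def using M0 energy_nonneg by simp
  have mag: "spin \<eta> x - mag n \<eta> = (\<Sum>y\<in>torus n. (spin \<eta> x - spin \<eta> y) / real n)" for \<eta> x
    by (simp add: mag_def sum_subtractf sum_divide_distrib[symmetric] diff_divide_distrib n0')
  have "ev (\<lambda>\<eta>. X \<eta> * (\<Sum>x\<in>torus n. \<phi> x * g x \<eta> * (spin \<eta> x - mag n \<eta>)))
    = ev (\<lambda>\<eta>. \<Sum>x\<in>torus n. \<Sum>y\<in>torus n. \<phi> x / real n * (g x \<eta> * X \<eta> * (spin \<eta> x - spin \<eta> y)))"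
    unfolding mag by (simp add: sum_distrib_left algebra_simps diff_divide_distrib)
  also have "\<dots> = (\<Sum>x\<in>torus n. \<Sum>y\<in>torus n. \<phi> x / real n * b x y)"
    by (simp add: ev_sum ev_cmult b_def del: times_divide_eq_left)
  finally have eq: "ev (\<lambda>\<eta>. X \<eta> * (\<Sum>x\<in>torus n. \<phi> x * g x \<eta> * (spin \<eta> x - mag n \<eta>))) = \<dots>" .
  have b: "\<bar>b x y\<bar> \<le> B + (if y = left n x then 2 * ev (\<lambda>\<eta>. \<bar>X \<eta>\<bar>) else 0)"
    if xy: "x \<in> torus n" "y \<in> torus n" for x y
  \<comment> \<open>For this partner g is not invariant; the trivial bound is affordable because
    only n of the n^2 pairs are of this kind.\<close>
  proof (cases "y = left n x")
    case True
    have "\<bar>b x y\<bar> \<le> ev (\<lambda>\<eta>. \<bar>g x \<eta> * X \<eta> * (spin \<eta> x - spin \<eta> y)\<bar>)"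
      unfolding b_def by (rule abs_ev_le)
    also have "\<dots> \<le> ev (\<lambda>\<eta>. 2 * \<bar>X \<eta>\<bar>)"
    proof (rule ev_mono)
      fix \<eta> assume \<eta>: "\<eta> \<in> configs n"
      have "\<bar>spin \<eta> x - spin \<eta> y\<bar> \<le> 2" using spin_values[OF \<eta> xy(1)] spin_values[OF \<eta> xy(2)] by auto
      then have "\<bar>g x \<eta>\<bar> * \<bar>X \<eta>\<bar> * \<bar>spin \<eta> x - spin \<eta> y\<bar> \<le> 1 * \<bar>X \<eta>\<bar> * 2"
        using g1[OF \<eta>] by (intro mult_mono) auto
      then show "\<bar>g x \<eta> * X \<eta> * (spin \<eta> x - spin \<eta> y)\<bar> \<le> 2 * \<bar>X \<eta>\<bar>" by (simp add: abs_mult)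
    qed
    finally show ?thesis using True B0 by (simp add: ev_cmult)
  next
    case False
    have "\<bar>b x y\<bar> \<le> 16 * real n * dir x y + (2 * M + 8\<^sup>2) / (16 * real n) + 8"
      unfolding b_def M_def using xy X g1 g2[OF _ xy False] by (intro integration_by_parts) auto
    also have "16 * real n * dir x y \<le> 16 * real n * (4 * energy / real n)"
      using dir_le_energy[OF xy] by (intro mult_left_mono) auto
    finally show ?thesis using False by (simp add: B_def)
  qed
  have "\<bar>\<Sum>x\<in>torus n. \<Sum>y\<in>torus n. \<phi> x / real n * b x y\<bar> \<le> (\<Sum>x\<in>torus n. \<Sum>y\<in>torus n. \<bar>\<phi> x / real n * b x y\<bar>)"
    by (intro order.trans[OF sum_abs] sum_mono sum_abs)
  also have "\<dots> \<le> (\<Sum>x\<in>torus n. \<Sum>y\<in>torus n. 1 / real n * (B + (if y = left n x then 2 * ev (\<lambda>\<eta>. \<bar>X \<eta>\<bar>) else 0)))"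
  proof (intro sum_mono)
    fix x y assume xy: "x \<in> torus n" "y \<in> torus n"
    have "\<bar>\<phi> x / real n\<bar> * \<bar>b x y\<bar> \<le> 1 / real n * (B + (if y = left n x then 2 * ev (\<lambda>\<eta>. \<bar>X \<eta>\<bar>) else 0))"
      using b[OF xy] \<phi>[of x] by (intro mult_mono) (auto simp: divide_right_mono)
    then show "\<bar>\<phi> x / real n * b x y\<bar> \<le> 1 / real n * (B + (if y = left n x then 2 * ev (\<lambda>\<eta>. \<bar>X \<eta>\<bar>) else 0))"
      by (simp add: abs_mult)
  qed
  also have "\<dots> = real n * B + ev (\<lambda>\<eta>. 2 * \<bar>X \<eta>\<bar>)"
    by (simp add: sum.distrib sum_divide_distrib[symmetric] n0' ev_cmult power2_eq_square)
  \<comment> \<open>Young's inequality spends a second eighth of M on the exceptional pairs.\<close>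
  also have "ev (\<lambda>\<eta>. 2 * \<bar>X \<eta>\<bar>) \<le> ev (\<lambda>\<eta>. 1/8 * (X \<eta>)\<^sup>2 + 8)"
  proof (rule ev_mono)
    fix \<eta>
    have "0 \<le> (\<bar>X \<eta>\<bar> - 8)\<^sup>2" by simp
    then show "2 * \<bar>X \<eta>\<bar> \<le> 1/8 * (X \<eta>)\<^sup>2 + 8" by (simp add: power2_eq_square algebra_simps)
  qed
  also have "\<dots> = M / 8 + 8" by (simp only: ev_add ev_cmult ev_const M_def)
  also have "real n * B = 64 * real n * energy + M / 8 + 4 + 8 * real n"
    by (simp add: B_def field_simps n0')
  finally show ?thesis unfolding eq M_def[symmetric] using n5 by (simp add: algebra_simps)
qed

lemma pspin_exchange_diff:
  assumes "\<eta> \<in> configs n" "x \<in> torus n" "y \<in> torus n"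
  shows "\<bar>pspin n (exchange \<eta> x y) w - pspin n \<eta> w\<bar> \<le> (if w mod int n = x \<or> w mod int n = y then 2 else 0)"
proof -
  have "w mod int n \<noteq> x \<Longrightarrow> w mod int n \<noteq> y \<Longrightarrow> pspin n (exchange \<eta> x y) w = pspin n \<eta> w"
    by (simp add: pspin_exchange)
  moreover have "\<bar>pspin n (exchange \<eta> x y) w - pspin n \<eta> w\<bar> \<le> 2"
    using abs_pspin[of n \<eta> w] abs_pspin[of n "exchange \<eta> x y" w] assms by auto
  ultimately show ?thesis by auto
qed

lemma sum_two_le:
  assumes "0 \<le> c"
  shows "(\<Sum>w\<in>torus n. if (w + k) mod int n = x \<or> (w + k) mod int n = y then c else 0) \<le> 2 * (c::real)"
proof -
  have "(\<Sum>w\<in>torus n. if (w + k) mod int n = x \<or> (w + k) mod int n = y then c else 0) =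
     (\<Sum>w\<in>torus n. if w mod int n = x \<or> w mod int n = y then c else 0)"
    by (rule sum_torus_shift[where f="\<lambda>w. if w mod int n = x \<or> w mod int n = y then c else 0"]) simp_all
  also have "\<dots> \<le> (\<Sum>w\<in>torus n. (if w = x then c else 0) + (if w = y then c else 0))"
    using assms by (intro sum_mono) auto
  also have "\<dots> \<le> 2 * c" using assms by (simp add: sum.distrib)
  finally show ?thesis .
qed

text \<open>The statistic is its own test function: because \<phi> sums to 0, \<sigma> may be
  replaced by \<sigma> - m, and a quarter of the second moment moves back to the left.\<close>

lemma linear_bound:
  assumes \<phi>: "\<And>x. \<bar>\<phi> x\<bar> \<le> 1" and \<phi>0: "(\<Sum>x\<in>torus n. \<phi> x) = 0"
  shows "ev (\<lambda>\<eta>. (\<Sum>x\<in>torus n. \<phi> x * pspin n \<eta> x)\<^sup>2) \<le> 100 * real n * (1 + energy)"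
proof -
  define X where "X \<eta> = (\<Sum>x\<in>torus n. \<phi> x * pspin n \<eta> x)" for \<eta>
  have X': "X \<eta> = (\<Sum>x\<in>torus n. \<phi> x * 1 * (spin \<eta> x - mag n \<eta>))" for \<eta>
    by (simp add: X_def algebra_simps sum_subtractf sum_distrib_right[symmetric] \<phi>0 pspin_torus)
  have XL: "\<bar>X (exchange \<eta> x y) - X \<eta>\<bar> \<le> 8" if xy: "\<eta> \<in> configs n" "x \<in> torus n" "y \<in> torus n" for \<eta> x y
  proof -
    have "\<bar>X (exchange \<eta> x y) - X \<eta>\<bar> = \<bar>\<Sum>w\<in>torus n. \<phi> w * (pspin n (exchange \<eta> x y) w - pspin n \<eta> w)\<bar>"
      by (simp add: X_def sum_subtractf algebra_simps)
    also have "\<dots> \<le> (\<Sum>w\<in>torus n. \<bar>\<phi> w * (pspin n (exchange \<eta> x y) w - pspin n \<eta> w)\<bar>)" by (rule sum_abs)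
    also have "\<dots> \<le> (\<Sum>w\<in>torus n. 1 * (if (w + 0) mod int n = x \<or> (w + 0) mod int n = y then 2 else 0))"
      unfolding abs_mult add_0_right by (intro sum_mono mult_mono \<phi> pspin_exchange_diff[OF xy]) auto
    also have "\<dots> \<le> 2 * 2" unfolding mult_1 by (rule sum_two_le) simp
    finally show ?thesis by simp
  qed
  have "ev (\<lambda>\<eta>. (X \<eta>)\<^sup>2) = ev (\<lambda>\<eta>. X \<eta> * (\<Sum>x\<in>torus n. \<phi> x * 1 * (spin \<eta> x - mag n \<eta>)))"
    unfolding X'[symmetric] power2_eq_square ..
  moreover have "\<bar>\<dots>\<bar> \<le> ev (\<lambda>\<eta>. (X \<eta>)\<^sup>2) / 4 + 64 * real n * (1 + energy)"
    by (rule fluctuation_bound[where g="\<lambda>_ _. 1"]) (use XL \<phi> in auto)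
  ultimately have "3/4 * ev (\<lambda>\<eta>. (X \<eta>)\<^sup>2) \<le> 64 * (real n * (1 + energy))" by linarith
  moreover have "0 \<le> real n * (1 + energy)" using energy_nonneg by simp
  ultimately show ?thesis unfolding X_def by linarith
qed

text \<open>Centering only the right factor leaves a sum covered by
  \<open>fluctuation_bound\<close>, with the left spin as g, plus m times a linear statistic with
  shifted coefficients, covered by \<open>linear_bound\<close> since \<bar>m\<bar> \<le> 1. Two
  quarters of the second moment are absorbed.\<close>

lemma quadratic_bound:
  assumes \<phi>: "\<And>x. \<bar>\<phi> x\<bar> \<le> 1" and \<phi>0: "(\<Sum>x\<in>torus n. \<phi> x) = 0" and per: "\<And>x. \<phi> (x mod int n) = \<phi> x"
  shows "ev (\<lambda>\<eta>. (\<Sum>x\<in>torus n. \<phi> x * pspin n \<eta> (x - 1) * pspin n \<eta> x)\<^sup>2) \<le> 400 * real n * (1 + energy)"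
proof -
  define X where "X \<eta> = (\<Sum>x\<in>torus n. \<phi> x * pspin n \<eta> (x - 1) * pspin n \<eta> x)" for \<eta>
  define L where "L \<eta> = (\<Sum>x\<in>torus n. \<phi> (x + 1) * pspin n \<eta> x)" for \<eta>
  have per': "\<phi> (x mod int n + 1) = \<phi> (x + 1)" for x
    using per[of "x mod int n + 1"] per[of "x + 1"] by (simp add: mod_simps)
  have L': "L \<eta> = (\<Sum>x\<in>torus n. \<phi> x * pspin n \<eta> (x - 1))" for \<eta>
    using sum_torus_shift[of n "\<lambda>x. \<phi> (x + 1) * pspin n \<eta> x" "-1"] per' by (simp add: L_def)
  have X': "X \<eta> = (\<Sum>x\<in>torus n. \<phi> x * pspin n \<eta> (x - 1) * (spin \<eta> x - mag n \<eta>)) + mag n \<eta> * L \<eta>" for \<eta>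
    by (simp add: X_def L' algebra_simps sum_subtractf sum_distrib_left pspin_torus)
  have XL: "\<bar>X (exchange \<eta> x y) - X \<eta>\<bar> \<le> 8" if xy: "\<eta> \<in> configs n" "x \<in> torus n" "y \<in> torus n" for \<eta> x y
  proof -
    let ?\<zeta> = "exchange \<eta> x y"
    have \<zeta>: "?\<zeta> \<in> configs n" using xy by simp
    \<comment> \<open>An exchange alters two sites, each site lies in two products, and each product
      changes by at most 2 per altered factor: in all 8.\<close>
    have *: "\<bar>\<phi> w * pspin n ?\<zeta> (w - 1) * pspin n ?\<zeta> w - \<phi> w * pspin n \<eta> (w - 1) * pspin n \<eta> w\<bar>
      \<le> (if w mod int n = x \<or> w mod int n = y then 2 else 0)
        + (if (w - 1) mod int n = x \<or> (w - 1) mod int n = y then 2 else 0)" for w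
    proof -
      have eq: "\<phi> w * pspin n ?\<zeta> (w - 1) * pspin n ?\<zeta> w - \<phi> w * pspin n \<eta> (w - 1) * pspin n \<eta> w =
        \<phi> w * (pspin n ?\<zeta> (w - 1) * (pspin n ?\<zeta> w - pspin n \<eta> w) + pspin n \<eta> w * (pspin n ?\<zeta> (w - 1) - pspin n \<eta> (w - 1)))"
        by (simp add: algebra_simps)
      have "\<bar>\<phi> w * pspin n ?\<zeta> (w - 1) * pspin n ?\<zeta> w - \<phi> w * pspin n \<eta> (w - 1) * pspin n \<eta> w\<bar>
        \<le> 1 * (\<bar>pspin n ?\<zeta> w - pspin n \<eta> w\<bar> + \<bar>pspin n ?\<zeta> (w - 1) - pspin n \<eta> (w - 1)\<bar>)"
        unfolding eq abs_mult[of "\<phi> w"]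
      proof (intro mult_mono \<phi>)
        show "\<bar>pspin n ?\<zeta> (w - 1) * (pspin n ?\<zeta> w - pspin n \<eta> w) + pspin n \<eta> w * (pspin n ?\<zeta> (w - 1) - pspin n \<eta> (w - 1))\<bar>
          \<le> \<bar>pspin n ?\<zeta> w - pspin n \<eta> w\<bar> + \<bar>pspin n ?\<zeta> (w - 1) - pspin n \<eta> (w - 1)\<bar>"
          by (rule order.trans[OF abs_triangle_ineq]) (simp add: abs_mult abs_pspin[OF n0 \<zeta>] abs_pspin[OF n0 xy(1)])
      qed auto
      also have "\<dots> \<le> (if w mod int n = x \<or> w mod int n = y then 2 else 0)
        + (if (w - 1) mod int n = x \<or> (w - 1) mod int n = y then 2 else 0)"
        unfolding mult_1 by (intro add_mono pspin_exchange_diff xy)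
      finally show ?thesis .
    qed
    have "\<bar>X ?\<zeta> - X \<eta>\<bar> \<le> (\<Sum>w\<in>torus n. \<bar>\<phi> w * pspin n ?\<zeta> (w - 1) * pspin n ?\<zeta> w - \<phi> w * pspin n \<eta> (w - 1) * pspin n \<eta> w\<bar>)"
      unfolding X_def sum_subtractf[symmetric] by (rule sum_abs)
    also have "\<dots> \<le> 2 * 2 + 2 * 2"
      using sum_two_le[of 2 0 x y] sum_two_le[of 2 "-1" x y]
      by (intro order.trans[OF sum_mono[OF *]]) (simp add: sum.distrib)
    finally show ?thesis by simp
  qed
  have lr: "left n x \<noteq> x" if "x \<in> torus n" for x
  proof -
    have "\<not> int n dvd - 1" using n5 by auto
    then have "(x - 1) mod int n \<noteq> x mod int n" by (simp add: mod_eq_dvd_iff)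
    then show ?thesis using that by (simp add: left_def)
  qed
  have "ev (\<lambda>\<eta>. (X \<eta>)\<^sup>2) = ev (\<lambda>\<eta>. X \<eta> * (\<Sum>x\<in>torus n. \<phi> x * pspin n \<eta> (x - 1) * (spin \<eta> x - mag n \<eta>)))
     + ev (\<lambda>\<eta>. X \<eta> * (mag n \<eta> * L \<eta>))"
    unfolding ev_add[symmetric] power2_eq_square distrib_left[symmetric] X'[symmetric] ..
  moreover have "\<bar>ev (\<lambda>\<eta>. X \<eta> * (\<Sum>x\<in>torus n. \<phi> x * pspin n \<eta> (x - 1) * (spin \<eta> x - mag n \<eta>)))\<bar>
     \<le> ev (\<lambda>\<eta>. (X \<eta>)\<^sup>2) / 4 + 64 * real n * (1 + energy)"
  proof (rule fluctuation_bound[where g="\<lambda>x \<eta>. pspin n \<eta> (x - 1)"])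
    fix x y \<eta> assume "\<eta> \<in> configs n" "x \<in> torus n" "y \<in> torus n" "y \<noteq> left n x"
    then show "pspin n (exchange \<eta> x y) (x - 1) = pspin n \<eta> (x - 1)"
      using lr[of x] by (simp add: pspin_exchange left_def[symmetric])
  qed (use XL \<phi> in \<open>auto simp: abs_pspin\<close>)
  moreover have "ev (\<lambda>\<eta>. X \<eta> * (mag n \<eta> * L \<eta>)) \<le> ev (\<lambda>\<eta>. 1/4 * (X \<eta>)\<^sup>2 + (L \<eta>)\<^sup>2)"
  proof (rule ev_mono)
    fix \<eta> assume \<eta>: "\<eta> \<in> configs n"
    have "\<bar>mag n \<eta>\<bar> * \<bar>X \<eta> * L \<eta>\<bar> \<le> 1 * \<bar>X \<eta> * L \<eta>\<bar>"
      using abs_mag_le[OF n0 \<eta>] by (intro mult_right_mono) auto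
    then have "X \<eta> * (mag n \<eta> * L \<eta>) \<le> \<bar>X \<eta>\<bar> * \<bar>L \<eta>\<bar>"
      unfolding abs_mult[symmetric] mult_1 by (simp add: mult.left_commute abs_le_iff)
    moreover have "0 \<le> (\<bar>X \<eta>\<bar> / 2 - \<bar>L \<eta>\<bar>)\<^sup>2" by simp
    ultimately show "X \<eta> * (mag n \<eta> * L \<eta>) \<le> 1/4 * (X \<eta>)\<^sup>2 + (L \<eta>)\<^sup>2"
      by (simp add: power2_eq_square algebra_simps)
  qed
  moreover have "ev (\<lambda>\<eta>. 1/4 * (X \<eta>)\<^sup>2 + (L \<eta>)\<^sup>2) = 1/4 * ev (\<lambda>\<eta>. (X \<eta>)\<^sup>2) + ev (\<lambda>\<eta>. (L \<eta>)\<^sup>2)"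
    by (simp only: ev_add ev_cmult)
  moreover have "ev (\<lambda>\<eta>. (L \<eta>)\<^sup>2) \<le> 100 * real n * (1 + energy)"
    unfolding L_def using \<phi> \<phi>0 sum_torus_shift[of n \<phi> 1] per by (intro linear_bound) auto
  moreover have "0 \<le> real n * (1 + energy)" using energy_nonneg by simp
  ultimately have "ev (\<lambda>\<eta>. (X \<eta>)\<^sup>2) \<le> 400 * (real n * (1 + energy))" by linarith
  then show ?thesis unfolding X_def by simp
qed

end

section \<open>Replacement of local products by powers of the magnetization\<close>

text \<open>Discrete sawtooth of slope -1 / n with a jump at the multiples of n. The additive
  constant makes it sum to zero over a period, as \<open>linear_bound\<close> and
  \<open>quadratic_bound\<close> require of their coefficients.\<close>

definition saw :: "nat \<Rightarrow> int \<Rightarrow> real" where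
  "saw n r = (real n - 1) / (2 * real n) - real_of_int (r mod int n) / real n"

lemma saw_mod [simp]: "saw n (r mod int n) = saw n r"
  by (simp add: saw_def)

lemma saw_cong: "r mod int n = r' mod int n \<Longrightarrow> saw n r = saw n r'"
  by (metis saw_mod)

lemma saw_diff_mod: "saw n (z - w mod int n - k) = saw n (z - w - k)"
proof (rule saw_cong)
  have "z - w mod int n - k = z - k - w mod int n" "z - w - k = z - k - w" by simp_all
  then show "(z - w mod int n - k) mod int n = (z - w - k) mod int n" by (simp only: mod_diff_right_eq)
qed

lemma abs_saw_le:
  assumes "0 < n" shows "\<bar>saw n r\<bar> \<le> 1 / 2"
proof -
  define k where "k = r mod int n"
  have "0 \<le> k" "k \<le> int n - 1" using assms by (simp_all add: k_def)
  then have "0 \<le> real_of_int k" "real_of_int k \<le> real n - 1" by linarith+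
  then have "0 \<le> real_of_int k / real n" "real_of_int k / real n \<le> (real n - 1) / real n"
    using assms by (simp_all add: divide_right_mono)
  moreover have "(real n - 1) / real n \<le> 1" using assms by simp
  moreover have "(real n - 1) / (2 * real n) = (real n - 1) / real n / 2" by simp
  ultimately show ?thesis unfolding saw_def k_def[symmetric] by linarith
qed

text \<open>The increments are a unit mass at 0 minus the uniform mass; summation by parts therefore
  reproduces a value minus the mean.\<close>

lemma saw_step:
  assumes "0 < n"
  shows "saw n r - saw n (r - 1) = (if r mod int n = 0 then 1 else 0) - 1 / real n"
proof -
  have "r mod int n = (r - 1) mod int n + 1 \<and> r mod int n \<noteq> 0 \<or> r mod int n = 0 \<and> (r - 1) mod int n = int n - 1"
  proof (cases "r mod int n = 0")
    case True
    then have "(r - 1) mod int n = (- 1) mod int n" by (metis diff_0 mod_diff_left_eq)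
    then show ?thesis using True assms by (simp add: zmod_minus1)
  next
    case False
    then have "(r mod int n - 1) mod int n = r mod int n - 1"
      using assms by (intro mod_pos_pos_trivial) (auto intro: less_trans[of _ "r mod int n"] simp: int_one_le_iff_zero_less order_neq_le_trans)
    then show ?thesis using False by (simp add: mod_diff_left_eq)
  qed
  then have "real_of_int (r mod int n) = real_of_int ((r - 1) mod int n) + 1 \<and> r mod int n \<noteq> 0
      \<or> r mod int n = 0 \<and> real_of_int ((r - 1) mod int n) = real n - 1"
    by (metis of_int_1 of_int_add of_int_diff of_int_of_nat_eq)
  then show ?thesis using assms by (elim disjE conjE) (simp_all add: saw_def diff_divide_distrib add_divide_distrib)
qed

lemma sum_saw:
  assumes "0 < n" shows "(\<Sum>x\<in>torus n. saw n x) = 0"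
proof -
  have "(\<Sum>x\<in>torus n. real_of_int (x mod int n)) = (\<Sum>k<n. real k)"
    by (rule sum.reindex_bij_witness[where i=int and j=nat]) (auto simp: torus_def)
  also have "\<dots> = real n * (real n - 1) / 2" by (induction n) (auto simp: field_simps)
  finally show ?thesis using assms
    by (simp add: saw_def sum_subtractf sum_divide_distrib[symmetric])
qed

text \<open>The discrete Green function \<^const>\<open>saw\<close> turns a deviation from the mean into a sum of gradients.\<close>

lemma pspin_minus_mag:
  assumes n: "0 < n"
  shows "pspin n \<eta> x - mag n \<eta> = (\<Sum>z\<in>torus n. saw n (z - x) * (pspin n \<eta> z - pspin n \<eta> (z + 1)))"
proof -
  let ?s = "pspin n \<eta>"
  have per: "saw n (w mod int n - k) = saw n (w - k)" for w k by (rule saw_cong) (simp add: mod_simps)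
  have "(\<Sum>z\<in>torus n. saw n (z - x) * ?s (z + 1)) = (\<Sum>z\<in>torus n. saw n (z + 1 - x - 1) * ?s (z + 1))"
    by simp
  also have "\<dots> = (\<Sum>z\<in>torus n. saw n (z - x - 1) * ?s z)"
    by (rule sum_torus_shift[where f="\<lambda>z. saw n (z - x - 1) * ?s z"])
      (use n per[of _ "x + 1"] in \<open>simp_all add: diff_diff_eq\<close>)
  finally have "(\<Sum>z\<in>torus n. saw n (z - x) * (?s z - ?s (z + 1))) =
      (\<Sum>z\<in>torus n. (saw n (z - x) - saw n (z - x - 1)) * ?s z)"
    by (simp add: algebra_simps sum_subtractf)
  also have "\<dots> = (\<Sum>z\<in>torus n. (if z = x mod int n then 1 else 0) * ?s z - 1 / real n * ?s z)"
  proof (rule sum.cong)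
    fix z assume z: "z \<in> torus n"
    have "(z - x) mod int n = 0 \<longleftrightarrow> z mod int n = x mod int n" by (simp add: mod_eq_dvd_iff dvd_eq_mod_eq_0)
    then show "(saw n (z - x) - saw n (z - x - 1)) * ?s z = (if z = x mod int n then 1 else 0) * ?s z - 1 / real n * ?s z"
      using z unfolding saw_step[OF n] by (simp add: left_diff_distrib)
  qed simp
  also have "\<dots> = ?s x - mag n \<eta>"
    using n by (simp add: sum_subtractf if_distrib[of "\<lambda>a. a * _"] mag_pspin sum_divide_distrib cong: if_cong)
  finally show ?thesis ..
qed

definition pair_dev :: "nat \<Rightarrow> int \<Rightarrow> config \<Rightarrow> real" where
  "pair_dev n k \<eta> = (\<Sum>x\<in>torus n. pspin n \<eta> x * pspin n \<eta> (x + k)) - real n * (mag n \<eta>)\<^sup>2"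

definition triple_dev :: "nat \<Rightarrow> config \<Rightarrow> real" where
  "triple_dev n \<eta> = (\<Sum>x\<in>torus n. pspin n \<eta> (x - 1) * pspin n \<eta> x * pspin n \<eta> (x + 1)) - real n * (mag n \<eta>) ^ 3"

text \<open>Centering the second factor is free, because the sum of \<sigma>(x) m is n m^2. The
  Green function then moves the gradient outside, and the remaining kernel is a mean-zero linear
  statistic.\<close>

lemma pair_dev_gradient:
  assumes n: "0 < n"
  shows "pair_dev n k \<eta> = (\<Sum>z\<in>torus n.
    (\<Sum>x\<in>torus n. saw n (z - x - k) * pspin n \<eta> x) * (pspin n \<eta> z - pspin n \<eta> (z + 1)))"
proof -
  let ?s = "pspin n \<eta>"
  have "pair_dev n k \<eta> = (\<Sum>x\<in>torus n. ?s x * (?s (x + k) - mag n \<eta>))"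
    using n sum_pspin[OF n, of \<eta> 0]
    by (simp add: pair_dev_def algebra_simps sum_subtractf sum_distrib_left[symmetric] power2_eq_square)
  also have "\<dots> = (\<Sum>x\<in>torus n. \<Sum>z\<in>torus n. saw n (z - x - k) * ?s x * (?s z - ?s (z + 1)))"
    unfolding pspin_minus_mag[OF n] by (simp add: sum_distrib_left diff_diff_eq mult_ac)
  also have "\<dots> = (\<Sum>z\<in>torus n. (\<Sum>x\<in>torus n. saw n (z - x - k) * ?s x) * (?s z - ?s (z + 1)))"
    by (subst sum.swap) (simp add: sum_distrib_right)
  finally show ?thesis .
qed

text \<open>Only the last factor is centered; the defect is m times the nearest-neighbour pair
  error, which is already of gradient form.\<close>

lemma triple_dev_gradient:
  assumes n: "0 < n"
  shows "triple_dev n \<eta> = (\<Sum>z\<in>torus n.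
    (\<Sum>x\<in>torus n. saw n (z - x - 1) * pspin n \<eta> (x - 1) * pspin n \<eta> x) * (pspin n \<eta> z - pspin n \<eta> (z + 1)))
    + mag n \<eta> * pair_dev n 1 \<eta>"
proof -
  let ?s = "pspin n \<eta>"
  have per: "pspin n \<eta> (x mod int n + k) = pspin n \<eta> (x + k)" for x k
    by (simp add: pspin_def mod_simps)
  have 1: "(\<Sum>x\<in>torus n. ?s (x - 1) * ?s x) = (\<Sum>x\<in>torus n. ?s x * ?s (x + 1))"
    using sum_torus_shift[OF n, of "\<lambda>x. ?s x * ?s (x + 1)" "-1"] per by simp
  have "triple_dev n \<eta> - mag n \<eta> * pair_dev n 1 \<eta> = (\<Sum>x\<in>torus n. ?s (x - 1) * ?s x * (?s (x + 1) - mag n \<eta>))"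
    unfolding triple_dev_def pair_dev_def 1[symmetric]
    by (simp add: algebra_simps sum_subtractf sum_distrib_left[symmetric] power2_eq_square power3_eq_cube)
  also have "\<dots> = (\<Sum>x\<in>torus n. \<Sum>z\<in>torus n. saw n (z - x - 1) * ?s (x - 1) * ?s x * (?s z - ?s (z + 1)))"
    unfolding pspin_minus_mag[OF n] by (simp add: sum_distrib_left diff_diff_eq mult_ac)
  also have "\<dots> = (\<Sum>z\<in>torus n. (\<Sum>x\<in>torus n. saw n (z - x - 1) * ?s (x - 1) * ?s x) * (?s z - ?s (z + 1)))"
    by (subst sum.swap) (simp add: sum_distrib_right)
  finally show ?thesis by simp
qed

section \<open>Bounds for the replacement errors in terms of the energy\<close>

context positive_law begin

lemma sum_saw_shift: "(\<Sum>x\<in>torus n. saw n (z - x - k)) = 0"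
  using sum_torus_reflect[of n "saw n" "z - k"] sum_saw[OF n0] by (simp add: algebra_simps)

text \<open>Reduces distinctness on the circle to distinctness of integers; with 5 \<le> n it covers
  all the local offsets that occur.\<close>

lemma mod_eq_small_iff:
  "(a mod int n = b mod int n) \<longleftrightarrow> a = b" if "\<bar>a - b\<bar> < int n"
proof
  assume "a mod int n = b mod int n"
  then have "int n dvd (a - b)" by (simp add: mod_eq_dvd_iff)
  then show "a = b" using that by (metis dvd_imp_le_int eq_iff_diff_eq_0 linorder_not_less of_nat_0_le_iff abs_of_nonneg)
qed simp

lemma pspin_exchange_right:
  assumes "z \<in> torus n"
  shows "pspin n (exchange \<eta> z (right n z)) w =
    (if w mod int n = (z + 1) mod int n then pspin n \<eta> z
     else if w mod int n = z mod int n then pspin n \<eta> (z + 1) else pspin n \<eta> w)"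
  using assms unfolding pspin_exchange right_def by (simp add: pspin_def)

text \<open>With \<beta> = n^2 the bond forms add up to exactly \<open>energy\<close>. A kernel with
  second moment of order n and increments of order 1 / n then costs only O(1 + energy). Any bounded
  function of the magnetization can ride along, since exchanges preserve it.\<close>

lemma gradient_bound:
  assumes F1: "\<And>\<eta>. \<eta> \<in> configs n \<Longrightarrow> \<bar>F (mag n \<eta>)\<bar> \<le> 1"
    and G2: "\<And>z. z \<in> torus n \<Longrightarrow> ev (\<lambda>\<eta>. (G z \<eta>)\<^sup>2) \<le> M" and c: "0 \<le> c"
    and GX: "\<And>z \<eta>. z \<in> torus n \<Longrightarrow> \<eta> \<in> configs n \<Longrightarrow> \<bar>G z (exchange \<eta> z (right n z)) - G z \<eta>\<bar> \<le> c"
  shows "\<bar>\<Sum>z\<in>torus n. ev (\<lambda>\<eta>. F (mag n \<eta>) * G z \<eta> * (spin \<eta> z - spin \<eta> (right n z)))\<bar>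
    \<le> energy + (2 * M + c\<^sup>2) / real n + c * real n"
proof -
  let ?I = "\<lambda>z. ev (\<lambda>\<eta>. F (mag n \<eta>) * G z \<eta> * (spin \<eta> z - spin \<eta> (right n z)))"
  have "\<bar>\<Sum>z\<in>torus n. ?I z\<bar> \<le> (\<Sum>z\<in>torus n. \<bar>?I z\<bar>)" by (rule sum_abs)
  also have "\<dots> \<le> (\<Sum>z\<in>torus n. (real n)\<^sup>2 * dir z (right n z) + (2 * M + c\<^sup>2) / (real n)\<^sup>2 + c)"
  proof (rule sum_mono)
    fix z assume z: "z \<in> torus n"
    have "\<bar>?I z\<bar> \<le> (real n)\<^sup>2 * dir z (right n z) + (2 * ev (\<lambda>\<eta>. (G z \<eta>)\<^sup>2) + c\<^sup>2) / (real n)\<^sup>2 + c"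
      using z F1 c GX[OF z] by (intro integration_by_parts) (auto simp: mag_exchange)
    also have "(2 * ev (\<lambda>\<eta>. (G z \<eta>)\<^sup>2) + c\<^sup>2) / (real n)\<^sup>2 \<le> (2 * M + c\<^sup>2) / (real n)\<^sup>2"
      using G2[OF z] by (intro divide_right_mono) auto
    finally show "\<bar>?I z\<bar> \<le> (real n)\<^sup>2 * dir z (right n z) + (2 * M + c\<^sup>2) / (real n)\<^sup>2 + c" by simp
  qed
  also have "\<dots> = energy + (2 * M + c\<^sup>2) / real n + c * real n"
    unfolding sum.distrib sum_distrib_left[symmetric] energy_def[symmetric]
    by (simp add: power2_eq_square n0')
  finally show ?thesis .
qed

text \<open>\<open>linear_bound\<close> gives the second moment of the kernel. Its increment under
  the exchange of z and z + 1 is one step of the sawtooth times a spin difference, and k = 1 or 2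
  keeps that step away from the jump, so it is only 1 / n.\<close>

lemma pair_bound:
  assumes F1: "\<And>\<eta>. \<eta> \<in> configs n \<Longrightarrow> \<bar>F (mag n \<eta>)\<bar> \<le> 1" and k: "k = 1 \<or> k = 2"
  shows "\<bar>ev (\<lambda>\<eta>. F (mag n \<eta>) * pair_dev n k \<eta>)\<bar> \<le> 300 * (1 + energy)"
proof -
  define G where "G z \<eta> = (\<Sum>x\<in>torus n. saw n (z - x - k) * pspin n \<eta> x)" for z \<eta>
  have G2: "ev (\<lambda>\<eta>. (G z \<eta>)\<^sup>2) \<le> 100 * real n * (1 + energy)" for z
    unfolding G_def
    by (intro linear_bound order.trans[OF abs_saw_le] sum_saw_shift) auto
  have GX: "\<bar>G z (exchange \<eta> z (right n z)) - G z \<eta>\<bar> \<le> 2 / real n"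
    if z: "z \<in> torus n" and \<eta>: "\<eta> \<in> configs n" for z \<eta>
  proof -
    let ?\<zeta> = "exchange \<eta> z (right n z)"
    have ne: "(z + 1) mod int n \<noteq> z mod int n" using n5 by (simp add: mod_eq_small_iff)
    have d: "pspin n ?\<zeta> w - pspin n \<eta> w = ((if w = (z + 1) mod int n then 1 else 0) - (if w = z mod int n then 1 else 0)) * (pspin n \<eta> z - pspin n \<eta> (z + 1))"
      if "w \<in> torus n" for w
    proof -
      have "w = (z + 1) mod int n \<Longrightarrow> pspin n \<eta> w = pspin n \<eta> (z + 1)" "w = z mod int n \<Longrightarrow> pspin n \<eta> w = pspin n \<eta> z"
        by simp_all
      then show ?thesis using that ne unfolding pspin_exchange_right[OF z] by auto
    qed
    have "G z ?\<zeta> - G z \<eta> = (\<Sum>x\<in>torus n. saw n (z - x - k) * (pspin n ?\<zeta> x - pspin n \<eta> x))"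
      by (simp add: G_def sum_subtractf algebra_simps)
    also have "\<dots> = (\<Sum>x\<in>torus n. ((if x = (z + 1) mod int n then saw n (z - x - k) else 0) - (if x = z mod int n then saw n (z - x - k) else 0)) * (pspin n \<eta> z - pspin n \<eta> (z + 1)))"
      by (intro sum.cong) (auto simp: d)
    also have "\<dots> = (saw n (z - (z + 1) mod int n - k) - saw n (z - z mod int n - k)) * (pspin n \<eta> z - pspin n \<eta> (z + 1))"
      unfolding sum_distrib_right[symmetric] sum_subtractf by simp
    also have "saw n (z - (z + 1) mod int n - k) = saw n (- k - 1)"
      unfolding saw_diff_mod by (rule arg_cong[where f="saw n"]) simp
    also have "saw n (z - z mod int n - k) = saw n (- k)" by (simp add: saw_diff_mod)
    also have "saw n (- k - 1) - saw n (- k) = 1 / real n"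
    proof -
      have "(- k) mod int n \<noteq> 0 mod int n" using k n5 by (subst mod_eq_small_iff) auto
      then show ?thesis using saw_step[OF n0, of "- k"] by simp
    qed
    finally have "\<bar>G z ?\<zeta> - G z \<eta>\<bar> = 1 / real n * \<bar>pspin n \<eta> z - pspin n \<eta> (z + 1)\<bar>"
      by (simp add: abs_mult)
    also have "\<dots> \<le> 1 / real n * 2"
      using pspin_values[OF n0 \<eta>, of z] pspin_values[OF n0 \<eta>, of "z + 1"] by (intro mult_left_mono) auto
    finally show ?thesis by simp
  qed
  have "ev (\<lambda>\<eta>. F (mag n \<eta>) * pair_dev n k \<eta>)
    = (\<Sum>z\<in>torus n. ev (\<lambda>\<eta>. F (mag n \<eta>) * G z \<eta> * (spin \<eta> z - spin \<eta> (right n z))))"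
    unfolding ev_sum[symmetric] pair_dev_gradient[OF n0] G_def[symmetric]
    by (intro ev_cong) (simp add: sum_distrib_left pspin_torus spin_right mult.assoc)
  also have "\<bar>\<dots>\<bar> \<le> energy + (2 * (100 * real n * (1 + energy)) + (2 / real n)\<^sup>2) / real n + 2 / real n * real n"
    by (intro gradient_bound F1 G2 GX) auto
  also have "\<dots> = energy + 200 * (1 + energy) + 4 / real n ^ 3 + 2"
    by (simp add: field_simps power2_eq_square power3_eq_cube n0')
  also have "\<dots> \<le> 300 * (1 + energy)"
  proof -
    have "e + 200 * (1 + e) + r + 2 \<le> 300 * (1 + e)" if "r \<le> 4" "0 \<le> e" for e r :: real
      using that by simp
    moreover have "4 / real n ^ 3 \<le> 4" using n5 by (simp add: field_simps)
    ultimately show ?thesis using energy_nonneg by blast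
  qed
  finally show ?thesis .
qed

text \<open>The kernel is now quadratic, and the exchange of z and z + 1 changes two of its terms by
  order one, too much for \<open>gradient_bound\<close>. These terms are split off as
  \<open>r\<close>; the rest \<open>G\<close> is exactly invariant, and the contribution
  \<open>R\<close> of the split-off terms is bounded pointwise.\<close>

lemma triple_bound:
  assumes F1: "\<And>\<eta>. \<eta> \<in> configs n \<Longrightarrow> \<bar>F (mag n \<eta>)\<bar> \<le> 1"
  shows "\<bar>ev (\<lambda>\<eta>. F (mag n \<eta>) * triple_dev n \<eta>)\<bar> \<le> 2000 * (1 + energy)"
proof -
  define f where "f z \<eta> x = saw n (z - x - 1) * pspin n \<eta> (x - 1) * pspin n \<eta> x" for z \<eta> x
  \<comment> \<open>The terms x = z and x = z + 2 contain exactly one of the two exchanged spins.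
    The term x = z + 1 contains both and is symmetric, so it may stay.\<close>
  define r where "r z \<eta> = saw n (- 1) * (pspin n \<eta> (z - 1) * pspin n \<eta> z) + saw n (- 3) * (pspin n \<eta> (z + 1) * pspin n \<eta> (z + 2))" for z \<eta>
  define G where "G z \<eta> = (\<Sum>x\<in>torus n - {z, (z + 2) mod int n}. f z \<eta> x)" for z \<eta>
  define R where "R \<eta> = (\<Sum>z\<in>torus n. r z \<eta> * (pspin n \<eta> z - pspin n \<eta> (z + 1)))" for \<eta>
  have per: "pspin n \<eta> (x mod int n + k) = pspin n \<eta> (x + k)" "pspin n \<eta> (x mod int n - k) = pspin n \<eta> (x - k)" for \<eta> x k
    by (simp_all add: pspin_def mod_simps)
  have sumf: "(\<Sum>x\<in>torus n. f z \<eta> x) = G z \<eta> + r z \<eta>" if z: "z \<in> torus n" for z \<eta>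
  proof -
    have "(z + 2) mod int n \<noteq> z mod int n" using n5 by (subst mod_eq_small_iff) auto
    then have ne: "(z + 2) mod int n \<noteq> z" using z by simp
    have "f z \<eta> ((z + 2) mod int n) = saw n (- 3) * (pspin n \<eta> (z + 1) * pspin n \<eta> (z + 2))"
      unfolding f_def saw_diff_mod per by (simp add: add.commute)
    moreover have "torus n - {z, (z + 2) mod int n} = torus n - {z} - {(z + 2) mod int n}" by auto
    ultimately show ?thesis
      using z ne sum.remove[of "torus n" z "f z \<eta>"] sum.remove[of "torus n - {z}" "(z + 2) mod int n" "f z \<eta>"]
      by (simp add: G_def r_def f_def)
  qed
  have Ginv: "G z (exchange \<eta> z (right n z)) = G z \<eta>" if z: "z \<in> torus n" for z \<eta>
    unfolding G_def
  proof (rule sum.cong)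
    fix x assume x: "x \<in> torus n - {z, (z + 2) mod int n}"
    then have 1: "x mod int n \<noteq> z mod int n" "x mod int n \<noteq> (z + 2) mod int n" using z by auto
    have 2: "(x - 1) mod int n = z mod int n \<longleftrightarrow> x mod int n = (z + 1) mod int n"
      "(x - 1) mod int n = (z + 1) mod int n \<longleftrightarrow> x mod int n = (z + 2) mod int n"
      by (simp_all add: mod_eq_dvd_iff algebra_simps)
    have 3: "(z + 1) mod int n \<noteq> z mod int n" using n5 by (subst mod_eq_small_iff) auto
    have 4: "w mod int n = w' mod int n \<Longrightarrow> pspin n \<eta> w = pspin n \<eta> w'" for w w' by (simp add: pspin_def)
    show "f z (exchange \<eta> z (right n z)) x = f z \<eta> x"
      unfolding f_def pspin_exchange_right[OF z] using 1 2 3 4[of x "z + 1"] 4[of "x - 1" z]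
      by (cases "x mod int n = (z + 1) mod int n") simp_all
  qed simp
  have r1: "\<bar>r z \<eta>\<bar> \<le> 1" if \<eta>: "\<eta> \<in> configs n" for z \<eta>
  proof -
    have "\<bar>r z \<eta>\<bar> \<le> \<bar>saw n (- 1)\<bar> + \<bar>saw n (- 3)\<bar>"
      unfolding r_def by (rule order.trans[OF abs_triangle_ineq]) (simp add: abs_mult abs_pspin[OF n0 \<eta>])
    then show ?thesis using abs_saw_le[OF n0, of "-1"] abs_saw_le[OF n0, of "-3"] by simp
  qed
  have G2: "ev (\<lambda>\<eta>. (G z \<eta>)\<^sup>2) \<le> 800 * real n * (1 + energy) + 2" if z: "z \<in> torus n" for z
  proof -
    have "ev (\<lambda>\<eta>. (G z \<eta>)\<^sup>2) \<le> ev (\<lambda>\<eta>. 2 * (\<Sum>x\<in>torus n. f z \<eta> x)\<^sup>2 + 2)"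
    proof (rule ev_mono)
      fix \<eta> assume \<eta>: "\<eta> \<in> configs n"
      define A where "A = (\<Sum>x\<in>torus n. f z \<eta> x)"
      have "(r z \<eta>)\<^sup>2 \<le> 1" using r1[OF \<eta>, of z] by (simp add: abs_square_le_1)
      moreover have "0 \<le> (A + r z \<eta>)\<^sup>2" by simp
      moreover have G: "G z \<eta> = A - r z \<eta>" using sumf[OF z] by (simp add: A_def)
      ultimately show "(G z \<eta>)\<^sup>2 \<le> 2 * (\<Sum>x\<in>torus n. f z \<eta> x)\<^sup>2 + 2"
        unfolding A_def[symmetric] G by (simp add: power2_eq_square algebra_simps)
    qed
    also have "\<dots> = 2 * ev (\<lambda>\<eta>. (\<Sum>x\<in>torus n. f z \<eta> x)\<^sup>2) + 2" by (simp only: ev_add ev_cmult ev_const)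
    also have "ev (\<lambda>\<eta>. (\<Sum>x\<in>torus n. f z \<eta> x)\<^sup>2) \<le> 400 * real n * (1 + energy)"
      unfolding f_def
      by (intro quadratic_bound order.trans[OF abs_saw_le] sum_saw_shift) (auto simp: saw_diff_mod)
    finally show ?thesis by simp
  qed
  \<comment> \<open>Squares of spins are 1, so only single spins and triple products are left, with
    total coefficient \<open>saw n (- 1) - saw n (- 3)\<close>, which is -2 / n. This offsets the
    number of sites.\<close>
  have R4: "\<bar>R \<eta>\<bar> \<le> 4" if \<eta>: "\<eta> \<in> configs n" for \<eta>
  proof -
    let ?s = "pspin n \<eta>"
    let ?T = "\<Sum>x\<in>torus n. ?s (x - 1) * ?s x * ?s (x + 1)"
    have T': "(\<Sum>z\<in>torus n. ?s z * ?s (z + 1) * ?s (z + 2)) = ?T"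
      using sum_torus_shift[OF n0, of "\<lambda>x. ?s (x - 1) * ?s x * ?s (x + 1)" 1] per by (simp add: add.assoc)
    have "R \<eta> = (\<Sum>z\<in>torus n. saw n (- 1) * (?s (z - 1) - ?s (z - 1) * ?s z * ?s (z + 1))
        + saw n (- 3) * (?s z * ?s (z + 1) * ?s (z + 2) - ?s (z + 2)))"
      unfolding R_def
    proof (rule sum.cong)
      fix z
      have "r z \<eta> * (?s z - ?s (z + 1)) = saw n (- 1) * (?s (z - 1) * (?s z * ?s z) - ?s (z - 1) * ?s z * ?s (z + 1))
        + saw n (- 3) * (?s z * ?s (z + 1) * ?s (z + 2) - ?s (z + 1) * ?s (z + 1) * ?s (z + 2))"
        by (simp add: r_def algebra_simps)
      then show "r z \<eta> * (?s z - ?s (z + 1)) = saw n (- 1) * (?s (z - 1) - ?s (z - 1) * ?s z * ?s (z + 1))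
        + saw n (- 3) * (?s z * ?s (z + 1) * ?s (z + 2) - ?s (z + 2))"
        by (simp add: pspin_mult_self[OF n0 \<eta>])
    qed simp
    also have "\<dots> = saw n (- 1) * (real n * mag n \<eta> - ?T) + saw n (- 3) * (?T - real n * mag n \<eta>)"
      unfolding sum.distrib sum_distrib_left[symmetric] sum_subtractf T'
      using sum_pspin[OF n0, of \<eta> "-1"] sum_pspin[OF n0, of \<eta> 2] by simp
    also have "\<dots> = (saw n (- 1) - saw n (- 3)) * (real n * mag n \<eta> - ?T)" by (simp add: algebra_simps)
    also have "saw n (- 1) - saw n (- 3) = - 2 / real n"
    proof -
      have "(- 1) mod int n = int n - 1" using n0 by (simp add: zmod_minus1)
      moreover have "(- 3) mod int n = int n - 3"
        using n5 mod_pos_pos_trivial[of "int n - 3" "int n"] mod_add_self1[of "int n" "-3"] by simp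
      ultimately have "real_of_int ((- 1) mod int n) = real n - 1" "real_of_int ((- 3) mod int n) = real n - 3"
        by (simp_all only: of_int_diff of_int_of_nat_eq of_int_1 of_int_numeral)
      then show ?thesis unfolding saw_def by (simp add: diff_divide_distrib)
    qed
    finally have "\<bar>R \<eta>\<bar> = \<bar>- 2 / real n\<bar> * \<bar>real n * mag n \<eta> - ?T\<bar>" by (simp only: abs_mult)
    then have "\<bar>R \<eta>\<bar> = 2 / real n * \<bar>real n * mag n \<eta> - ?T\<bar>" by simp
    also have "\<dots> \<le> 2 / real n * (2 * real n)"
    proof (intro mult_left_mono)
      have "\<bar>?T\<bar> \<le> (\<Sum>x\<in>torus n. \<bar>?s (x - 1) * ?s x * ?s (x + 1)\<bar>)" by (rule sum_abs)
      then have "\<bar>?T\<bar> \<le> real n" by (simp add: abs_mult abs_pspin[OF n0 \<eta>])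
      moreover have "\<bar>real n * mag n \<eta>\<bar> \<le> real n"
        using abs_mag_le[OF n0 \<eta>] by (simp add: abs_mult mult_left_le)
      ultimately show "\<bar>real n * mag n \<eta> - ?T\<bar> \<le> 2 * real n" by linarith
    qed simp
    finally show ?thesis by (simp add: n0')
  qed
  have main: "\<bar>\<Sum>z\<in>torus n. ev (\<lambda>\<eta>. F (mag n \<eta>) * G z \<eta> * (spin \<eta> z - spin \<eta> (right n z)))\<bar>
     \<le> energy + 1600 * (1 + energy) + 4 / real n"
  proof -
    have "energy + (2 * (800 * real n * (1 + energy) + 2) + 0\<^sup>2) / real n + 0 * real n = energy + 1600 * (1 + energy) + 4 / real n"
      by (simp add: field_simps n0')
    then show ?thesis
      using gradient_bound[of F G "800 * real n * (1 + energy) + 2" 0] F1 G2 Ginv by simp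
  qed
  have "ev (\<lambda>\<eta>. F (mag n \<eta>) * triple_dev n \<eta>) = ev (\<lambda>\<eta>. (\<Sum>z\<in>torus n. F (mag n \<eta>) * G z \<eta> * (spin \<eta> z - spin \<eta> (right n z)))
     + F (mag n \<eta>) * R \<eta> + (F (mag n \<eta>) * mag n \<eta>) * pair_dev n 1 \<eta>)"
  proof (rule ev_cong)
    fix \<eta>
    have "triple_dev n \<eta> = (\<Sum>z\<in>torus n. (G z \<eta> + r z \<eta>) * (pspin n \<eta> z - pspin n \<eta> (z + 1))) + mag n \<eta> * pair_dev n 1 \<eta>"
      unfolding triple_dev_gradient[OF n0] using sumf[of _ \<eta>] by (simp add: f_def)
    also have "\<dots> = (\<Sum>z\<in>torus n. G z \<eta> * (spin \<eta> z - spin \<eta> (right n z))) + R \<eta> + mag n \<eta> * pair_dev n 1 \<eta>"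
      by (simp add: R_def distrib_right sum.distrib spin_right pspin_torus)
    finally show "F (mag n \<eta>) * triple_dev n \<eta> = (\<Sum>z\<in>torus n. F (mag n \<eta>) * G z \<eta> * (spin \<eta> z - spin \<eta> (right n z)))
     + F (mag n \<eta>) * R \<eta> + (F (mag n \<eta>) * mag n \<eta>) * pair_dev n 1 \<eta>"
      by (simp add: algebra_simps sum_distrib_left)
  qed
  also have "\<dots> = (\<Sum>z\<in>torus n. ev (\<lambda>\<eta>. F (mag n \<eta>) * G z \<eta> * (spin \<eta> z - spin \<eta> (right n z))))
     + ev (\<lambda>\<eta>. F (mag n \<eta>) * R \<eta>) + ev (\<lambda>\<eta>. (F (mag n \<eta>) * mag n \<eta>) * pair_dev n 1 \<eta>)"
    by (simp only: ev_add ev_sum)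
  also have "\<bar>\<dots>\<bar> \<le> (energy + 1600 * (1 + energy) + 4 / real n) + 4 + 300 * (1 + energy)"
  proof (intro order.trans[OF abs_triangle_ineq] add_mono main)
    have FR: "\<bar>F (mag n \<eta>)\<bar> * \<bar>R \<eta>\<bar> \<le> 1 * 4" if "\<eta> \<in> configs n" for \<eta>
      using that F1 R4 by (intro mult_mono) auto
    show "\<bar>ev (\<lambda>\<eta>. F (mag n \<eta>) * R \<eta>)\<bar> \<le> 4"
      by (rule order.trans[OF abs_ev_le]) (use FR in \<open>auto intro!: ev_le_const simp: abs_mult\<close>)
    have "\<bar>F (mag n \<eta>)\<bar> * \<bar>mag n \<eta>\<bar> \<le> 1 * 1" if "\<eta> \<in> configs n" for \<eta>
      using that F1 abs_mag_le[OF n0] by (intro mult_mono) auto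
    then show "\<bar>ev (\<lambda>\<eta>. (F (mag n \<eta>) * mag n \<eta>) * pair_dev n 1 \<eta>)\<bar> \<le> 300 * (1 + energy)"
      using pair_bound[where F="\<lambda>m. F m * m" and k=1] by (simp add: abs_mult)
  qed
  also have "\<dots> \<le> 2000 * (1 + energy)"
  proof -
    have "e + 1600 * (1 + e) + r + 4 + 300 * (1 + e) \<le> 2000 * (1 + e)" if "r \<le> 4" "0 \<le> e" for e r :: real
      using that by simp
    moreover have "4 / real n \<le> 4" using n5 by (simp add: field_simps)
    ultimately show ?thesis using energy_nonneg by blast
  qed
  finally show ?thesis .
qed

lemma ev_rescale:
  assumes "0 < B" "\<bar>ev (\<lambda>\<eta>. F \<eta> / B * D \<eta>)\<bar> \<le> K"
  shows "\<bar>ev (\<lambda>\<eta>. F \<eta> * D \<eta>)\<bar> \<le> B * K"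
proof -
  have "ev (\<lambda>\<eta>. F \<eta> * D \<eta>) = B * ev (\<lambda>\<eta>. F \<eta> / B * D \<eta>)"
    unfolding ev_cmult[symmetric] using assms by (intro ev_cong) simp
  then show ?thesis using assms by (simp add: abs_mult)
qed

lemma dev_bounds:
  assumes B: "0 < B" and F: "\<And>\<eta>. \<eta> \<in> configs n \<Longrightarrow> \<bar>F (mag n \<eta>)\<bar> \<le> B"
  shows "\<bar>ev (\<lambda>\<eta>. F (mag n \<eta>) * pair_dev n 1 \<eta>)\<bar> \<le> B * (300 * (1 + energy))"
    "\<bar>ev (\<lambda>\<eta>. F (mag n \<eta>) * pair_dev n 2 \<eta>)\<bar> \<le> B * (300 * (1 + energy))"
    "\<bar>ev (\<lambda>\<eta>. F (mag n \<eta>) * triple_dev n \<eta>)\<bar> \<le> B * (2000 * (1 + energy))"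
proof -
  have F1: "\<bar>F (mag n \<eta>) / B\<bar> \<le> 1" if "\<eta> \<in> configs n" for \<eta> using F[OF that] B by simp
  show "\<bar>ev (\<lambda>\<eta>. F (mag n \<eta>) * pair_dev n 1 \<eta>)\<bar> \<le> B * (300 * (1 + energy))"
    "\<bar>ev (\<lambda>\<eta>. F (mag n \<eta>) * pair_dev n 2 \<eta>)\<bar> \<le> B * (300 * (1 + energy))"
    "\<bar>ev (\<lambda>\<eta>. F (mag n \<eta>) * triple_dev n \<eta>)\<bar> \<le> B * (2000 * (1 + energy))"
    using pair_bound[of "\<lambda>m. F m / B"] triple_bound[of "\<lambda>m. F m / B"] F1
    by (auto intro!: ev_rescale B)
qed

end

section \<open>Entropy production\<close>

lemma mag_flip:
  assumes "x \<in> torus n" "\<eta> \<in> configs n"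
  shows "mag n (flip \<eta> x) = mag n \<eta> - 2 * spin \<eta> x / real n"
proof -
  have "(\<Sum>w\<in>torus n. spin (flip \<eta> x) w) = (\<Sum>w\<in>torus n. spin \<eta> w - (if w = x then 2 * spin \<eta> x else 0))"
    by (intro sum.cong) (use config_values[OF assms(2,1)] in \<open>auto simp: spin_def flip_def\<close>)
  also have "\<dots> = (\<Sum>w\<in>torus n. spin \<eta> w) - 2 * spin \<eta> x"
    using assms by (simp add: sum_subtractf)
  finally show ?thesis by (simp add: mag_def diff_divide_distrib)
qed

definition particles :: "nat \<Rightarrow> config \<Rightarrow> nat" where
  "particles n \<eta> = (\<Sum>x\<in>torus n. \<eta> x)"

lemma particles_mag: "0 < n \<Longrightarrow> mag n \<eta> = (2 * real (particles n \<eta>) - real n) / real n"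
  by (simp add: mag_def spin_def particles_def sum_subtractf sum_distrib_left)

lemma particles_exchange:
  "0 < n \<Longrightarrow> x \<in> torus n \<Longrightarrow> y \<in> torus n \<Longrightarrow> particles n (exchange \<eta> x y) = particles n \<eta>"
  using particles_mag[of n \<eta>] particles_mag[of n "exchange \<eta> x y"] by (simp add: mag_exchange)

lemma particles_flip:
  assumes n: "0 < n" and x: "x \<in> torus n" and \<eta>: "\<eta> \<in> configs n"
  shows "spin \<eta> x = - 1 \<Longrightarrow> particles n (flip \<eta> x) = Suc (particles n \<eta>)"
    and "spin \<eta> x = 1 \<Longrightarrow> Suc (particles n (flip \<eta> x)) = particles n \<eta>"
proof -
  have "real n * mag n (flip \<eta> x) = real n * mag n \<eta> - 2 * spin \<eta> x"
    using mag_flip[OF x \<eta>] n by (simp add: field_simps)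
  moreover have "real n * mag n \<zeta> = 2 * real (particles n \<zeta>) - real n" for \<zeta>
    using particles_mag[OF n, of \<zeta>] n by simp
  ultimately have "real (particles n (flip \<eta> x)) = real (particles n \<eta>) - spin \<eta> x" by simp
  then show "spin \<eta> x = - 1 \<Longrightarrow> particles n (flip \<eta> x) = Suc (particles n \<eta>)"
    and "spin \<eta> x = 1 \<Longrightarrow> Suc (particles n (flip \<eta> x)) = particles n \<eta>" by linarith+
qed

lemma rate_pspin:
  "x \<in> torus n \<Longrightarrow> rate \<theta> n x \<eta> = 1 - gamma \<theta> n * pspin n \<eta> x * (pspin n \<eta> (x - 1) + pspin n \<eta> (x + 1))
     + (gamma \<theta> n)\<^sup>2 * (pspin n \<eta> (x - 1) * pspin n \<eta> (x + 1))"
  by (simp add: rate_def spin_left spin_right pspin_torus)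

lemma pspin_flip:
  assumes "x \<in> torus n" "\<eta> \<in> configs n"
  shows "pspin n (flip \<eta> x) w = (if w mod int n = x then - pspin n \<eta> w else pspin n \<eta> w)"
  using config_values[OF assms(2,1)] by (auto simp: pspin_def spin_def flip_def)

lemma rate_flip:
  assumes n: "1 < n" and x: "x \<in> torus n" and \<eta>: "\<eta> \<in> configs n"
  shows "rate \<theta> n x (flip \<eta> x) = 1 + gamma \<theta> n * pspin n \<eta> x * (pspin n \<eta> (x - 1) + pspin n \<eta> (x + 1))
     + (gamma \<theta> n)\<^sup>2 * (pspin n \<eta> (x - 1) * pspin n \<eta> (x + 1))"
proof -
  have "\<not> int n dvd 1" "\<not> int n dvd - 1" using n by auto
  then have "(x - 1) mod int n \<noteq> x mod int n" "(x + 1) mod int n \<noteq> x mod int n"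
    by (simp_all add: mod_eq_dvd_iff)
  then show ?thesis using x \<eta> by (simp add: rate_pspin pspin_flip)
qed

text \<open>Since \<sigma>(x)^2 = 1, the rate factors over the two bonds at x; positivity and the
  bound 4 can be read off for 0 < \<gamma> < 1.\<close>

lemma rate_product:
  assumes n: "0 < n" and x: "x \<in> torus n" and \<eta>: "\<eta> \<in> configs n"
  shows "rate \<theta> n x \<eta> = (1 - gamma \<theta> n * pspin n \<eta> x * pspin n \<eta> (x - 1)) * (1 - gamma \<theta> n * pspin n \<eta> x * pspin n \<eta> (x + 1))"
proof -
  have "(1 - gamma \<theta> n * pspin n \<eta> x * pspin n \<eta> (x - 1)) * (1 - gamma \<theta> n * pspin n \<eta> x * pspin n \<eta> (x + 1)) =
    1 - gamma \<theta> n * pspin n \<eta> x * (pspin n \<eta> (x - 1) + pspin n \<eta> (x + 1))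
     + (gamma \<theta> n)\<^sup>2 * (pspin n \<eta> (x - 1) * pspin n \<eta> (x + 1)) * (pspin n \<eta> x * pspin n \<eta> x)"
    by (simp add: algebra_simps power2_eq_square)
  then show ?thesis by (simp add: rate_pspin[OF x] pspin_mult_self[OF n \<eta>])
qed

lemma rate_pos:
  assumes n: "0 < n" and x: "x \<in> torus n" and \<eta>: "\<eta> \<in> configs n" and g: "0 < gamma \<theta> n" "gamma \<theta> n < 1"
  shows "0 < rate \<theta> n x \<eta>"
  unfolding rate_product[OF n x \<eta>]
  using pspin_values[OF n \<eta>, of x] pspin_values[OF n \<eta>, of "x - 1"] pspin_values[OF n \<eta>, of "x + 1"] g
  by (intro mult_pos_pos) auto

lemma rate_le:
  assumes n: "0 < n" and x: "x \<in> torus n" and \<eta>: "\<eta> \<in> configs n" and g: "0 < gamma \<theta> n" "gamma \<theta> n < 1"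
  shows "rate \<theta> n x \<eta> \<le> 4"
proof -
  have "1 - gamma \<theta> n * pspin n \<eta> x * pspin n \<eta> w \<le> 2" "0 \<le> 1 - gamma \<theta> n * pspin n \<eta> x * pspin n \<eta> w" for w
    using pspin_values[OF n \<eta>, of x] pspin_values[OF n \<eta>, of w] g by auto
  then have "rate \<theta> n x \<eta> \<le> 2 * 2" unfolding rate_product[OF n x \<eta>] by (intro mult_mono) auto
  then show ?thesis by simp
qed

section \<open>Entropy relative to the mean-field weight\<close>

locale stationary_law = positive_law n p for n p +
  fixes \<theta> a :: real
  assumes a0: "0 < a"
    and stationary: "\<And>f. ev (gen \<theta> a n f) = 0"
    and gamma_bounds: "1 / 4 \<le> gamma \<theta> n" "gamma \<theta> n \<le> 3 / 4"
begin

abbreviation "\<gamma> \<equiv> gamma \<theta> n"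

lemma gamma01: "0 < \<gamma>" "\<gamma> < 1" using gamma_bounds by auto

text \<open>Quotient of the mean-field flip rates: with both neighbours replaced by m, an upward
  flip has rate (1 + \<gamma> m)^2 and a downward one (1 - \<gamma> m)^2.\<close>

definition odds :: "real \<Rightarrow> real" where
  "odds m = ((1 + \<gamma> * m) / (1 - \<gamma> * m))\<^sup>2"

text \<open>Logarithm of an unnormalized birth-death weight: adding a particle to j particles
  multiplies it by the odds at the magnetization of level j.\<close>

definition log_weight :: "nat \<Rightarrow> real" where
  "log_weight k = (\<Sum>j<k. ln (odds ((2 * real j - real n) / real n)))"

text \<open>The adjoint of the flip generator with respect to this weight, applied to the constant
  1. It would vanish if the flips left the weight invariant.\<close>

definition drift :: "config \<Rightarrow> real" where
  "drift \<eta> = (\<Sum>x\<in>torus n. rate \<theta> n x (flip \<eta> x) *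
     exp (log_weight (particles n (flip \<eta> x)) - log_weight (particles n \<eta>)) - rate \<theta> n x \<eta>)"

text \<open>The weight drops out because exchanges keep the particle number. Using ln t \<le> t - 1
  at the square root of the ratio of probabilities, not at the ratio itself, leaves the square of
  the Dirichlet form next to a difference that sums to zero.\<close>

lemma entropy_exchange:
  "ev (gen_ex n (\<lambda>\<eta>. ln (p \<eta>) - log_weight (particles n \<eta>))) \<le> - (energy / (real n)\<^sup>2)"
proof -
  let ?f = "\<lambda>\<eta>. ln (p \<eta>) - log_weight (particles n \<eta>)"
  have "ev (gen_ex n ?f) = (\<Sum>z\<in>torus n. ev (\<lambda>\<eta>. ?f (exchange \<eta> z (right n z)) - ?f \<eta>))"
    unfolding gen_ex_def by (rule ev_sum)
  also have "\<dots> \<le> (\<Sum>z\<in>torus n. - dir z (right n z))"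
  proof (rule sum_mono)
    fix z assume z: "z \<in> torus n"
    let ?e = "\<lambda>\<eta>. exchange \<eta> z (right n z)"
    have "ev (\<lambda>\<eta>. ?f (?e \<eta>) - ?f \<eta>) \<le> (\<Sum>\<eta>\<in>configs n. - (sqrt (p \<eta>) - sqrt (p (?e \<eta>)))\<^sup>2 + (p (?e \<eta>) - p \<eta>))"
      unfolding ev_def
    proof (rule sum_mono)
      fix \<eta> assume \<eta>: "\<eta> \<in> configs n"
      define u v where uv: "u = sqrt (p \<eta>)" "v = sqrt (p (?e \<eta>))"
      have pp: "0 < p \<eta>" "0 < p (?e \<eta>)" using p_pos \<eta> z by simp_all
      then have p: "p \<eta> = u\<^sup>2" "p (?e \<eta>) = v\<^sup>2" "0 < u" "0 < v" by (simp_all add: uv)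
      have "ln (v / u) \<le> v / u - 1" using p by (intro ln_le_minus_one) simp
      then have "u\<^sup>2 * (2 * ln v - 2 * ln u) \<le> u\<^sup>2 * (2 * (v / u - 1))"
        using p by (intro mult_left_mono) (simp_all add: ln_div)
      also have "\<dots> = - (u - v)\<^sup>2 + (v\<^sup>2 - u\<^sup>2)" using p by (simp add: power2_eq_square field_simps)
      finally show "p \<eta> * (?f (?e \<eta>) - ?f \<eta>) \<le> - (sqrt (p \<eta>) - sqrt (p (?e \<eta>)))\<^sup>2 + (p (?e \<eta>) - p \<eta>)"
        unfolding uv[symmetric] using z p by (simp add: particles_exchange ln_realpow)
    qed
    also have "\<dots> = - dir z (right n z)"
      unfolding sum.distrib sum_subtractf sum_negf dir_def
      using sum_exchange[of z n "right n z" p] z by simp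
    finally show "ev (\<lambda>\<eta>. ?f (?e \<eta>) - ?f \<eta>) \<le> - dir z (right n z)" .
  qed
  also have "\<dots> = - (energy / (real n)\<^sup>2)" by (simp add: energy_def sum_negf n0')
  finally show ?thesis .
qed

text \<open>Here ln t \<le> t - 1 is applied to the full ratio of densities relative to the weight.
  Reindexing by the flip then moves the increment from the density to the weight, where it becomes
  \<open>drift\<close>.\<close>

lemma entropy_flip:
  "ev (gen_G \<theta> n (\<lambda>\<eta>. ln (p \<eta>) - log_weight (particles n \<eta>))) \<le> ev drift"
proof -
  let ?g = "\<lambda>\<eta>. log_weight (particles n \<eta>)"
  let ?f = "\<lambda>\<eta>. ln (p \<eta>) - ?g \<eta>"
  have "ev (gen_G \<theta> n ?f) = (\<Sum>x\<in>torus n. ev (\<lambda>\<eta>. rate \<theta> n x \<eta> * (?f (flip \<eta> x) - ?f \<eta>)))"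
    unfolding gen_G_def by (rule ev_sum)
  also have "\<dots> \<le> (\<Sum>x\<in>torus n. ev (\<lambda>\<eta>. rate \<theta> n x (flip \<eta> x) * exp (?g (flip \<eta> x) - ?g \<eta>) - rate \<theta> n x \<eta>))"
  proof (rule sum_mono)
    fix x assume x: "x \<in> torus n"
    let ?h = "\<lambda>\<eta>. rate \<theta> n x (flip \<eta> x) * (p \<eta> * exp (?g (flip \<eta> x) - ?g \<eta>))"
    have "ev (\<lambda>\<eta>. rate \<theta> n x \<eta> * (?f (flip \<eta> x) - ?f \<eta>))
      \<le> (\<Sum>\<eta>\<in>configs n. ?h (flip \<eta> x) - rate \<theta> n x \<eta> * p \<eta>)"
      unfolding ev_def
    proof (rule sum_mono)
      fix \<eta> assume \<eta>: "\<eta> \<in> configs n"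
      have pp: "0 < p \<eta>" "0 < p (flip \<eta> x)" using p_pos \<eta> x by simp_all
      define t where "t = p (flip \<eta> x) / p \<eta> * exp (?g \<eta> - ?g (flip \<eta> x))"
      have "?f (flip \<eta> x) - ?f \<eta> = ln t"
        using pp unfolding t_def by (subst ln_mult) (simp_all add: ln_div)
      also have "\<dots> \<le> t - 1" using pp by (intro ln_le_minus_one) (simp add: t_def)
      finally have "rate \<theta> n x \<eta> * p \<eta> * (?f (flip \<eta> x) - ?f \<eta>) \<le> rate \<theta> n x \<eta> * p \<eta> * (t - 1)"
        using rate_pos[OF n0 x \<eta> gamma01] pp by (intro mult_left_mono) auto
      moreover have "p \<eta> * t = p (flip \<eta> x) * exp (?g \<eta> - ?g (flip \<eta> x))"
        using pp by (simp add: t_def)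
      then have "rate \<theta> n x \<eta> * p \<eta> * (t - 1) = ?h (flip \<eta> x) - rate \<theta> n x \<eta> * p \<eta>"
        using \<eta> x by (simp add: right_diff_distrib mult.assoc)
      ultimately show "p \<eta> * (rate \<theta> n x \<eta> * (?f (flip \<eta> x) - ?f \<eta>)) \<le> ?h (flip \<eta> x) - rate \<theta> n x \<eta> * p \<eta>"
        by (simp add: mult_ac)
    qed
    also have "\<dots> = ev (\<lambda>\<eta>. rate \<theta> n x (flip \<eta> x) * exp (?g (flip \<eta> x) - ?g \<eta>) - rate \<theta> n x \<eta>)"
      unfolding sum_subtractf sum_flip[OF x, of ?h] ev_def by (simp add: algebra_simps sum_subtractf)
    finally show "ev (\<lambda>\<eta>. rate \<theta> n x \<eta> * (?f (flip \<eta> x) - ?f \<eta>)) \<le> \<dots>" .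
  qed
  also have "\<dots> = ev drift" unfolding drift_def by (rule ev_sum[symmetric])
  finally show ?thesis .
qed

text \<open>Stationarity is tested on the logarithm of the density relative to the weight. The speed
  n^2 of the exchanges matches the normalization of \<open>energy\<close>, so the only factor left
  in front of the drift is a.\<close>

lemma energy_le_drift: "energy \<le> a * ev drift"
proof -
  let ?f = "\<lambda>\<eta>. ln (p \<eta>) - log_weight (particles n \<eta>)"
  have "0 = (real n)\<^sup>2 * ev (gen_ex n ?f) + a * ev (gen_G \<theta> n ?f)"
    using stationary[of ?f] unfolding gen_def ev_add ev_cmult by simp
  also have "\<dots> \<le> (real n)\<^sup>2 * (- (energy / (real n)\<^sup>2)) + a * ev drift"
    using a0 by (intro add_mono mult_left_mono entropy_exchange entropy_flip) auto
  finally show ?thesis by (simp add: n0')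
qed

end

section \<open>The drift as a combination of replacement errors\<close>

context stationary_law begin

lemma one_plus_bounds:
  assumes "\<bar>m\<bar> \<le> 1"
  shows "1 / 4 \<le> 1 + \<gamma> * m" "1 + \<gamma> * m \<le> 7 / 4" "1 / 4 \<le> 1 - \<gamma> * m" "1 - \<gamma> * m \<le> 7 / 4"
proof -
  have "\<bar>\<gamma>\<bar> * \<bar>m\<bar> \<le> 3 / 4 * 1" using assms gamma_bounds by (intro mult_mono) auto
  then have "\<bar>\<gamma> * m\<bar> \<le> 3 / 4" by (simp add: abs_mult)
  then show "1 / 4 \<le> 1 + \<gamma> * m" "1 + \<gamma> * m \<le> 7 / 4" "1 / 4 \<le> 1 - \<gamma> * m" "1 - \<gamma> * m \<le> 7 / 4" by linarith+
qed

text \<open>\<open>wsum\<close> and \<open>wdiff\<close> are the even and odd parts in m of 1 / (1 -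
  \<gamma> m)^2. For s = 1 and s = -1, \<open>wdiff m - wsum m * s\<close> equals -1 / (1 + \<gamma>
  m)^2 and 1 / (1 - \<gamma> m)^2, so that a case distinction on the spin becomes an affine function
  of it.\<close>

definition wsum :: "real \<Rightarrow> real" where
  "wsum m = (1 / (1 - \<gamma> * m)\<^sup>2 + 1 / (1 + \<gamma> * m)\<^sup>2) / 2"

definition wdiff :: "real \<Rightarrow> real" where
  "wdiff m = (1 / (1 - \<gamma> * m)\<^sup>2 - 1 / (1 + \<gamma> * m)\<^sup>2) / 2"

text \<open>The weight balances the mean-field rates taken at the lower of two adjacent levels, so a
  downward flip meets the odds at m - 2 / n instead of m. The quotients differ by at most 48 / n and
  each is at most 7, whence 48 * 14 = 672.\<close>

lemma inverse_odds_shift: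
  assumes m: "\<bar>m\<bar> \<le> 1" and m': "\<bar>m - 2 / real n\<bar> \<le> 1"
  shows "1 / odds (m - 2 / real n) \<le> ((1 - \<gamma> * m) / (1 + \<gamma> * m))\<^sup>2 + 672 / real n"
proof -
  define k where "k = m - 2 / real n"
  define q q' where q: "q = (1 - \<gamma> * m) / (1 + \<gamma> * m)" "q' = (1 - \<gamma> * k) / (1 + \<gamma> * k)"
  note b = one_plus_bounds[OF m] one_plus_bounds[OF m'[folded k_def]]
  have le7: "(1 - \<gamma> * w) / (1 + \<gamma> * w) \<le> 7" "0 \<le> (1 - \<gamma> * w) / (1 + \<gamma> * w)" if w: "\<bar>w\<bar> \<le> 1" for w
  proof -
    note bw = one_plus_bounds[OF w]
    have "(1 - \<gamma> * w) / (1 + \<gamma> * w) \<le> (7 / 4) / (1 / 4)" using bw by (intro frac_le) auto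
    then show "(1 - \<gamma> * w) / (1 + \<gamma> * w) \<le> 7" by simp
    show "0 \<le> (1 - \<gamma> * w) / (1 + \<gamma> * w)" using bw by simp
  qed
  have "q' - q = 4 * \<gamma> / real n / ((1 + \<gamma> * m) * (1 + \<gamma> * k))"
  proof -
    have "q' - q = 2 * \<gamma> * (m - k) / ((1 + \<gamma> * m) * (1 + \<gamma> * k))"
      using b by (simp add: q field_simps)
    then show ?thesis by (simp add: k_def)
  qed
  also have "\<dots> \<le> 3 / real n / (1 / 4 * (1 / 4))"
    using b gamma_bounds by (intro frac_le mult_mono divide_right_mono mult_nonneg_nonneg) auto
  finally have d: "q' - q \<le> 48 / real n" by simp
  have "q'\<^sup>2 - q\<^sup>2 = (q' - q) * (q' + q)" by (simp add: power2_eq_square algebra_simps)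
  also have "\<dots> \<le> 48 / real n * (q' + q)"
    using d le7[OF m] le7[OF m'[folded k_def]] by (intro mult_right_mono) (auto simp: q)
  also have "\<dots> \<le> 48 / real n * 14"
    using le7[OF m] le7[OF m'[folded k_def]] by (intro mult_left_mono) (auto simp: q)
  finally have "q'\<^sup>2 \<le> q\<^sup>2 + 672 / real n" by simp
  moreover have "1 / odds k = q'\<^sup>2" by (simp add: odds_def q power_divide)
  ultimately show ?thesis by (simp add: q k_def)
qed

text \<open>Both spin values share the same numerator, the second factor on the right, which
  vanishes when the neighbours have sum 2 m and product m^2. An upward flip gives equality; a
  downward one pays the level shift times the maximal rate, 4 * 672 = 2688.\<close>

lemma drift_site:
  assumes x: "x \<in> torus n" and \<eta>: "\<eta> \<in> configs n"
  defines "m \<equiv> mag n \<eta>"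
  shows "rate \<theta> n x (flip \<eta> x) * exp (log_weight (particles n (flip \<eta> x)) - log_weight (particles n \<eta>)) - rate \<theta> n x \<eta>
    \<le> (wdiff m - wsum m * pspin n \<eta> x) *
       (4 * \<gamma> * m * (1 + \<gamma>\<^sup>2 * (pspin n \<eta> (x - 1) * pspin n \<eta> (x + 1)))
        - 2 * \<gamma> * (1 + \<gamma>\<^sup>2 * m\<^sup>2) * (pspin n \<eta> (x - 1) + pspin n \<eta> (x + 1))) + 2688 / real n"
proof -
  define s q where "s = pspin n \<eta> (x - 1) + pspin n \<eta> (x + 1)" and "q = pspin n \<eta> (x - 1) * pspin n \<eta> (x + 1)"
  have n1: "1 < n" using n5 by simp
  have m1: "\<bar>m\<bar> \<le> 1" unfolding m_def by (rule abs_mag_le[OF n0 \<eta>])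
  note b = one_plus_bounds[OF m1]
  have R: "rate \<theta> n x \<eta> = 1 - \<gamma> * pspin n \<eta> x * s + \<gamma>\<^sup>2 * q"
    "rate \<theta> n x (flip \<eta> x) = 1 + \<gamma> * pspin n \<eta> x * s + \<gamma>\<^sup>2 * q"
    unfolding s_def q_def by (rule rate_pspin[OF x] rate_flip[OF n1 x \<eta>])+
  have sp: "pspin n \<eta> x = spin \<eta> x" using x by (simp add: pspin_torus)
  have key: "4 * \<gamma> * m * (1 + \<gamma>\<^sup>2 * q) - 2 * \<gamma> * (1 + \<gamma>\<^sup>2 * m\<^sup>2) * s =
     (1 + \<gamma> * m)\<^sup>2 * (1 - \<gamma> * s + \<gamma>\<^sup>2 * q) - (1 - \<gamma> * m)\<^sup>2 * (1 + \<gamma> * s + \<gamma>\<^sup>2 * q)"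
    by (simp add: power2_eq_square algebra_simps)
  consider "spin \<eta> x = - 1" | "spin \<eta> x = 1" using spin_values[OF \<eta> x] by auto
  then show ?thesis
  proof cases
    case 1
    have "exp (log_weight (particles n (flip \<eta> x)) - log_weight (particles n \<eta>)) = odds m"
      using b by (simp add: particles_flip(1)[OF n0 x \<eta> 1] log_weight_def particles_mag[OF n0, symmetric] m_def[symmetric])
        (simp add: odds_def)
    moreover have "wdiff m + wsum m = 1 / (1 - \<gamma> * m)\<^sup>2" by (simp add: wdiff_def wsum_def field_simps)
    ultimately show ?thesis
      using b 1 unfolding s_def[symmetric] q_def[symmetric] key R sp
      by (simp add: odds_def power_divide diff_divide_distrib mult.commute)
  next
    case 2
    let ?k = "m - 2 / real n"
    have N: "particles n \<eta> = Suc (particles n (flip \<eta> x))" using particles_flip(2)[OF n0 x \<eta> 2] by simp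
    have mk: "mag n (flip \<eta> x) = ?k" using mag_flip[OF x \<eta>] 2 by (simp add: m_def)
    have k1: "\<bar>?k\<bar> \<le> 1" using abs_mag_le[OF n0, of "flip \<eta> x"] x \<eta> by (simp add: mk)
    have "exp (log_weight (particles n (flip \<eta> x)) - log_weight (particles n \<eta>)) = 1 / odds ?k"
    proof -
      have "0 < odds ?k" using one_plus_bounds[OF k1] unfolding odds_def
        by (intro zero_less_power divide_pos_pos) linarith+
      then show ?thesis unfolding N log_weight_def
        by (simp add: particles_mag[OF n0, symmetric] mk exp_minus inverse_eq_divide)
    qed
    also have "\<dots> \<le> ((1 - \<gamma> * m) / (1 + \<gamma> * m))\<^sup>2 + 672 / real n" by (rule inverse_odds_shift[OF m1 k1])
    finally have "rate \<theta> n x (flip \<eta> x) * exp (log_weight (particles n (flip \<eta> x)) - log_weight (particles n \<eta>))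
      \<le> rate \<theta> n x (flip \<eta> x) * (((1 - \<gamma> * m) / (1 + \<gamma> * m))\<^sup>2 + 672 / real n)"
      using rate_pos[OF n0 x _ gamma01, of "flip \<eta> x"] x \<eta> by (intro mult_left_mono) auto
    also have "\<dots> \<le> rate \<theta> n x (flip \<eta> x) * ((1 - \<gamma> * m) / (1 + \<gamma> * m))\<^sup>2 + 4 * (672 / real n)"
      unfolding distrib_left using rate_le[OF n0 x _ gamma01, of "flip \<eta> x"] x \<eta> by (intro add_left_mono mult_right_mono) auto
    finally have "rate \<theta> n x (flip \<eta> x) * exp (log_weight (particles n (flip \<eta> x)) - log_weight (particles n \<eta>)) - rate \<theta> n x \<eta>
      \<le> rate \<theta> n x (flip \<eta> x) * ((1 - \<gamma> * m) / (1 + \<gamma> * m))\<^sup>2 - rate \<theta> n x \<eta> + 2688 / real n" by simp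
    moreover have "wdiff m - wsum m = - (1 / (1 + \<gamma> * m)\<^sup>2)" by (simp add: wdiff_def wsum_def field_simps)
    moreover have "- (1 / c\<^sup>2) * (c\<^sup>2 * A - d\<^sup>2 * B) = B * (d / c)\<^sup>2 - A" if "c \<noteq> 0" for A B c d :: real
      using that by (simp add: power_divide right_diff_distrib)
    moreover have "1 + \<gamma> * m \<noteq> 0" using b by simp
    ultimately show ?thesis
      using 2 unfolding s_def[symmetric] q_def[symmetric] key R sp by simp
  qed
qed

lemma sum_pairs_shift:
  "(\<Sum>x\<in>torus n. pspin n \<eta> (x - 1) * pspin n \<eta> (x + 1)) = (\<Sum>x\<in>torus n. pspin n \<eta> x * pspin n \<eta> (x + 2))"
  "(\<Sum>x\<in>torus n. pspin n \<eta> (x - 1) * pspin n \<eta> x) = (\<Sum>x\<in>torus n. pspin n \<eta> x * pspin n \<eta> (x + 1))"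
proof -
  have per: "pspin n \<eta> (x mod int n + k) = pspin n \<eta> (x + k)" for x k
    by (simp add: pspin_def mod_simps)
  show "(\<Sum>x\<in>torus n. pspin n \<eta> (x - 1) * pspin n \<eta> (x + 1)) = (\<Sum>x\<in>torus n. pspin n \<eta> x * pspin n \<eta> (x + 2))"
    using sum_torus_shift[OF n0, of "\<lambda>x. pspin n \<eta> x * pspin n \<eta> (x + 2)" "-1"] per by (simp add: add.commute)
  show "(\<Sum>x\<in>torus n. pspin n \<eta> (x - 1) * pspin n \<eta> x) = (\<Sum>x\<in>torus n. pspin n \<eta> x * pspin n \<eta> (x + 1))"
    using sum_torus_shift[OF n0, of "\<lambda>x. pspin n \<eta> x * pspin n \<eta> (x + 1)" "-1"] per by (simp add: add.commute)
qed

lemma local_sums: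
  fixes \<eta> defines "m \<equiv> mag n \<eta>"
  shows "(\<Sum>x\<in>torus n. pspin n \<eta> x) = real n * m"
    "(\<Sum>x\<in>torus n. pspin n \<eta> (x - 1)) = real n * m"
    "(\<Sum>x\<in>torus n. pspin n \<eta> (x + 1)) = real n * m"
    "(\<Sum>x\<in>torus n. pspin n \<eta> (x - 1) * pspin n \<eta> (x + 1)) = real n * m\<^sup>2 + pair_dev n 2 \<eta>"
    "(\<Sum>x\<in>torus n. pspin n \<eta> (x - 1) * pspin n \<eta> x) = real n * m\<^sup>2 + pair_dev n 1 \<eta>"
    "(\<Sum>x\<in>torus n. pspin n \<eta> x * pspin n \<eta> (x + 1)) = real n * m\<^sup>2 + pair_dev n 1 \<eta>"
    "(\<Sum>x\<in>torus n. pspin n \<eta> (x - 1) * pspin n \<eta> x * pspin n \<eta> (x + 1)) = real n * m ^ 3 + triple_dev n \<eta>"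
  using sum_pspin[OF n0, of \<eta> 0] sum_pspin[OF n0, of \<eta> "-1"] sum_pspin[OF n0, of \<eta> 1] sum_pairs_shift[of \<eta>]
  by (simp_all add: m_def pair_dev_def triple_dev_def)

definition gap_coeff :: "real \<Rightarrow> real" where
  "gap_coeff m = 4 * \<gamma> ^ 3 * wdiff m * m"

definition triple_coeff :: "real \<Rightarrow> real" where
  "triple_coeff m = 4 * \<gamma> ^ 3 * wsum m * m"

definition pair_coeff :: "real \<Rightarrow> real" where
  "pair_coeff m = 4 * \<gamma> * (1 + \<gamma>\<^sup>2 * m\<^sup>2) * wsum m"

text \<open>All terms of order n cancel, since the weight is balanced for the mean-field rates. What
  survives are the replacement errors with coefficients depending on m alone, and n site errors of
  2688 / n.\<close>

lemma drift_le:
  assumes \<eta>: "\<eta> \<in> configs n"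
  defines "m \<equiv> mag n \<eta>"
  shows "drift \<eta> \<le> gap_coeff m * pair_dev n 2 \<eta> - triple_coeff m * triple_dev n \<eta> + pair_coeff m * pair_dev n 1 \<eta> + 2688"
proof -
  let ?s = "pspin n \<eta>"
  let ?u = "wsum m" and ?v = "wdiff m"
  define A B where "A = 4 * \<gamma> * m" and "B = 2 * \<gamma> * (1 + \<gamma>\<^sup>2 * m\<^sup>2)"
  have "drift \<eta> \<le> (\<Sum>x\<in>torus n. (?v - ?u * ?s x) *
       (A * (1 + \<gamma>\<^sup>2 * (?s (x - 1) * ?s (x + 1))) - B * (?s (x - 1) + ?s (x + 1))) + 2688 / real n)"
    unfolding drift_def A_def B_def m_def by (intro sum_mono drift_site \<eta>)
  also have "\<dots> = (\<Sum>x\<in>torus n. ?v * A + ?v * A * \<gamma>\<^sup>2 * (?s (x - 1) * ?s (x + 1)) - ?v * B * ?s (x - 1) - ?v * B * ?s (x + 1)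
      - ?u * A * ?s x - ?u * A * \<gamma>\<^sup>2 * (?s (x - 1) * ?s x * ?s (x + 1)) + ?u * B * (?s (x - 1) * ?s x) + ?u * B * (?s x * ?s (x + 1)) + 2688 / real n)"
    by (intro sum.cong refl) (simp add: algebra_simps)
  also have "\<dots> = real n * (?v * A) + ?v * A * \<gamma>\<^sup>2 * (real n * m\<^sup>2 + pair_dev n 2 \<eta>) - ?v * B * (real n * m) - ?v * B * (real n * m)
      - ?u * A * (real n * m) - ?u * A * \<gamma>\<^sup>2 * (real n * m ^ 3 + triple_dev n \<eta>) + ?u * B * (real n * m\<^sup>2 + pair_dev n 1 \<eta>) + ?u * B * (real n * m\<^sup>2 + pair_dev n 1 \<eta>) + 2688"
    unfolding sum.distrib sum_subtractf sum_distrib_left[symmetric] local_sums m_def[symmetric] by (simp add: n0')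
  also have "\<dots> = gap_coeff m * pair_dev n 2 \<eta> - triple_coeff m * triple_dev n \<eta> + pair_coeff m * pair_dev n 1 \<eta> + 2688"
    by (simp add: A_def B_def gap_coeff_def triple_coeff_def pair_coeff_def power2_eq_square power3_eq_cube algebra_simps)
  finally show ?thesis .
qed

lemma coefficient_bounds:
  assumes m: "\<bar>m\<bar> \<le> 1"
  shows "\<bar>gap_coeff m\<bar> \<le> 100" "\<bar>triple_coeff m\<bar> \<le> 100" "\<bar>pair_coeff m\<bar> \<le> 100"
proof -
  note b = one_plus_bounds[OF m]
  have inv: "1 / w\<^sup>2 \<le> 16" "0 < 1 / w\<^sup>2" if "1 / 4 \<le> w" for w :: real
  proof -
    have "1 / w\<^sup>2 \<le> 1 / (1 / 4)\<^sup>2" using that by (intro divide_left_mono power_mono mult_pos_pos) auto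
    then show "1 / w\<^sup>2 \<le> 16" by (simp add: power2_eq_square)
    show "0 < 1 / w\<^sup>2" using that by simp
  qed
  define A B where "A = 1 / (1 - \<gamma> * m)\<^sup>2" and "B = 1 / (1 + \<gamma> * m)\<^sup>2"
  have "A \<le> 16" "0 < A" "B \<le> 16" "0 < B" using inv[OF b(1)] inv[OF b(3)] by (simp_all add: A_def B_def)
  then have u: "\<bar>wsum m\<bar> \<le> 16" and v: "\<bar>wdiff m\<bar> \<le> 16"
    unfolding wsum_def wdiff_def A_def[symmetric] B_def[symmetric] by simp_all
  have g3: "\<bar>\<gamma> ^ 3\<bar> \<le> 1" "\<bar>\<gamma>\<^sup>2\<bar> \<le> 1" using gamma01 by (auto simp: power_le_one)
  have "\<bar>4 * \<gamma> ^ 3\<bar> * \<bar>wdiff m\<bar> * \<bar>m\<bar> \<le> 4 * 16 * 1"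
    using g3 v m by (intro mult_mono) auto
  then show "\<bar>gap_coeff m\<bar> \<le> 100" by (simp add: gap_coeff_def abs_mult)
  have "\<bar>4 * \<gamma> ^ 3\<bar> * \<bar>wsum m\<bar> * \<bar>m\<bar> \<le> 4 * 16 * 1"
    using g3 u m by (intro mult_mono) auto
  then show "\<bar>triple_coeff m\<bar> \<le> 100" by (simp add: triple_coeff_def abs_mult)
  have "\<bar>\<gamma> * m\<bar> \<le> \<bar>3 / 4\<bar>" using b by linarith
  then have "(\<gamma> * m)\<^sup>2 \<le> (3 / 4)\<^sup>2" unfolding abs_le_square_iff .
  then have "\<gamma>\<^sup>2 * m\<^sup>2 \<le> 9 / 16" by (simp add: power_mult_distrib power_divide)
  moreover have "0 \<le> \<gamma>\<^sup>2 * m\<^sup>2" by simp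
  ultimately have "\<bar>1 + \<gamma>\<^sup>2 * m\<^sup>2\<bar> \<le> 25 / 16" by linarith
  then have "\<bar>4 * \<gamma>\<bar> * \<bar>1 + \<gamma>\<^sup>2 * m\<^sup>2\<bar> * \<bar>wsum m\<bar> \<le> 3 * (25 / 16) * 16"
    using u gamma_bounds by (intro mult_mono) auto
  then show "\<bar>pair_coeff m\<bar> \<le> 100"
    unfolding pair_coeff_def abs_mult[symmetric] by simp
qed

text \<open>The constant is 100 * (300 + 2000 + 300) + 2688, rounded up.\<close>

lemma ev_drift_le: "ev drift \<le> 263000 * (1 + energy)"
proof -
  let ?m = "mag n"
  have arith: "d \<le> 263000 * (1 + e)"
    if "d \<le> A - B + C + 2688" "\<bar>A\<bar> \<le> 100 * (300 * (1 + e))" "\<bar>B\<bar> \<le> 100 * (2000 * (1 + e))"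
      "\<bar>C\<bar> \<le> 100 * (300 * (1 + e))" "0 \<le> e" for d A B C e :: real
    using that by (simp add: abs_le_iff)
  note cb = coefficient_bounds[OF abs_mag_le[OF n0]]
  have "ev drift \<le> ev (\<lambda>\<eta>. gap_coeff (?m \<eta>) * pair_dev n 2 \<eta> - triple_coeff (?m \<eta>) * triple_dev n \<eta>
    + pair_coeff (?m \<eta>) * pair_dev n 1 \<eta> + 2688)" by (rule ev_mono) (rule drift_le)
  then have "ev drift \<le> ev (\<lambda>\<eta>. gap_coeff (?m \<eta>) * pair_dev n 2 \<eta>) - ev (\<lambda>\<eta>. triple_coeff (?m \<eta>) * triple_dev n \<eta>)
     + ev (\<lambda>\<eta>. pair_coeff (?m \<eta>) * pair_dev n 1 \<eta>) + 2688"
    by (simp only: ev_add ev_diff ev_const)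
  then show ?thesis
    by (rule arith) (rule dev_bounds cb energy_nonneg | simp)+
qed

text \<open>For small \<open>a\<close> the entropy production absorbs the error of the replacement, which is itself
  controlled by the energy.\<close>

lemma energy_le_1:
  assumes "a \<le> 1 / 526000"
  shows "energy \<le> 1"
proof -
  have "energy \<le> a * (263000 * (1 + energy))"
    using energy_le_drift a0 ev_drift_le by (meson mult_left_mono order.trans less_imp_le)
  \<comment> \<open>The threshold makes the product of the constants 1 / 2, so energy \<le> (1 +
    energy) / 2.\<close>
  also have "\<dots> \<le> 1 / 526000 * (263000 * (1 + energy))"
    using assms energy_nonneg by (intro mult_right_mono) auto
  finally show ?thesis by simp
qed

end

section \<open>Moments and the approximate Stein equation\<close>

context stationary_law begin

text \<open>Exchanges do not move the magnetization, so stationarity involves the flips only and a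
  cancels.\<close>

lemma ev_flip_mag:
  "ev (\<lambda>\<eta>. \<Sum>x\<in>torus n. rate \<theta> n x \<eta> * (f (mag n \<eta> - 2 * spin \<eta> x / real n) - f (mag n \<eta>))) = 0"
proof -
  have "a * ev (\<lambda>\<eta>. \<Sum>x\<in>torus n. rate \<theta> n x \<eta> * (f (mag n \<eta> - 2 * spin \<eta> x / real n) - f (mag n \<eta>)))
     = ev (gen \<theta> a n (\<lambda>\<eta>. f (mag n \<eta>)))"
    unfolding ev_cmult[symmetric]
    by (intro ev_cong) (simp add: gen_def gen_ex_def gen_G_def mag_exchange mag_flip)
  then show ?thesis using a0 stationary by simp
qed

lemma sum_rate:
  "(\<Sum>x\<in>torus n. rate \<theta> n x \<eta>) = real n - 2 * \<gamma> * (real n * (mag n \<eta>)\<^sup>2 + pair_dev n 1 \<eta>)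
     + \<gamma>\<^sup>2 * (real n * (mag n \<eta>)\<^sup>2 + pair_dev n 2 \<eta>)"
proof -
  have "(\<Sum>x\<in>torus n. rate \<theta> n x \<eta>) = (\<Sum>x\<in>torus n. 1 - \<gamma> * (pspin n \<eta> (x - 1) * pspin n \<eta> x)
     - \<gamma> * (pspin n \<eta> x * pspin n \<eta> (x + 1)) + \<gamma>\<^sup>2 * (pspin n \<eta> (x - 1) * pspin n \<eta> (x + 1)))"
    by (intro sum.cong refl) (simp add: rate_pspin algebra_simps)
  then show ?thesis
    unfolding sum.distrib sum_subtractf sum_distrib_left[symmetric] local_sums by (simp add: algebra_simps)
qed

text \<open>Multiplication by the spin collapses the quadratic terms of the rate to linear ones.
  Their total coefficient 1 - 2 \<gamma> is of order n^(-1/2), which lets the cubic term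
  compete.\<close>

lemma sum_rate_spin:
  assumes \<eta>: "\<eta> \<in> configs n"
  shows "(\<Sum>x\<in>torus n. rate \<theta> n x \<eta> * spin \<eta> x) = (1 - 2 * \<gamma>) * (real n * mag n \<eta>)
     + \<gamma>\<^sup>2 * (real n * (mag n \<eta>) ^ 3 + triple_dev n \<eta>)"
proof -
  have "(\<Sum>x\<in>torus n. rate \<theta> n x \<eta> * spin \<eta> x) = (\<Sum>x\<in>torus n. pspin n \<eta> x - \<gamma> * pspin n \<eta> (x - 1)
     - \<gamma> * pspin n \<eta> (x + 1) + \<gamma>\<^sup>2 * (pspin n \<eta> (x - 1) * pspin n \<eta> x * pspin n \<eta> (x + 1)))"
  proof (rule sum.cong)
    fix x assume x: "x \<in> torus n"
    have "rate \<theta> n x \<eta> * spin \<eta> x = pspin n \<eta> x - \<gamma> * pspin n \<eta> (x - 1) * (pspin n \<eta> x * pspin n \<eta> x)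
     - \<gamma> * pspin n \<eta> (x + 1) * (pspin n \<eta> x * pspin n \<eta> x) + \<gamma>\<^sup>2 * (pspin n \<eta> (x - 1) * pspin n \<eta> x * pspin n \<eta> (x + 1))"
      unfolding rate_pspin[OF x] pspin_torus[OF x, symmetric] by (simp add: algebra_simps)
    then show "rate \<theta> n x \<eta> * spin \<eta> x = pspin n \<eta> x - \<gamma> * pspin n \<eta> (x - 1)
     - \<gamma> * pspin n \<eta> (x + 1) + \<gamma>\<^sup>2 * (pspin n \<eta> (x - 1) * pspin n \<eta> x * pspin n \<eta> (x + 1))"
      by (simp add: pspin_mult_self[OF n0 \<eta>])
  qed simp
  then show ?thesis
    unfolding sum.distrib sum_subtractf sum_distrib_left[symmetric] local_sums by (simp add: algebra_simps)
qed

lemma one_minus_two_gamma: "1 - 2 * \<gamma> = \<theta> / sqrt (real n)"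
  by (simp add: gamma_def diff_divide_distrib)

text \<open>Stationarity of m^2 balances the total rate, at most 4 n, against n times m times the
  sum of rate and spin. The latter contains \<gamma>^2 n m^4 \<ge> n m^4 / 16; half of this absorbs
  the linear term of unknown sign. The constant 150000 rounds up 32 * (4 + 4000).\<close>

lemma fourth_moment:
  assumes a: "a \<le> 1 / 526000"
  shows "real n * ev (\<lambda>\<eta>. (mag n \<eta>) ^ 4) \<le> 150000 + 256 * \<theta>\<^sup>2"
proof -
  define M where "M = ev (\<lambda>\<eta>. (mag n \<eta>) ^ 4)"
  have "ev (\<lambda>\<eta>. \<Sum>x\<in>torus n. rate \<theta> n x \<eta> * ((mag n \<eta> - 2 * spin \<eta> x / real n)\<^sup>2 - (mag n \<eta>)\<^sup>2)) = 0"
    by (rule ev_flip_mag[where f="\<lambda>m. m\<^sup>2"])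
  also have "ev (\<lambda>\<eta>. \<Sum>x\<in>torus n. rate \<theta> n x \<eta> * ((mag n \<eta> - 2 * spin \<eta> x / real n)\<^sup>2 - (mag n \<eta>)\<^sup>2))
    = ev (\<lambda>\<eta>. 4 / (real n)\<^sup>2 * (\<Sum>x\<in>torus n. rate \<theta> n x \<eta>) - 4 / real n * (mag n \<eta> * (\<Sum>x\<in>torus n. rate \<theta> n x \<eta> * spin \<eta> x)))"
  proof (rule ev_cong)
    fix \<eta> assume \<eta>: "\<eta> \<in> configs n"
    have "rate \<theta> n x \<eta> * ((mag n \<eta> - 2 * spin \<eta> x / real n)\<^sup>2 - (mag n \<eta>)\<^sup>2)
      = 4 / (real n)\<^sup>2 * rate \<theta> n x \<eta> - 4 / real n * (mag n \<eta> * (rate \<theta> n x \<eta> * spin \<eta> x))" if x: "x \<in> torus n" for x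
    proof -
      have "spin \<eta> x * spin \<eta> x = 1" using spin_values[OF \<eta> x] by auto
      then show ?thesis by (simp add: power2_eq_square algebra_simps)
    qed
    then show "(\<Sum>x\<in>torus n. rate \<theta> n x \<eta> * ((mag n \<eta> - 2 * spin \<eta> x / real n)\<^sup>2 - (mag n \<eta>)\<^sup>2)) =
      4 / (real n)\<^sup>2 * (\<Sum>x\<in>torus n. rate \<theta> n x \<eta>) - 4 / real n * (mag n \<eta> * (\<Sum>x\<in>torus n. rate \<theta> n x \<eta> * spin \<eta> x))"
      by (simp add: sum_subtractf sum_distrib_left)
  qed
  also have "\<dots> = 4 / (real n)\<^sup>2 * ev (\<lambda>\<eta>. \<Sum>x\<in>torus n. rate \<theta> n x \<eta>) - 4 / real n * ev (\<lambda>\<eta>. mag n \<eta> * (\<Sum>x\<in>torus n. rate \<theta> n x \<eta> * spin \<eta> x))"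
    by (simp only: ev_diff ev_cmult)
  finally have "real n * ev (\<lambda>\<eta>. mag n \<eta> * (\<Sum>x\<in>torus n. rate \<theta> n x \<eta> * spin \<eta> x)) = ev (\<lambda>\<eta>. \<Sum>x\<in>torus n. rate \<theta> n x \<eta>)"
    by (simp add: field_simps power2_eq_square n0')
  also have "\<dots> \<le> ev (\<lambda>\<eta>. \<Sum>x\<in>torus n. 4)"
    by (intro ev_mono sum_mono rate_le gamma01) auto
  also have "\<dots> = real n * 4" by (simp add: ev_const)
  finally have le4: "ev (\<lambda>\<eta>. mag n \<eta> * (\<Sum>x\<in>torus n. rate \<theta> n x \<eta> * spin \<eta> x)) \<le> 4"
    by simp
  have lower: "ev (\<lambda>\<eta>. 1 / 32 * (real n * (mag n \<eta>) ^ 4) - 8 * \<theta>\<^sup>2 + \<gamma>\<^sup>2 * (mag n \<eta> * triple_dev n \<eta>))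
     \<le> ev (\<lambda>\<eta>. mag n \<eta> * (\<Sum>x\<in>torus n. rate \<theta> n x \<eta> * spin \<eta> x))"
  proof (rule ev_mono)
    fix \<eta> assume \<eta>: "\<eta> \<in> configs n"
    define m where "m = mag n \<eta>"
    define r where "r = sqrt (real n)"
    have r: "r\<^sup>2 = real n" "0 < r" by (simp_all add: r_def)
    \<comment> \<open>The square is tuned so that \<theta> sqrt n m^2 costs n m^4 / 32, half of what
      \<gamma> \<ge> 1 / 4 provides.\<close>
    have "0 \<le> (r * m\<^sup>2 / 2 + 8 * \<theta>)\<^sup>2" by simp
    then have "- (1 / 32 * (r\<^sup>2 * m ^ 4) + 8 * \<theta>\<^sup>2) \<le> \<theta> * (r * m\<^sup>2)"
      by (simp add: power2_eq_square power4_eq_xxxx algebra_simps)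
    also have "\<theta> * (r * m\<^sup>2) = (1 - 2 * \<gamma>) * (real n * m\<^sup>2)"
      unfolding one_minus_two_gamma r_def[symmetric] r(1)[symmetric] using r(2) by (simp add: power2_eq_square)
    finally have 1: "- (1 / 32 * (real n * m ^ 4) + 8 * \<theta>\<^sup>2) \<le> (1 - 2 * \<gamma>) * (real n * m\<^sup>2)" by (simp add: r)
    have "(1 / 4)\<^sup>2 \<le> \<gamma>\<^sup>2" using gamma_bounds by (intro power_mono) auto
    then have "(1 / 4)\<^sup>2 * (real n * m ^ 4) \<le> \<gamma>\<^sup>2 * (real n * m ^ 4)" by (intro mult_right_mono) auto
    then have 2: "1 / 16 * (real n * m ^ 4) \<le> \<gamma>\<^sup>2 * (real n * m ^ 4)" by (simp add: power2_eq_square)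
    have "m * (\<Sum>x\<in>torus n. rate \<theta> n x \<eta> * spin \<eta> x) = (1 - 2 * \<gamma>) * (real n * m\<^sup>2) + \<gamma>\<^sup>2 * (real n * m ^ 4) + \<gamma>\<^sup>2 * (m * triple_dev n \<eta>)"
      unfolding sum_rate_spin[OF \<eta>] m_def[symmetric] by (simp add: power2_eq_square power3_eq_cube power4_eq_xxxx algebra_simps)
    then show "1 / 32 * (real n * (mag n \<eta>) ^ 4) - 8 * \<theta>\<^sup>2 + \<gamma>\<^sup>2 * (mag n \<eta> * triple_dev n \<eta>) \<le> mag n \<eta> * (\<Sum>x\<in>torus n. rate \<theta> n x \<eta> * spin \<eta> x)"
      using 1 2 unfolding m_def[symmetric] by linarith
  qed
  have "\<bar>ev (\<lambda>\<eta>. mag n \<eta> * triple_dev n \<eta>)\<bar> \<le> 2000 * (1 + energy)"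
    by (rule triple_bound[where F="\<lambda>m. m"]) (rule abs_mag_le[OF n0])
  then have T: "\<bar>ev (\<lambda>\<eta>. mag n \<eta> * triple_dev n \<eta>)\<bar> \<le> 4000" using energy_le_1[OF a] by simp
  have "\<gamma>\<^sup>2 \<le> 1" using gamma01 by (simp add: power_le_one)
  then have "\<bar>\<gamma>\<^sup>2\<bar> * \<bar>ev (\<lambda>\<eta>. mag n \<eta> * triple_dev n \<eta>)\<bar> \<le> 1 * 4000" using T by (intro mult_mono) auto
  then have "\<bar>\<gamma>\<^sup>2 * ev (\<lambda>\<eta>. mag n \<eta> * triple_dev n \<eta>)\<bar> \<le> 4000" by (simp add: abs_mult)
  moreover have "ev (\<lambda>\<eta>. 1 / 32 * (real n * (mag n \<eta>) ^ 4) - 8 * \<theta>\<^sup>2 + \<gamma>\<^sup>2 * (mag n \<eta> * triple_dev n \<eta>))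
     = 1 / 32 * (real n * M) - 8 * \<theta>\<^sup>2 + \<gamma>\<^sup>2 * ev (\<lambda>\<eta>. mag n \<eta> * triple_dev n \<eta>)"
    by (simp only: ev_diff ev_add ev_cmult ev_const M_def)
  ultimately show ?thesis using le4 lower unfolding M_def[symmetric] by (simp add: abs_le_iff)
qed

end

text \<open>The derivatives are named from F = f' on because the Stein equation is an equation for
  F; no bound on f itself is asked for.\<close>

lemma taylor_3:
  fixes f :: "real \<Rightarrow> real"
  assumes f: "\<And>y. (f has_real_derivative F y) (at y)" and F: "\<And>y. (F has_real_derivative F1 y) (at y)"
    and F1: "\<And>y. (F1 has_real_derivative F2 y) (at y)" and B: "\<And>y. \<bar>F2 y\<bar> \<le> B"
  shows "\<bar>f (y + h) - f y - F y * h - F1 y * h\<^sup>2 / 2\<bar> \<le> B * \<bar>h\<bar> ^ 3"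
proof (cases "h = 0")
  case False
  define d where "d k = (if k = 0 then f else if k = 1 then F else if k = 2 then F1 else F2)" for k :: nat
  have "\<exists>t. (if y + h < y then y + h < t \<and> t < y else y < t \<and> t < y + h) \<and>
      f (y + h) = (\<Sum>m<3. d m y / fact m * (y + h - y) ^ m) + d 3 t / fact 3 * (y + h - y) ^ 3"
    by (rule Taylor[where a="min y (y + h)" and b="max y (y + h)"])
      (use f F F1 False in \<open>auto simp: d_def less_Suc_eq numeral_eq_Suc\<close>)
  then obtain t where "f (y + h) = (\<Sum>m<3. d m y / fact m * h ^ m) + d 3 t / fact 3 * h ^ 3" by auto
  then have eq: "f (y + h) - f y - F y * h - F1 y * h\<^sup>2 / 2 = F2 t / 6 * h ^ 3"
    by (simp add: d_def numeral_eq_Suc fact_numeral)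
  have "\<bar>F2 t / 6\<bar> \<le> B" using B[of t] by simp
  then have "\<bar>F2 t / 6\<bar> * \<bar>h\<bar> ^ 3 \<le> B * \<bar>h\<bar> ^ 3" by (intro mult_right_mono) auto
  then show ?thesis unfolding eq by (simp add: abs_mult power_abs)
qed simp

section \<open>The scaled magnetization and its approximate Stein equation\<close>

context stationary_law begin

definition rho :: real where "rho = real n powr (1 / 4)"

lemma rho: "1 \<le> rho" "rho ^ 4 = real n" "rho\<^sup>2 = sqrt (real n)"
proof -
  show "1 \<le> rho" unfolding rho_def using n5 by (intro ge_one_powr_ge_zero) auto
  show "rho ^ 4 = real n" by (simp add: rho_def powr_power)
  show "rho\<^sup>2 = sqrt (real n)" by (simp add: rho_def powr_power powr_half_sqrt)
qed

text \<open>This is n^(-3/4) times the sum of \<eta>(x) - 1/2, that is, \<open>fluct\<close> at the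
  constant function 1.\<close>

definition scaled :: "config \<Rightarrow> real" where
  "scaled \<eta> = rho * mag n \<eta> / 2"

lemma second_moment:
  assumes a: "a \<le> 1 / 526000"
  shows "ev (\<lambda>\<eta>. (mag n \<eta>)\<^sup>2) \<le> (150001 + 256 * \<theta>\<^sup>2) / rho\<^sup>2"
proof -
  have r0: "0 < rho\<^sup>2" using rho(1) by (simp add: zero_less_power)
  have "rho\<^sup>2 * ev (\<lambda>\<eta>. (mag n \<eta>)\<^sup>2) = ev (\<lambda>\<eta>. rho\<^sup>2 * (mag n \<eta>)\<^sup>2)" by (simp add: ev_cmult)
  also have "\<dots> \<le> ev (\<lambda>\<eta>. 1 + real n * (mag n \<eta>) ^ 4)"
  proof (rule ev_mono)
    fix \<eta>
    have "0 \<le> (rho\<^sup>2 * (mag n \<eta>)\<^sup>2 - 1)\<^sup>2 + (rho\<^sup>2 * (mag n \<eta>)\<^sup>2)\<^sup>2 + 1" by simp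
    then show "rho\<^sup>2 * (mag n \<eta>)\<^sup>2 \<le> 1 + real n * (mag n \<eta>) ^ 4"
      unfolding rho(2)[symmetric] by (simp add: power2_eq_square power4_eq_xxxx algebra_simps)
  qed
  also have "\<dots> = 1 + real n * ev (\<lambda>\<eta>. (mag n \<eta>) ^ 4)" by (simp only: ev_add ev_const ev_cmult)
  also have "\<dots> \<le> 150001 + 256 * \<theta>\<^sup>2" using fourth_moment[OF a] by simp
  finally show ?thesis using r0 by (simp add: field_simps)
qed

lemma scaled_second_moment:
  assumes a: "a \<le> 1 / 526000"
  shows "ev (\<lambda>\<eta>. (scaled \<eta>)\<^sup>2) \<le> 150001 + 256 * \<theta>\<^sup>2"
proof -
  have "ev (\<lambda>\<eta>. (scaled \<eta>)\<^sup>2) = rho\<^sup>2 / 4 * ev (\<lambda>\<eta>. (mag n \<eta>)\<^sup>2)"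
    unfolding ev_cmult[symmetric] by (simp add: scaled_def power_divide power_mult_distrib)
  also have "\<dots> \<le> rho\<^sup>2 / 4 * ((150001 + 256 * \<theta>\<^sup>2) / rho\<^sup>2)"
    by (intro mult_left_mono second_moment a) auto
  also have "\<dots> \<le> 150001 + 256 * \<theta>\<^sup>2" using rho(1) by simp
  finally show ?thesis .
qed

lemma bounded_dev:
  assumes a: "a \<le> 1 / 526000" and B: "0 < B" "\<And>y. \<bar>F y\<bar> \<le> B"
  shows "\<bar>ev (\<lambda>\<eta>. F (scaled \<eta>) * pair_dev n 1 \<eta>)\<bar> \<le> 600 * B"
    "\<bar>ev (\<lambda>\<eta>. F (scaled \<eta>) * pair_dev n 2 \<eta>)\<bar> \<le> 600 * B"
    "\<bar>ev (\<lambda>\<eta>. F (scaled \<eta>) * triple_dev n \<eta>)\<bar> \<le> 4000 * B"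
proof -
  have "B * (300 * (1 + energy)) \<le> B * 600" "B * (2000 * (1 + energy)) \<le> B * 4000"
    using energy_le_1[OF a] B by (intro mult_left_mono; simp)+
  then show "\<bar>ev (\<lambda>\<eta>. F (scaled \<eta>) * pair_dev n 1 \<eta>)\<bar> \<le> 600 * B"
    "\<bar>ev (\<lambda>\<eta>. F (scaled \<eta>) * pair_dev n 2 \<eta>)\<bar> \<le> 600 * B"
    "\<bar>ev (\<lambda>\<eta>. F (scaled \<eta>) * triple_dev n \<eta>)\<bar> \<le> 4000 * B"
    using dev_bounds[of B "\<lambda>m. F (rho * m / 2)"] B unfolding scaled_def
    by (auto simp: mult.commute intro: order.trans)
qed

text \<open>One flip moves the scaled magnetization by \<delta> = n^(-3/4). Expanding f to second
  order and dividing by \<delta>^2 n brings drift and diffusion to order one, with errors O(1 /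
  rho). The bound on y^3 F y pays for replacing 8 \<gamma>^2 by its limit 2.\<close>

lemma stein_bound:
  assumes a: "a \<le> 1 / 526000"
    and f: "\<And>y. (f has_real_derivative F y) (at y)" and F: "\<And>y. (F has_real_derivative F1 y) (at y)"
    and F1: "\<And>y. (F1 has_real_derivative F2 y) (at y)"
    and B: "0 < B" "\<And>y. \<bar>F y\<bar> \<le> B" "\<And>y. \<bar>F1 y\<bar> \<le> B" "\<And>y. \<bar>F2 y\<bar> \<le> B" "\<And>y. \<bar>y ^ 3 * F y\<bar> \<le> B"
  shows "\<bar>ev (\<lambda>\<eta>. F1 (scaled \<eta>) / 2 - (2 * \<theta> * scaled \<eta> + 2 * scaled \<eta> ^ 3) * F (scaled \<eta>))\<bar>
    \<le> (6000 + 6 * \<bar>\<theta>\<bar> + 2 * (150001 + 256 * \<theta>\<^sup>2)) * B / rho"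
proof -
  let ?Y = scaled
  define \<delta> where "\<delta> = rho / real n"
  have r0: "0 < rho" using rho(1) by simp
  have n: "real n = rho ^ 4" using rho(2) by simp
  have \<delta>: "0 < \<delta>" "\<delta> = 1 / rho ^ 3"
    using r0 by (simp_all add: \<delta>_def n power4_eq_xxxx power3_eq_cube)
  have Yflip: "rho * (mag n \<eta> - 2 * spin \<eta> x / real n) / 2 = ?Y \<eta> + - \<delta> * spin \<eta> x" for \<eta> x
    by (simp add: scaled_def \<delta>_def algebra_simps diff_divide_distrib)
  define E where "E \<eta> = (\<Sum>x\<in>torus n. rate \<theta> n x \<eta> * (f (?Y \<eta> + - \<delta> * spin \<eta> x) - f (?Y \<eta>)))" for \<eta>
  define P where "P \<eta> = - \<delta> * F (?Y \<eta>) * (\<Sum>x\<in>torus n. rate \<theta> n x \<eta> * spin \<eta> x)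
     + \<delta>\<^sup>2 * (F1 (?Y \<eta>) / 2) * (\<Sum>x\<in>torus n. rate \<theta> n x \<eta>)" for \<eta>
  have evE: "ev E = 0"
    using ev_flip_mag[of "\<lambda>m. f (rho * m / 2)"] unfolding E_def Yflip unfolding scaled_def .
  have EP: "\<bar>E \<eta> - P \<eta>\<bar> \<le> real n * 4 * (B * \<delta> ^ 3)" if \<eta>: "\<eta> \<in> configs n" for \<eta>
  proof -
    let ?r = "\<lambda>x. f (?Y \<eta> + - \<delta> * spin \<eta> x) - f (?Y \<eta>) - F (?Y \<eta>) * (- \<delta> * spin \<eta> x) - F1 (?Y \<eta>) * (- \<delta> * spin \<eta> x)\<^sup>2 / 2"
    have eq: "E \<eta> - P \<eta> = (\<Sum>x\<in>torus n. rate \<theta> n x \<eta> * ?r x)"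
    proof -
      have "(spin \<eta> x)\<^sup>2 = 1" if "x \<in> torus n" for x using spin_values[OF \<eta> that] by auto
      then have "(\<Sum>x\<in>torus n. rate \<theta> n x \<eta> * ?r x)
        = (\<Sum>x\<in>torus n. rate \<theta> n x \<eta> * (f (?Y \<eta> + - \<delta> * spin \<eta> x) - f (?Y \<eta>)) - (- \<delta> * F (?Y \<eta>) * (rate \<theta> n x \<eta> * spin \<eta> x) + \<delta>\<^sup>2 * (F1 (?Y \<eta>) / 2) * rate \<theta> n x \<eta>))"
        by (intro sum.cong) (simp_all add: power_mult_distrib algebra_simps)
      then show ?thesis by (simp only: E_def P_def sum_subtractf sum.distrib sum_distrib_left)
    qed
    have "\<bar>E \<eta> - P \<eta>\<bar> \<le> (\<Sum>x\<in>torus n. 4 * (B * \<delta> ^ 3))"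
      unfolding eq
    proof (rule order.trans[OF sum_abs], rule sum_mono)
      fix x assume x: "x \<in> torus n"
      have "\<bar>- \<delta> * spin \<eta> x\<bar> = \<delta>" using spin_values[OF \<eta> x] \<delta> by auto
      then have "\<bar>?r x\<bar> \<le> B * \<delta> ^ 3"
        using taylor_3[OF f F F1 B(4), of "?Y \<eta>" "- \<delta> * spin \<eta> x"] by simp
      then show "\<bar>rate \<theta> n x \<eta> * ?r x\<bar> \<le> 4 * (B * \<delta> ^ 3)"
        unfolding abs_mult using rate_pos[OF n0 x \<eta> gamma01] rate_le[OF n0 x \<eta> gamma01] by (intro mult_mono) auto
    qed
    then show ?thesis by simp
  qed
  have "ev P = ev E - ev (\<lambda>\<eta>. E \<eta> - P \<eta>)" by (simp add: ev_diff)
  also have "\<bar>\<dots>\<bar> = \<bar>ev (\<lambda>\<eta>. E \<eta> - P \<eta>)\<bar>" by (simp add: evE)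
  also have "\<dots> \<le> real n * 4 * (B * \<delta> ^ 3)"
    by (rule order.trans[OF abs_ev_le]) (auto intro!: ev_le_const EP)
  finally have "\<bar>ev P\<bar> \<le> \<delta>\<^sup>2 * real n * (4 * B * \<delta>)" by (simp add: power2_eq_square power3_eq_cube mult_ac)
  moreover have "ev P = \<delta>\<^sup>2 * real n * ev (\<lambda>\<eta>. P \<eta> / (\<delta>\<^sup>2 * real n))"
    unfolding ev_cmult[symmetric] using \<delta> by (intro ev_cong) (simp add: n0')
  ultimately have "\<delta>\<^sup>2 * real n * \<bar>ev (\<lambda>\<eta>. P \<eta> / (\<delta>\<^sup>2 * real n))\<bar> \<le> \<delta>\<^sup>2 * real n * (4 * B * \<delta>)"
    by (simp add: abs_mult)
  then have evQ: "\<bar>ev (\<lambda>\<eta>. P \<eta> / (\<delta>\<^sup>2 * real n))\<bar> \<le> 4 * B * \<delta>"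
    by (rule mult_left_le_imp_le) (use \<delta> n0 in simp)
  \<comment> \<open>An exact identity. After the normalized expansion P the corrections are, in
    order: \<gamma> differing from 1 / 2 in the cubic term, the triple replacement, the m^2 part of
    the total rate, and the two pair replacements.\<close>
  have pt: "F1 (?Y \<eta>) / 2 - (2 * \<theta> * ?Y \<eta> + 2 * ?Y \<eta> ^ 3) * F (?Y \<eta>) =
      P \<eta> / (\<delta>\<^sup>2 * real n) + (8 * \<gamma>\<^sup>2 - 2) * (?Y \<eta> ^ 3 * F (?Y \<eta>)) + \<gamma>\<^sup>2 / rho * (F (?Y \<eta>) * triple_dev n \<eta>)
      + (2 * \<gamma> - \<gamma>\<^sup>2) / 2 * (F1 (?Y \<eta>) * (mag n \<eta>)\<^sup>2) + \<gamma> / real n * (F1 (?Y \<eta>) * pair_dev n 1 \<eta>)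
      - \<gamma>\<^sup>2 / (2 * real n) * (F1 (?Y \<eta>) * pair_dev n 2 \<eta>)" if \<eta>: "\<eta> \<in> configs n" for \<eta>
  proof -
    have m: "mag n \<eta> = 2 * ?Y \<eta> / rho" using r0 by (simp add: scaled_def)
    have g: "1 - 2 * \<gamma> = \<theta> / rho\<^sup>2" by (simp add: one_minus_two_gamma rho)
    have "P \<eta> / (\<delta>\<^sup>2 * real n) = - F (?Y \<eta>) * ((\<Sum>x\<in>torus n. rate \<theta> n x \<eta> * spin \<eta> x) / rho)
       + F1 (?Y \<eta>) / 2 * ((\<Sum>x\<in>torus n. rate \<theta> n x \<eta>) / real n)"
    proof -
      have "\<delta> * real n = rho" by (simp add: \<delta>_def n0')
      then have "\<delta>\<^sup>2 * real n = \<delta> * rho" by (simp add: power2_eq_square mult.assoc)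
      then have 1: "- \<delta> * X * Y / (\<delta>\<^sup>2 * real n) = - X * (Y / rho)" for X Y using \<delta>(1) by simp
      have 2: "\<delta>\<^sup>2 * X * Y / (\<delta>\<^sup>2 * real n) = X * (Y / real n)" for X Y using \<delta>(1) by simp
      show ?thesis unfolding P_def add_divide_distrib 1 2 ..
    qed
    also have "(\<Sum>x\<in>torus n. rate \<theta> n x \<eta> * spin \<eta> x) / rho = 2 * \<theta> * ?Y \<eta> + 8 * \<gamma>\<^sup>2 * ?Y \<eta> ^ 3 + \<gamma>\<^sup>2 / rho * triple_dev n \<eta>"
      unfolding sum_rate_spin[OF \<eta>] g m n using r0 by (simp add: field_simps power2_eq_square power3_eq_cube power4_eq_xxxx)
    also have "(\<Sum>x\<in>torus n. rate \<theta> n x \<eta>) / real n = 1 - (2 * \<gamma> - \<gamma>\<^sup>2) * (mag n \<eta>)\<^sup>2 - 2 * \<gamma> / real n * pair_dev n 1 \<eta> + \<gamma>\<^sup>2 / real n * pair_dev n 2 \<eta>"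
      unfolding sum_rate by (simp add: field_simps n0')
    finally show ?thesis by (simp add: algebra_simps diff_divide_distrib)
  qed
  have "ev (\<lambda>\<eta>. F1 (?Y \<eta>) / 2 - (2 * \<theta> * ?Y \<eta> + 2 * ?Y \<eta> ^ 3) * F (?Y \<eta>)) =
      ev (\<lambda>\<eta>. P \<eta> / (\<delta>\<^sup>2 * real n)) + (8 * \<gamma>\<^sup>2 - 2) * ev (\<lambda>\<eta>. ?Y \<eta> ^ 3 * F (?Y \<eta>)) + \<gamma>\<^sup>2 / rho * ev (\<lambda>\<eta>. F (?Y \<eta>) * triple_dev n \<eta>)
      + (2 * \<gamma> - \<gamma>\<^sup>2) / 2 * ev (\<lambda>\<eta>. F1 (?Y \<eta>) * (mag n \<eta>)\<^sup>2) + \<gamma> / real n * ev (\<lambda>\<eta>. F1 (?Y \<eta>) * pair_dev n 1 \<eta>)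
      - \<gamma>\<^sup>2 / (2 * real n) * ev (\<lambda>\<eta>. F1 (?Y \<eta>) * pair_dev n 2 \<eta>)"
    unfolding ev_cmult[symmetric] ev_add[symmetric] ev_diff[symmetric] by (intro ev_cong pt)
  moreover have "4 * B * \<delta> \<le> 4 * (B / rho)"
  proof -
    have "rho ^ 1 \<le> rho ^ 3" using rho(1) by (intro power_increasing) auto
    then show ?thesis unfolding \<delta>(2) using B(1) r0 by (simp add: field_simps)
  qed
  moreover have "\<bar>(8 * \<gamma>\<^sup>2 - 2) * ev (\<lambda>\<eta>. ?Y \<eta> ^ 3 * F (?Y \<eta>))\<bar> \<le> 6 * \<bar>\<theta>\<bar> * (B / rho)"
  proof -
    \<comment> \<open>The factor vanishes at \<gamma> = 1 / 2, hence it is of order n^(-1/2), even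
      better than needed.\<close>
    have "8 * \<gamma>\<^sup>2 - 2 = - 2 * (1 + 2 * \<gamma>) * (1 - 2 * \<gamma>)" by (simp add: power2_eq_square algebra_simps)
    also have "\<bar>\<dots>\<bar> = 2 * (1 + 2 * \<gamma>) * (\<bar>\<theta>\<bar> / rho\<^sup>2)"
      unfolding one_minus_two_gamma rho(3) using gamma01 by (simp add: abs_mult)
    also have "\<dots> \<le> 6 * (\<bar>\<theta>\<bar> / rho)"
    proof (intro mult_mono divide_left_mono)
      show "rho \<le> rho\<^sup>2" using rho(1) by (simp add: power2_eq_square)
    qed (use gamma01 r0 in auto)
    finally have "\<bar>8 * \<gamma>\<^sup>2 - 2\<bar> \<le> 6 * (\<bar>\<theta>\<bar> / rho)" .
    moreover have "\<bar>ev (\<lambda>\<eta>. ?Y \<eta> ^ 3 * F (?Y \<eta>))\<bar> \<le> B"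
      by (rule order.trans[OF abs_ev_le]) (auto intro!: ev_le_const B)
    ultimately have "\<bar>8 * \<gamma>\<^sup>2 - 2\<bar> * \<bar>ev (\<lambda>\<eta>. ?Y \<eta> ^ 3 * F (?Y \<eta>))\<bar> \<le> 6 * (\<bar>\<theta>\<bar> / rho) * B"
      using r0 by (intro mult_mono) auto
    then show ?thesis by (simp add: abs_mult)
  qed
  moreover have g2: "0 \<le> \<gamma>\<^sup>2" "\<gamma>\<^sup>2 \<le> 1" using gamma01 by (simp_all add: power_le_one)
  moreover have "\<bar>\<gamma>\<^sup>2 / rho * ev (\<lambda>\<eta>. F (?Y \<eta>) * triple_dev n \<eta>)\<bar> \<le> 4000 * (B / rho)"
  proof -
    have "\<bar>\<gamma>\<^sup>2 / rho\<bar> * \<bar>ev (\<lambda>\<eta>. F (?Y \<eta>) * triple_dev n \<eta>)\<bar> \<le> 1 / rho * (4000 * B)"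
      using g2 r0 bounded_dev(3)[OF a B(1,2)] by (intro mult_mono) (auto simp: divide_right_mono)
    then show ?thesis by (simp add: abs_mult)
  qed
  moreover have "\<bar>(2 * \<gamma> - \<gamma>\<^sup>2) / 2 * ev (\<lambda>\<eta>. F1 (?Y \<eta>) * (mag n \<eta>)\<^sup>2)\<bar> \<le> 2 * (150001 + 256 * \<theta>\<^sup>2) * (B / rho)"
  proof -
    have "\<bar>ev (\<lambda>\<eta>. F1 (?Y \<eta>) * (mag n \<eta>)\<^sup>2)\<bar> \<le> ev (\<lambda>\<eta>. B * (mag n \<eta>)\<^sup>2)"
      by (rule order.trans[OF abs_ev_le]) (auto intro!: ev_mono mult_right_mono B simp: abs_mult)
    also have "\<dots> \<le> B * ((150001 + 256 * \<theta>\<^sup>2) / rho\<^sup>2)"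
      unfolding ev_cmult using B(1) by (intro mult_left_mono second_moment a) auto
    also have "\<dots> \<le> B * ((150001 + 256 * \<theta>\<^sup>2) / rho)"
      using B(1) rho(1) r0 by (intro mult_left_mono divide_left_mono) (auto simp: power2_eq_square)
    finally have 1: "\<bar>ev (\<lambda>\<eta>. F1 (?Y \<eta>) * (mag n \<eta>)\<^sup>2)\<bar> \<le> B * ((150001 + 256 * \<theta>\<^sup>2) / rho)" .
    have "\<bar>(2 * g - q) / 2\<bar> \<le> 2" if "0 \<le> q" "q \<le> 1" "0 < g" "g < 1" for g q :: real
      using that by (simp add: abs_le_iff field_simps)
    then have "\<bar>(2 * \<gamma> - \<gamma>\<^sup>2) / 2\<bar> \<le> 2" using g2 gamma01 by blast
    then have "\<bar>(2 * \<gamma> - \<gamma>\<^sup>2) / 2\<bar> * \<bar>ev (\<lambda>\<eta>. F1 (?Y \<eta>) * (mag n \<eta>)\<^sup>2)\<bar> \<le> 2 * (B * ((150001 + 256 * \<theta>\<^sup>2) / rho))"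
      using 1 by (rule mult_mono) auto
    then show ?thesis by (simp add: abs_mult mult_ac)
  qed
  moreover have n_ge: "1 / real n \<le> 1 / rho"
  proof -
    have "rho ^ 1 \<le> rho ^ 4" using rho(1) by (intro power_increasing) auto
    then show ?thesis unfolding n using r0 by (simp add: field_simps)
  qed
  moreover have "\<bar>\<gamma> / real n * ev (\<lambda>\<eta>. F1 (?Y \<eta>) * pair_dev n 1 \<eta>)\<bar> \<le> 600 * (B / rho)"
  proof -
    have "\<gamma> / real n \<le> 1 / real n" using gamma01 by (intro divide_right_mono) auto
    then have "\<bar>\<gamma> / real n\<bar> * \<bar>ev (\<lambda>\<eta>. F1 (?Y \<eta>) * pair_dev n 1 \<eta>)\<bar> \<le> 1 / rho * (600 * B)"
      using n_ge r0 gamma01 bounded_dev(1)[OF a B(1,3)] by (intro mult_mono) auto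
    then show ?thesis by (simp add: abs_mult)
  qed
  moreover have "\<bar>\<gamma>\<^sup>2 / (2 * real n) * ev (\<lambda>\<eta>. F1 (?Y \<eta>) * pair_dev n 2 \<eta>)\<bar> \<le> 600 * (B / rho)"
  proof -
    have "\<gamma>\<^sup>2 / (2 * real n) \<le> 1 / real n" using g2 n0 by (simp add: field_simps)
    then have "\<bar>\<gamma>\<^sup>2 / (2 * real n)\<bar> * \<bar>ev (\<lambda>\<eta>. F1 (?Y \<eta>) * pair_dev n 2 \<eta>)\<bar> \<le> 1 / rho * (600 * B)"
      using n_ge r0 gamma01 bounded_dev(2)[OF a B(1,3)] by (intro mult_mono) auto
    then show ?thesis by (simp add: abs_mult)
  qed
  moreover have "0 \<le> B / rho" using B(1) r0 by simp
  moreover have "(6000 + 6 * \<bar>\<theta>\<bar> + 2 * (150001 + 256 * \<theta>\<^sup>2)) * B / rho = 6000 * (B / rho) + 6 * \<bar>\<theta>\<bar> * (B / rho) + 2 * (150001 + 256 * \<theta>\<^sup>2) * (B / rho)"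
    by (simp add: algebra_simps add_divide_distrib)
  \<comment> \<open>The purely numerical errors are 4 + 4000 + 600 + 600, below 6000.\<close>
  moreover have "\<bar>e\<bar> \<le> t" if "e = A1 + A2 + A3 + A4 + A5 - A6" "\<bar>A1\<bar> \<le> d" "d \<le> 4 * b" "\<bar>A2\<bar> \<le> t2" "\<bar>A3\<bar> \<le> 4000 * b" "\<bar>A4\<bar> \<le> t4" "\<bar>A5\<bar> \<le> 600 * b" "\<bar>A6\<bar> \<le> 600 * b" "0 \<le> b" "t = 6000 * b + t2 + t4"
    for e A1 A2 A3 A4 A5 A6 d b t t2 t4 :: real
    using that by linarith
  ultimately show ?thesis using evQ by blast
qed

end

section \<open>The stationary law\<close>

text \<open>Induction by removing a state \<open>s\<close> and redirecting the jumps into \<open>s\<close> according to the exit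
  distribution of \<open>s\<close>.\<close>

lemma stationary_weights_exist:
  fixes q :: "'a \<Rightarrow> 'a \<Rightarrow> real"
  assumes "finite S" "S \<noteq> {}" "\<And>x y. 0 \<le> q x y"
  shows "\<exists>w. (\<forall>x. 0 \<le> w x) \<and> (\<Sum>x\<in>S. w x) = 1 \<and>
    (\<forall>f. (\<Sum>x\<in>S. w x * (\<Sum>y\<in>S. q x y * (f y - f x))) = 0)"
  using assms
proof (induction S arbitrary: q rule: finite_ne_induct)
  case (singleton s)
  then show ?case by (intro exI[of _ "\<lambda>_. 1"]) simp
next
  case (insert s S)
  define Q where "Q = (\<Sum>y\<in>S. q s y)"
  show ?case
  proof (cases "Q = 0")
    \<comment> \<open>Then \<open>s\<close> has no exit to \<open>S\<close>, and the point mass at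
      \<open>s\<close> is stationary.\<close>
    case True
    then have "\<forall>y\<in>S. q s y = 0"
      using insert.prems insert.hyps sum_nonneg_eq_0_iff[of S "q s"] by (auto simp: Q_def)
    then show ?thesis using insert.hyps
      by (intro exI[of _ "\<lambda>x. if x = s then 1 else 0"]) (auto simp: if_distrib[of "\<lambda>c. c * _"] cong: if_cong)
  next
    case False
    then have Q: "0 < Q" using insert.prems by (simp add: Q_def order_neq_le_trans sum_nonneg)
    have "0 \<le> q x y + q x s * q s y / Q" for x y using Q insert.prems by simp
    from insert.IH[of "\<lambda>x y. q x y + q x s * q s y / Q", OF this]
    obtain w where w: "\<And>x. 0 \<le> w x" "(\<Sum>x\<in>S. w x) = 1"
      and st: "\<And>f. (\<Sum>x\<in>S. w x * (\<Sum>y\<in>S. (q x y + q x s * q s y / Q) * (f y - f x))) = 0" by blast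
    \<comment> \<open>Mass of \<open>s\<close> before normalization: the inflow from
      \<open>S\<close> divided by the exit rate \<open>Q\<close>, as balance at \<open>s\<close>
      demands.\<close>
    define c where "c = (\<Sum>x\<in>S. w x * q x s) / Q"
    have c: "0 \<le> c" unfolding c_def using w Q insert.prems by (simp add: sum_nonneg)
    define v where "v x = (if x = s then c else w x) / (1 + c)" for x
    have S: "(\<Sum>x\<in>S. if x = s then a else g x) = (\<Sum>x\<in>S. g x)" for a and g :: "'a \<Rightarrow> real"
      using insert.hyps by (intro sum.cong) auto
    have v_S: "x \<in> S \<Longrightarrow> v x = w x / (1 + c)" and v_s: "v s = c / (1 + c)" for x
      using insert.hyps by (auto simp: v_def)
    show ?thesis
    proof (intro exI[of _ v] conjI allI)
      show "0 \<le> v x" for x using c w by (simp add: v_def)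
      show "(\<Sum>x\<in>insert s S. v x) = 1"
        using insert.hyps w c by (simp add: v_S v_s sum_divide_distrib[symmetric] add_divide_distrib[symmetric])
      fix f :: "'a \<Rightarrow> real"
      define A where "A x = (\<Sum>y\<in>S. q x y * (f y - f x))" for x
      define F where "F = (\<Sum>y\<in>S. q s y * f y)"
      have "(\<Sum>y\<in>S. (q x y + q x s * q s y / Q) * (f y - f x)) = A x + q x s * (F / Q - f x)" for x
      proof -
        have "(\<Sum>y\<in>S. (q x y + q x s * q s y / Q) * (f y - f x)) =
          (\<Sum>y\<in>S. q x y * (f y - f x) + (q x s / Q * (q s y * f y) - q x s * f x / Q * q s y))"
          by (intro sum.cong) (simp_all add: algebra_simps diff_divide_distrib)
        also have "\<dots> = A x + (q x s / Q * F - q x s * f x / Q * Q)"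
          by (simp only: sum.distrib sum_subtractf sum_distrib_left[symmetric] A_def F_def Q_def[symmetric])
        finally show ?thesis using Q by (simp add: algebra_simps)
      qed
      then have 0: "(\<Sum>x\<in>S. w x * (A x + q x s * (F / Q - f x))) = 0" using st[of f] by simp
      have As: "A s = F - Q * f s"
        by (simp add: A_def F_def Q_def right_diff_distrib sum_subtractf sum_distrib_right)
      have "(\<Sum>x\<in>insert s S. v x * (\<Sum>y\<in>insert s S. q x y * (f y - f x)))
        = (c * A s + (\<Sum>x\<in>S. w x * (q x s * (f s - f x) + A x))) / (1 + c)"
        using insert.hyps by (simp add: v_s v_S A_def add_divide_distrib sum_divide_distrib)
      also have "c * A s = (\<Sum>x\<in>S. w x * q x s * (F / Q - f s))"
        unfolding sum_distrib_right[symmetric] c_def As using Q by (simp add: field_simps)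
      also have "\<dots> + (\<Sum>x\<in>S. w x * (q x s * (f s - f x) + A x)) = 0"
        unfolding sum.distrib[symmetric] 0[symmetric] by (intro sum.cong) (simp_all add: algebra_simps)
      finally show "(\<Sum>x\<in>insert s S. v x * (\<Sum>y\<in>insert s S. q x y * (f y - f x))) = 0" by simp
    qed
  qed
qed

section \<open>Irreducibility and uniqueness of stationary weights\<close>

definition jump_rate :: "real \<Rightarrow> real \<Rightarrow> nat \<Rightarrow> config \<Rightarrow> config \<Rightarrow> real" where
  "jump_rate \<theta> a n \<eta> \<zeta> = (real n)\<^sup>2 * (\<Sum>x\<in>torus n. if \<zeta> = exchange \<eta> x (right n x) then 1 else 0)
     + a * (\<Sum>x\<in>torus n. if \<zeta> = flip \<eta> x then rate \<theta> n x \<eta> else 0)"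

lemma gen_jump_rate:
  assumes "0 < n" "\<eta> \<in> configs n"
  shows "gen \<theta> a n f \<eta> = (\<Sum>\<zeta>\<in>configs n. jump_rate \<theta> a n \<eta> \<zeta> * (f \<zeta> - f \<eta>))"
proof -
  have *: "(\<Sum>\<zeta>\<in>configs n. (if \<zeta> = \<xi> then r else 0) * (f \<zeta> - f \<eta>)) = r * (f \<xi> - f \<eta>)" if "\<xi> \<in> configs n" for \<xi> r
    using that by (simp add: if_distrib[of "\<lambda>c. c * _"] cong: if_cong)
  have "(\<Sum>\<zeta>\<in>configs n. jump_rate \<theta> a n \<eta> \<zeta> * (f \<zeta> - f \<eta>)) =
     (real n)\<^sup>2 * (\<Sum>x\<in>torus n. \<Sum>\<zeta>\<in>configs n. (if \<zeta> = exchange \<eta> x (right n x) then 1 else 0) * (f \<zeta> - f \<eta>))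
     + a * (\<Sum>x\<in>torus n. \<Sum>\<zeta>\<in>configs n. (if \<zeta> = flip \<eta> x then rate \<theta> n x \<eta> else 0) * (f \<zeta> - f \<eta>))"
    unfolding jump_rate_def distrib_right sum.distrib sum_distrib_left sum_distrib_right
    by (subst (3 4) sum.swap) (simp add: mult.assoc)
  also have "\<dots> = gen \<theta> a n f \<eta>"
    unfolding gen_def gen_ex_def gen_G_def using assms by (simp add: *)
  finally show ?thesis ..
qed

text \<open>Stated for arbitrary weights, so that the condition is linear and applies to differences
  of laws.\<close>

definition is_stationary :: "real \<Rightarrow> real \<Rightarrow> nat \<Rightarrow> (config \<Rightarrow> real) \<Rightarrow> bool" where
  "is_stationary \<theta> a n v \<longleftrightarrow> (\<forall>f. (\<Sum>\<eta>\<in>configs n. v \<eta> * gen \<theta> a n f \<eta>) = 0)"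

text \<open>Tested on the indicator of \<eta>, stationarity is a vanishing sum of nonnegative terms,
  since the only possibly negative one carries the weight of \<eta>. So every configuration that
  jumps to \<eta> has weight zero, among them its flips.\<close>

lemma stationary_zero_spreads:
  assumes n: "0 < n" and a: "0 < a" and g: "0 < gamma \<theta> n" "gamma \<theta> n < 1"
    and st: "is_stationary \<theta> a n v" and v: "\<And>\<eta>. \<eta> \<in> configs n \<Longrightarrow> 0 \<le> v \<eta>"
    and \<eta>: "\<eta> \<in> configs n" "v \<eta> = 0" and x: "x \<in> torus n"
  shows "v (flip \<eta> x) = 0"
proof -
  define f where "f \<zeta> = (if \<zeta> = \<eta> then 1 else 0 :: real)" for \<zeta>
  have nonneg: "0 \<le> v \<zeta> * gen \<theta> a n f \<zeta>" if \<zeta>: "\<zeta> \<in> configs n" for \<zeta>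
  proof (cases "\<zeta> = \<eta>")
    case False
    then have "0 \<le> gen \<theta> a n f \<zeta>"
      unfolding gen_def gen_ex_def gen_G_def f_def
      by (intro add_nonneg_nonneg mult_nonneg_nonneg sum_nonneg)
        (use a rate_pos[OF n _ \<zeta> g] in \<open>auto intro: less_imp_le\<close>)
    then show ?thesis using v[OF \<zeta>] by simp
  qed (use \<eta> in simp)
  have "(\<Sum>\<zeta>\<in>configs n. v \<zeta> * gen \<theta> a n f \<zeta>) = 0" using st by (simp add: is_stationary_def)
  then have 0: "v (flip \<eta> x) * gen \<theta> a n f (flip \<eta> x) = 0"
    using nonneg \<eta> x by (simp add: sum_nonneg_eq_0_iff)
  have ne: "flip \<eta> x \<noteq> \<eta>" using config_values[OF \<eta>(1) x] by (auto simp: flip_def fun_eq_iff)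
  have \<zeta>: "flip \<eta> x \<in> configs n" using \<eta> x by simp
  have "0 < gen \<theta> a n f (flip \<eta> x)"
    unfolding gen_def gen_ex_def gen_G_def
  proof (intro add_nonneg_pos mult_pos_pos mult_nonneg_nonneg a sum_nonneg)
    show "0 < (\<Sum>y\<in>torus n. rate \<theta> n y (flip \<eta> x) * (f (flip (flip \<eta> x) y) - f (flip \<eta> x)))"
    proof (rule sum_pos2[of _ x])
      show "0 < rate \<theta> n x (flip \<eta> x) * (f (flip (flip \<eta> x) x) - f (flip \<eta> x))"
        using ne \<eta> x rate_pos[OF n x \<zeta> g] by (simp add: f_def)
      show "0 \<le> rate \<theta> n y (flip \<eta> x) * (f (flip (flip \<eta> x) y) - f (flip \<eta> x))" if "y \<in> torus n" for y
        using ne rate_pos[OF n that \<zeta> g] by (simp add: f_def)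
    qed (use x in auto)
  qed (use ne in \<open>auto simp: f_def\<close>)
  then show ?thesis using 0 by simp
qed

text \<open>Flips alone connect all configurations: induction on the number of sites where \<zeta>
  and \<eta> differ.\<close>

lemma stationary_zero_everywhere:
  assumes n: "0 < n" and a: "0 < a" and g: "0 < gamma \<theta> n" "gamma \<theta> n < 1"
    and st: "is_stationary \<theta> a n v" and v: "\<And>\<eta>. \<eta> \<in> configs n \<Longrightarrow> 0 \<le> v \<eta>"
    and \<eta>: "\<eta> \<in> configs n" "v \<eta> = 0" and \<zeta>: "\<zeta> \<in> configs n"
  shows "v \<zeta> = 0"
  using \<zeta>
proof (induction "card {x \<in> torus n. \<zeta> x \<noteq> \<eta> x}" arbitrary: \<zeta>)
  case 0
  then have "\<forall>x\<in>torus n. \<zeta> x = \<eta> x" by simp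
  then have "\<zeta> = \<eta>"
    using 0 \<eta> unfolding configs_def by (intro PiE_ext) auto
  then show ?case using \<eta> by simp
next
  case (Suc k)
  then have "{x \<in> torus n. \<zeta> x \<noteq> \<eta> x} \<noteq> {}" by (metis card.empty nat.distinct(1))
  then obtain x where x: "x \<in> torus n" "\<zeta> x \<noteq> \<eta> x" by blast
  have "{y \<in> torus n. flip \<zeta> x y \<noteq> \<eta> y} = {y \<in> torus n. \<zeta> y \<noteq> \<eta> y} - {x}"
    using x config_values[OF Suc.prems x(1)] config_values[OF \<eta>(1) x(1)] by (auto simp: flip_def)
  then have "k = card {y \<in> torus n. flip \<zeta> x y \<noteq> \<eta> y}" using Suc.hyps(2) x by simp
  then have "v (flip \<zeta> x) = 0" using Suc.hyps(1) Suc.prems x by simp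
  then show ?case
    using stationary_zero_spreads[OF n a g st v, of "flip \<zeta> x" x] Suc.prems x by simp
qed

text \<open>Subtracting from v the largest multiple of w that stays below it gives nonnegative
  stationary weights with a zero, hence zero everywhere; the total masses then force the multiple to
  be 1.\<close>

lemma stationary_unique:
  assumes n: "0 < n" and a: "0 < a" and g: "0 < gamma \<theta> n" "gamma \<theta> n < 1"
    and v: "is_stationary \<theta> a n v" "\<And>\<eta>. \<eta> \<in> configs n \<Longrightarrow> 0 < v \<eta>" "sum v (configs n) = 1"
    and w: "is_stationary \<theta> a n w" "\<And>\<eta>. \<eta> \<in> configs n \<Longrightarrow> 0 < w \<eta>" "sum w (configs n) = 1"
    and \<zeta>: "\<zeta> \<in> configs n"
  shows "v \<zeta> = w \<zeta>"
proof -
  define t where "t = Min ((\<lambda>\<eta>. v \<eta> / w \<eta>) ` configs n)"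
  define u where "u \<eta> = v \<eta> - t * w \<eta>" for \<eta>
  have "t \<in> (\<lambda>\<eta>. v \<eta> / w \<eta>) ` configs n" unfolding t_def using \<zeta> by (intro Min_in) auto
  then obtain \<eta> where \<eta>: "\<eta> \<in> configs n" "t = v \<eta> / w \<eta>" by blast
  have t_le: "t \<le> v \<xi> / w \<xi>" if "\<xi> \<in> configs n" for \<xi> unfolding t_def using that by (intro Min_le) auto
  have "u \<eta> = 0" using \<eta> w(2)[OF \<eta>(1)] by (simp add: u_def)
  moreover have "0 \<le> u \<xi>" if "\<xi> \<in> configs n" for \<xi>
    using t_le[OF that] w(2)[OF that] by (simp add: u_def field_simps)
  moreover have "is_stationary \<theta> a n u"
    using v(1) w(1) by (simp add: is_stationary_def u_def left_diff_distrib sum_subtractf mult.assoc sum_distrib_left[symmetric])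
  ultimately have u0: "u \<xi> = 0" if "\<xi> \<in> configs n" for \<xi>
    using stationary_zero_everywhere[OF n a g _ _ \<eta>(1) _ that, of u] by blast
  have "0 = (\<Sum>\<xi>\<in>configs n. u \<xi>)" using u0 by simp
  also have "\<dots> = 1 - t" by (simp add: u_def sum_subtractf v(3) sum_distrib_left[symmetric] w(3))
  finally show ?thesis using u0[OF \<zeta>] by (simp add: u_def)
qed

section \<open>From the semigroup to the generator\<close>

lemma gen_bound:
  assumes n: "0 < n"
  obtains C :: real where "0 \<le> C"
    "\<And>(f :: config \<Rightarrow> real) (M :: real) \<eta>. (\<And>\<eta>. \<eta> \<in> configs n \<Longrightarrow> \<bar>f \<eta>\<bar> \<le> M) \<Longrightarrow> \<eta> \<in> configs n \<Longrightarrow> \<bar>gen \<theta> a n f \<eta>\<bar> \<le> C * M"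
proof
  define R where "R = (\<Sum>\<eta>\<in>configs n. \<Sum>\<zeta>\<in>configs n. \<bar>jump_rate \<theta> a n \<eta> \<zeta>\<bar>)"
  show "0 \<le> 2 * R" by (simp add: R_def sum_nonneg)
  fix f :: "config \<Rightarrow> real" and M :: real and \<eta> assume f: "\<And>\<eta>. \<eta> \<in> configs n \<Longrightarrow> \<bar>f \<eta>\<bar> \<le> M" and \<eta>: "\<eta> \<in> configs n"
  have M: "0 \<le> M" using f[OF \<eta>] by simp
  have "\<bar>gen \<theta> a n f \<eta>\<bar> \<le> (\<Sum>\<zeta>\<in>configs n. \<bar>jump_rate \<theta> a n \<eta> \<zeta>\<bar> * (2 * M))"
    unfolding gen_jump_rate[OF n \<eta>]
  proof (rule order.trans[OF sum_abs], rule sum_mono)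
    fix \<zeta> assume \<zeta>: "\<zeta> \<in> configs n"
    show "\<bar>jump_rate \<theta> a n \<eta> \<zeta> * (f \<zeta> - f \<eta>)\<bar> \<le> \<bar>jump_rate \<theta> a n \<eta> \<zeta>\<bar> * (2 * M)"
      unfolding abs_mult using f[OF \<zeta>] f[OF \<eta>] by (intro mult_left_mono) auto
  qed
  also have "\<dots> = (\<Sum>\<zeta>\<in>configs n. \<bar>jump_rate \<theta> a n \<eta> \<zeta>\<bar>) * (2 * M)" by (simp add: sum_distrib_right)
  also have "\<dots> \<le> R * (2 * M)"
    unfolding R_def using \<eta> M
    by (intro mult_right_mono member_le_sum[of \<eta> _ "\<lambda>\<eta>. \<Sum>\<zeta>\<in>configs n. \<bar>jump_rate \<theta> a n \<eta> \<zeta>\<bar>"]) (auto intro: sum_nonneg)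
  finally show "\<bar>gen \<theta> a n f \<eta>\<bar> \<le> 2 * R * M" by simp
qed

lemma expectation_configs:
  assumes "set_pmf \<mu> \<subseteq> configs n"
  shows "measure_pmf.expectation \<mu> f = (\<Sum>\<eta>\<in>configs n. pmf \<mu> \<eta> * f \<eta>)"
  using assms by (subst integral_measure_pmf_real[of "configs n"]) (auto simp: mult.commute)

text \<open>Makes the expectation of the semigroup a power series in t whose coefficients are
  expectations of iterates of the generator.\<close>

lemma expectation_semigroup_sums:
  assumes n: "0 < n" and \<mu>: "set_pmf \<mu> \<subseteq> configs n"
  shows "(\<lambda>k. (\<Sum>\<eta>\<in>configs n. pmf \<mu> \<eta> * (gen \<theta> a n ^^ k) f \<eta>) / fact k * t ^ k)
     sums measure_pmf.expectation \<mu> (markov_semigroup \<theta> a n t f)"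
proof -
  obtain C :: real where C: "0 \<le> C" "\<And>(f :: config \<Rightarrow> real) (M :: real) \<eta>. (\<And>\<eta>. \<eta> \<in> configs n \<Longrightarrow> \<bar>f \<eta>\<bar> \<le> M) \<Longrightarrow> \<eta> \<in> configs n \<Longrightarrow> \<bar>gen \<theta> a n f \<eta>\<bar> \<le> C * M"
    using gen_bound[OF n] by blast
  define M where "M = (\<Sum>\<eta>\<in>configs n. \<bar>f \<eta>\<bar>)"
  have it: "\<bar>(gen \<theta> a n ^^ k) f \<eta>\<bar> \<le> C ^ k * M" if "\<eta> \<in> configs n" for k \<eta>
    using that
  proof (induction k arbitrary: \<eta>)
    case 0
    then show ?case unfolding M_def using member_le_sum[of \<eta> "configs n" "\<lambda>\<eta>. \<bar>f \<eta>\<bar>"] by simp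
  next
    case (Suc k)
    then show ?case using C(2)[of "(gen \<theta> a n ^^ k) f" "C ^ k * M" \<eta>] by simp
  qed
  have sm: "summable (\<lambda>k. t ^ k / fact k * (gen \<theta> a n ^^ k) f \<eta>)" if \<eta>: "\<eta> \<in> configs n" for \<eta>
  proof (rule summable_comparison_test')
    show "summable (\<lambda>k. M * (inverse (fact k) * (\<bar>t\<bar> * C) ^ k))"
      by (intro summable_mult summable_exp)
    fix k :: nat
    have "\<bar>t ^ k / fact k\<bar> * \<bar>(gen \<theta> a n ^^ k) f \<eta>\<bar> \<le> \<bar>t ^ k / fact k\<bar> * (C ^ k * M)"
      by (intro mult_left_mono it \<eta>) auto
    then show "norm (t ^ k / fact k * (gen \<theta> a n ^^ k) f \<eta>) \<le> M * (inverse (fact k) * (\<bar>t\<bar> * C) ^ k)"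
      by (simp add: abs_mult power_abs power_mult_distrib field_simps)
  qed
  have "(\<lambda>k. \<Sum>\<eta>\<in>configs n. pmf \<mu> \<eta> * (t ^ k / fact k * (gen \<theta> a n ^^ k) f \<eta>))
     sums (\<Sum>\<eta>\<in>configs n. pmf \<mu> \<eta> * markov_semigroup \<theta> a n t f \<eta>)"
    unfolding markov_semigroup_def by (intro sums_sum sums_mult summable_sums sm)
  then show ?thesis
    unfolding expectation_configs[OF \<mu>] by (simp add: sum_distrib_left sum_divide_distrib mult_ac)
qed

text \<open>Invariance makes the power series constant for t \<ge> 0 only, so the first coefficient
  is compared with the right derivative at 0. Conversely each iterate of order k \<ge> 1 is the
  generator of something, so stationarity kills every coefficient but the zeroth.\<close>

lemma invariant_law_iff:
  assumes n: "0 < n"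
  shows "invariant_law \<theta> a n \<mu> \<longleftrightarrow> set_pmf \<mu> \<subseteq> configs n \<and> is_stationary \<theta> a n (pmf \<mu>)"
proof (intro iffI conjI)
  assume inv: "invariant_law \<theta> a n \<mu>"
  then show \<mu>: "set_pmf \<mu> \<subseteq> configs n" by (simp add: invariant_law_def)
  show "is_stationary \<theta> a n (pmf \<mu>)" unfolding is_stationary_def
  proof
    fix f
    define c where "c k = (\<Sum>\<eta>\<in>configs n. pmf \<mu> \<eta> * (gen \<theta> a n ^^ k) f \<eta>) / fact k" for k
    define \<phi> where "\<phi> t = (\<Sum>k. c k * t ^ k)" for t
    have s: "(\<lambda>k. c k * t ^ k) sums measure_pmf.expectation \<mu> (markov_semigroup \<theta> a n t f)" for t
      unfolding c_def by (rule expectation_semigroup_sums[OF n \<mu>])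
    have const: "\<phi> t = measure_pmf.expectation \<mu> f" if "0 \<le> t" for t
      using s[of t] inv that by (simp add: \<phi>_def invariant_law_def sums_iff)
    have "DERIV \<phi> 0 :> (\<Sum>k. diffs c k * 0 ^ k)"
      unfolding \<phi>_def using s[of 1] by (intro termdiffs_strong[where K=1]) (auto simp: sums_iff)
    then have "DERIV \<phi> 0 :> c 1" by (simp only: powser_zero) (simp add: diffs_def)
    then have "((\<lambda>h. (\<phi> (0 + h) - \<phi> 0) / h) \<longlongrightarrow> c 1) (at_right 0)"
      unfolding DERIV_def by (rule filterlim_at_split[THEN iffD1, THEN conjunct2])
    moreover have "((\<lambda>h. (\<phi> (0 + h) - \<phi> 0) / h) \<longlongrightarrow> 0) (at_right 0)"
      by (rule tendsto_eventually) (auto simp: const intro!: eventually_mono[OF eventually_at_right_less])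
    ultimately have "c 1 = 0" by (rule tendsto_unique[OF trivial_limit_at_right_real])
    then show "(\<Sum>\<eta>\<in>configs n. pmf \<mu> \<eta> * gen \<theta> a n f \<eta>) = 0" by (simp add: c_def)
  qed
next
  assume *: "set_pmf \<mu> \<subseteq> configs n \<and> is_stationary \<theta> a n (pmf \<mu>)"
  show "invariant_law \<theta> a n \<mu>"
    unfolding invariant_law_def
  proof (intro conjI allI impI)
    fix t f
    let ?c = "\<lambda>k. (\<Sum>\<eta>\<in>configs n. pmf \<mu> \<eta> * (gen \<theta> a n ^^ k) f \<eta>) / fact k * t ^ k"
    have "?c k = 0" if "k \<noteq> 0" for k
      using * that by (cases k) (simp_all add: is_stationary_def)
    then have "?c sums (\<Sum>k\<in>{0}. ?c k)" by (intro sums_finite) auto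
    then have "measure_pmf.expectation \<mu> (markov_semigroup \<theta> a n t f) = (\<Sum>k\<in>{0}. ?c k)"
      using expectation_semigroup_sums[OF n, of \<mu> \<theta> a f t] * by (blast intro: sums_unique2)
    then show "measure_pmf.expectation \<mu> (markov_semigroup \<theta> a n t f) = measure_pmf.expectation \<mu> f"
      by (simp add: expectation_configs[OF conjunct1[OF *]])
  qed (use * in auto)
qed

text \<open>Justifies the definite description in \<open>mu_ss\<close>. Positivity comes first: a
  zero would spread to all configurations. It is needed for uniqueness here and for the logarithms
  in the entropy argument.\<close>

lemma mu_ss_properties:
  assumes n: "0 < n" and a: "0 < a" and g: "0 < gamma \<theta> n" "gamma \<theta> n < 1"
  shows "set_pmf (mu_ss \<theta> a n) \<subseteq> configs n" "is_stationary \<theta> a n (pmf (mu_ss \<theta> a n))"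
    "\<And>\<eta>. \<eta> \<in> configs n \<Longrightarrow> 0 < pmf (mu_ss \<theta> a n) \<eta>"
proof -
  have pos: "0 < pmf \<mu> \<eta>" if \<mu>: "set_pmf \<mu> \<subseteq> configs n" "is_stationary \<theta> a n (pmf \<mu>)" and \<eta>: "\<eta> \<in> configs n" for \<mu> \<eta>
  proof (rule ccontr)
    assume "\<not> 0 < pmf \<mu> \<eta>"
    then have "pmf \<mu> \<eta> = 0" using pmf_nonneg[of \<mu> \<eta>] by linarith
    then have "pmf \<mu> \<zeta> = 0" if "\<zeta> \<in> configs n" for \<zeta>
      using stationary_zero_everywhere[OF n a g \<mu>(2) _ \<eta> _ that] by simp
    then have "sum (pmf \<mu>) (configs n) = 0" by simp
    moreover have "sum (pmf \<mu>) (configs n) = 1" using \<mu> by (intro sum_pmf_eq_1) auto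
    ultimately show False by simp
  qed
  have uniq: "\<mu> = \<nu>" if \<mu>: "set_pmf \<mu> \<subseteq> configs n" "is_stationary \<theta> a n (pmf \<mu>)"
    and \<nu>: "set_pmf \<nu> \<subseteq> configs n" "is_stationary \<theta> a n (pmf \<nu>)" for \<mu> \<nu>
  proof (rule pmf_eqI)
    fix \<eta>
    show "pmf \<mu> \<eta> = pmf \<nu> \<eta>"
    proof (cases "\<eta> \<in> configs n")
      case True
      then show ?thesis using \<mu> \<nu> pos
        by (intro stationary_unique[OF n a g, of "pmf \<mu>" "pmf \<nu>"] sum_pmf_eq_1) auto
    next
      case False
      then show ?thesis using \<mu>(1) \<nu>(1) by (metis pmf_eq_0_set_pmf subsetD)
    qed
  qed
  \<comment> \<open>\<open>stationary_weights_exist\<close> asks for nonnegative rates on the whole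
    type, while \<open>rate\<close> may be negative off \<open>configs n\<close>. The truncation
    changes nothing on \<open>configs n\<close>.\<close>
  have nonneg: "0 \<le> (if \<eta> \<in> configs n then max 0 (jump_rate \<theta> a n \<eta> \<zeta>) else 0)" for \<eta> \<zeta> by simp
  have "(\<lambda>x. if x \<in> torus n then 0 else undefined) \<in> configs n" by (auto simp: configs_def)
  then have "configs n \<noteq> {}" by blast
  from stationary_weights_exist[OF finite_configs this nonneg, of "\<lambda>\<eta> _. \<eta>" "\<lambda>_ \<zeta>. \<zeta>"]
  obtain w where w: "\<And>\<eta>. 0 \<le> w \<eta>" "(\<Sum>\<eta>\<in>configs n. w \<eta>) = 1"
    and st: "\<And>f. (\<Sum>\<eta>\<in>configs n. w \<eta> * (\<Sum>\<zeta>\<in>configs n. (if \<eta> \<in> configs n then max 0 (jump_rate \<theta> a n \<eta> \<zeta>) else 0) * (f \<zeta> - f \<eta>))) = 0"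
    by blast
  have jr: "0 \<le> jump_rate \<theta> a n \<eta> \<zeta>" if "\<eta> \<in> configs n" for \<eta> \<zeta>
    unfolding jump_rate_def using a rate_pos[OF n _ that g]
    by (intro add_nonneg_nonneg mult_nonneg_nonneg sum_nonneg) (auto intro: less_imp_le)
  have stw: "is_stationary \<theta> a n w" unfolding is_stationary_def
  proof
    fix f
    have "(\<Sum>\<eta>\<in>configs n. w \<eta> * gen \<theta> a n f \<eta>) = (\<Sum>\<eta>\<in>configs n. w \<eta> * (\<Sum>\<zeta>\<in>configs n. (if \<eta> \<in> configs n then max 0 (jump_rate \<theta> a n \<eta> \<zeta>) else 0) * (f \<zeta> - f \<eta>)))"
      using jr by (intro sum.cong) (simp_all add: gen_jump_rate[OF n] max_absorb2)
    then show "(\<Sum>\<eta>\<in>configs n. w \<eta> * gen \<theta> a n f \<eta>) = 0" using st by simp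
  qed
  define w' where "w' \<eta> = (if \<eta> \<in> configs n then w \<eta> else 0)" for \<eta>
  define \<mu> where "\<mu> = embed_pmf w'"
  have "(\<integral>\<^sup>+ \<eta>. ennreal (w' \<eta>) \<partial>count_space UNIV) = (\<Sum>\<eta>\<in>configs n. ennreal (w' \<eta>))"
    by (rule nn_integral_count_space') (auto simp: w'_def)
  also have "\<dots> = ennreal (\<Sum>\<eta>\<in>configs n. w' \<eta>)" using w by (simp add: w'_def)
  also have "\<dots> = 1" using w by (simp add: w'_def)
  finally have pmf: "pmf \<mu> \<eta> = w' \<eta>" for \<eta>
    unfolding \<mu>_def using w by (intro pmf_embed_pmf) (auto simp: w'_def)
  have "invariant_law \<theta> a n \<mu>"
    unfolding invariant_law_iff[OF n]
  proof
    show "set_pmf \<mu> \<subseteq> configs n" by (auto simp: set_pmf_eq pmf w'_def split: if_splits)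
    show "is_stationary \<theta> a n (pmf \<mu>)"
      using stw by (simp add: is_stationary_def pmf w'_def)
  qed
  then have "\<exists>!\<mu>. invariant_law \<theta> a n \<mu>"
    using uniq unfolding invariant_law_iff[OF n] by blast
  then have "invariant_law \<theta> a n (mu_ss \<theta> a n)" unfolding mu_ss_def by (rule theI')
  then show *: "set_pmf (mu_ss \<theta> a n) \<subseteq> configs n" "is_stationary \<theta> a n (pmf (mu_ss \<theta> a n))"
    unfolding invariant_law_iff[OF n] by auto
  show "\<And>\<eta>. \<eta> \<in> configs n \<Longrightarrow> 0 < pmf (mu_ss \<theta> a n) \<eta>" using pos[OF *] .
qed

section \<open>Stein characterization of the limit law\<close>

lemma continuous_antiderivative:
  fixes f :: "real \<Rightarrow> real"
  assumes "\<And>x. isCont f x"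
  obtains F where "\<And>x. (F has_real_derivative f x) (at x)"
proof -
  have "\<exists>F. \<forall>x::real. - \<infinity> < ereal x \<longrightarrow> ereal x < \<infinity> \<longrightarrow> (F has_vector_derivative f x) (at x)"
    by (rule einterval_antiderivative) (use assms in auto)
  then show ?thesis using that by (auto simp: has_real_derivative_iff_has_vector_derivative)
qed

lemma compactly_supported_bounded:
  fixes f :: "real \<Rightarrow> real"
  assumes cont: "\<And>x. isCont f x" and supp: "\<And>y. R \<le> \<bar>y\<bar> \<Longrightarrow> f y = 0"
  obtains B where "0 < B" "\<And>y. \<bar>f y\<bar> \<le> B"
proof -
  have "compact (f ` {- R..R})"
    by (intro compact_continuous_image continuous_at_imp_continuous_on compact_Icc ballI cont)
  then have "bounded (f ` {- R..R})" by (rule compact_imp_bounded)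
  then obtain b where "\<forall>x\<in>f ` {- R..R}. norm x \<le> b" unfolding bounded_iff by blast
  then have b: "\<bar>f y\<bar> \<le> b" if "y \<in> {- R..R}" for y using that by auto
  have "\<bar>f y\<bar> \<le> max b 1" for y
  proof (cases "R \<le> \<bar>y\<bar>")
    case False
    then have "\<bar>f y\<bar> \<le> b" by (intro b) auto
    then show ?thesis by simp
  qed (use supp in auto)
  then show ?thesis using that[of "max b 1"] by auto
qed

section \<open>The unnormalized limit density and its integrability\<close>

definition weight :: "real \<Rightarrow> real \<Rightarrow> real" where
  "weight \<theta> y = exp (- 2 * potential \<theta> y)"

lemma weight_pos: "0 < weight \<theta> y"
  by (simp add: weight_def)

lemma isCont_weight [simp]: "isCont (weight \<theta>) y"
  unfolding weight_def potential_def by (intro continuous_intros) auto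

lemma weight_measurable [measurable]: "weight \<theta> \<in> borel_measurable borel"
  by (intro borel_measurable_continuous_onI continuous_at_imp_continuous_on ballI) simp

text \<open>Completing the square in y^2 dominates the quartic density by a Gaussian for either sign
  of \<theta>. A spare y^2 in the exponent is kept for the second bound, through y^2 \<le> exp
  (y^2).\<close>

lemma weight_le:
  "weight \<theta> y \<le> exp ((1 - \<theta>)\<^sup>2) * exp (- y\<^sup>2)" "y\<^sup>2 * weight \<theta> y \<le> exp ((1 - \<theta>)\<^sup>2) * exp (- y\<^sup>2)"
proof -
  have "0 \<le> (y\<^sup>2 - (1 - \<theta>))\<^sup>2" by simp
  then have *: "- 2 * potential \<theta> y + y\<^sup>2 \<le> (1 - \<theta>)\<^sup>2 - y\<^sup>2"
    by (simp add: potential_def power2_eq_square power4_eq_xxxx algebra_simps)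
  have "- 2 * potential \<theta> y \<le> (1 - \<theta>)\<^sup>2 - y\<^sup>2" using * zero_le_power2[of y] by linarith
  then have "exp (- 2 * potential \<theta> y) \<le> exp ((1 - \<theta>)\<^sup>2 - y\<^sup>2)" by (rule exp_le_cancel_iff[THEN iffD2])
  then show "weight \<theta> y \<le> exp ((1 - \<theta>)\<^sup>2) * exp (- y\<^sup>2)" by (simp add: weight_def exp_diff exp_minus field_simps)
  have "y\<^sup>2 \<le> exp (y\<^sup>2)" using exp_ge_add_one_self[of "y\<^sup>2"] by linarith
  then have "y\<^sup>2 * weight \<theta> y \<le> exp (y\<^sup>2) * exp (- 2 * potential \<theta> y)"
    unfolding weight_def by (intro mult_right_mono) auto
  also have "\<dots> = exp (- 2 * potential \<theta> y + y\<^sup>2)" by (simp add: exp_add[symmetric] add.commute)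
  also have "\<dots> \<le> exp ((1 - \<theta>)\<^sup>2 - y\<^sup>2)" using * by (rule exp_le_cancel_iff[THEN iffD2])
  finally show "y\<^sup>2 * weight \<theta> y \<le> exp ((1 - \<theta>)\<^sup>2) * exp (- y\<^sup>2)" by (simp add: exp_diff exp_minus field_simps)
qed

lemma integrable_gauss: "integrable lborel (\<lambda>y::real. exp (- y\<^sup>2))"
proof -
  have "exp (- y\<^sup>2) = sqrt pi * normal_density 0 (1 / sqrt 2) y" for y :: real
    by (simp add: normal_density_def power_divide real_sqrt_mult)
  then show ?thesis by (simp only:) (intro integrable_mult_right integrable_normal_density, simp)
qed

lemma integrable_weight: "integrable lborel (weight \<theta>)"
  by (rule Bochner_Integration.integrable_bound[OF integrable_mult_right[OF integrable_gauss, of "exp ((1 - \<theta>)\<^sup>2)"]])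
    (use weight_le(1)[of \<theta>] weight_pos[of \<theta>] in \<open>auto simp: less_imp_le\<close>)

lemma integrable_square_weight: "integrable lborel (\<lambda>y. y\<^sup>2 * weight \<theta> y)"
  by (rule Bochner_Integration.integrable_bound[OF integrable_mult_right[OF integrable_gauss, of "exp ((1 - \<theta>)\<^sup>2)"]])
    (use weight_le(2)[of _ \<theta>] weight_pos[of \<theta>] in \<open>auto simp: less_imp_le abs_mult\<close>)

lemma integrable_bounded_weight:
  assumes "\<And>y. isCont g y" "\<And>y. \<bar>g y\<bar> \<le> B"
  shows "integrable lborel (\<lambda>y. g y * weight \<theta> y)"
proof (rule Bochner_Integration.integrable_bound[OF integrable_mult_right[OF integrable_weight, of B]])
  have "g \<in> borel_measurable borel"
    by (intro borel_measurable_continuous_onI continuous_at_imp_continuous_on ballI assms)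
  then show "(\<lambda>y. g y * weight \<theta> y) \<in> borel_measurable lborel" by simp
  show "AE y in lborel. norm (g y * weight \<theta> y) \<le> norm (B * weight \<theta> y)"
  proof (intro AE_I2)
    fix y
    have "\<bar>g y\<bar> \<le> \<bar>B\<bar>" using assms(2)[of y] by linarith
    then show "norm (g y * weight \<theta> y) \<le> norm (B * weight \<theta> y)" by (simp add: abs_mult mult_right_mono)
  qed
qed

text \<open>Squaring the positive part makes the cutoff continuously differentiable, the regularity
  that \<open>compact_test\<close> asks of its right-hand side, and its deviation from 1 is bounded
  by a multiple of y^2, which second moments control.\<close>

definition cutoff :: "real \<Rightarrow> real \<Rightarrow> real" where
  "cutoff R y = (max 0 (1 - (y / R)\<^sup>2))\<^sup>2"

definition cutoff' :: "real \<Rightarrow> real \<Rightarrow> real" where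
  "cutoff' R y = - 4 * y / R\<^sup>2 * max 0 (1 - (y / R)\<^sup>2)"

text \<open>The first-order remainder is at most h^2 for every s, so the kink at 0 needs no separate
  limit.\<close>

lemma DERIV_max_square: "((\<lambda>s. (max 0 s)\<^sup>2) has_real_derivative 2 * max 0 s) (at s)" for s :: real
proof -
  have est: "\<bar>((max 0 (s + h))\<^sup>2 - (max 0 s)\<^sup>2) / h - 2 * max 0 s\<bar> \<le> \<bar>h\<bar>" if "h \<noteq> 0" for h
  proof -
    have "\<bar>(max 0 (s + h))\<^sup>2 - (max 0 s)\<^sup>2 - 2 * max 0 s * h\<bar> \<le> h\<^sup>2"
    proof -
      define u v where "u = max 0 s" and "v = max 0 (s + h)"
      have "\<bar>v - u\<bar> \<le> \<bar>h\<bar>" by (auto simp: u_def v_def max_def)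
      consider "s \<ge> 0" "s + h \<ge> 0" | "s \<ge> 0" "s + h < 0" | "s < 0" "s + h \<ge> 0" | "s < 0" "s + h < 0" by linarith
      then show ?thesis
      proof cases
        case 1 then show ?thesis by (simp add: max_def power2_eq_square algebra_simps)
      next
        case 2
        then have "0 \<le> - (s * s) - 2 * s * h" "- (s * s) - 2 * s * h \<le> h * h"
          using mult_nonneg_nonneg[of s "- (s + h)"] mult_nonneg_nonneg[of s "- h"] zero_le_square[of "s + h"]
          by (simp_all add: algebra_simps)
        then show ?thesis using 2 by (simp add: max_def power2_eq_square)
      next
        case 3
        then have "(s + h)\<^sup>2 \<le> h\<^sup>2" by (intro power_mono) auto
        then show ?thesis using 3 by (simp add: max_def)
      next
        case 4 then show ?thesis by (simp add: max_def)
      qed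
    qed
    then have "\<bar>((max 0 (s + h))\<^sup>2 - (max 0 s)\<^sup>2 - 2 * max 0 s * h) / h\<bar> \<le> h\<^sup>2 / \<bar>h\<bar>"
      by (simp add: divide_right_mono)
    also have "h\<^sup>2 / \<bar>h\<bar> = \<bar>h\<bar>" using that by (auto simp: power2_eq_square abs_if)
    finally show ?thesis using that by (simp add: diff_divide_distrib)
  qed
  have lim: "((\<lambda>h. \<bar>h\<bar>) \<longlongrightarrow> (0::real)) (at 0)"
    by (rule tendsto_rabs_zero[OF tendsto_ident_at])
  have "eventually (\<lambda>h. norm (((max 0 (s + h))\<^sup>2 - (max 0 s)\<^sup>2) / h - 2 * max 0 s) \<le> \<bar>h\<bar>) (at 0)"
    unfolding eventually_at_filter real_norm_def by (intro always_eventually allI impI est)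
  from Lim_null_comparison[OF this lim]
  have "((\<lambda>h. ((max 0 (s + h))\<^sup>2 - (max 0 s)\<^sup>2) / h - 2 * max 0 s) \<longlongrightarrow> 0) (at 0)" .
  then show ?thesis unfolding DERIV_def by (rule LIM_zero_cancel)
qed

lemma DERIV_cutoff: "R \<noteq> 0 \<Longrightarrow> (cutoff R has_real_derivative cutoff' R y) (at y)"
proof -
  assume R: "R \<noteq> 0"
  have "((\<lambda>y. 1 - (y / R)\<^sup>2) has_real_derivative - 2 * y / R\<^sup>2) (at y)"
    using R by (auto intro!: derivative_eq_intros simp: power2_eq_square)
  from DERIV_chain2[OF DERIV_max_square this]
  show ?thesis unfolding cutoff_def[abs_def] cutoff'_def by (simp add: mult_ac)
qed

lemma isCont_cutoff': "isCont (cutoff' R) y" if "R \<noteq> 0"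
  unfolding cutoff'_def[abs_def] using that by (intro continuous_intros) auto

lemma cutoff_nonneg: "0 \<le> cutoff R y"
  by (simp add: cutoff_def)

lemma cutoff_le_1: "cutoff R y \<le> 1"
  unfolding cutoff_def by (intro power_le_one) auto

lemma one_minus_cutoff: "1 - cutoff R y \<le> 2 / R\<^sup>2 * y\<^sup>2"
proof -
  define s where "s = (y / R)\<^sup>2"
  have "0 \<le> s" by (simp add: s_def)
  have "1 - 2 * s \<le> (max 0 (1 - s))\<^sup>2"
  proof (cases "s \<le> 1")
    case True
    then show ?thesis using zero_le_square[of s] by (simp add: max_def power2_eq_square algebra_simps)
  qed (auto simp: max_def)
  then show ?thesis by (simp add: cutoff_def s_def power_divide)
qed

lemma cutoff_outside:
  assumes "0 < R" "R \<le> \<bar>y\<bar>"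
  shows "cutoff R y = 0" "cutoff' R y = 0"
proof -
  have "1 \<le> \<bar>y / R\<bar>" using assms by simp
  then have "1 \<le> (y / R)\<^sup>2" using abs_le_square_iff[of 1 "y / R"] by simp
  then show "cutoff R y = 0" "cutoff' R y = 0" by (simp_all add: cutoff_def cutoff'_def)
qed

lemma integrable_cutoff:
  assumes R: "R \<noteq> 0" and u: "\<And>y. isCont u y" "\<And>y. \<bar>u y\<bar> \<le> 1"
  shows "integrable lborel (\<lambda>y. u y * cutoff R y * weight \<theta> y)"
proof (rule integrable_bounded_weight[where B=1])
  show "isCont (\<lambda>y. u y * cutoff R y) y" for y
    using u(1) DERIV_isCont[OF DERIV_cutoff[OF R]] by (rule continuous_mult)
  show "\<bar>u y * cutoff R y\<bar> \<le> 1" for y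
    using mult_mono[OF u(2)[of y] cutoff_le_1[of R y]] by (simp add: abs_mult cutoff_nonneg)
qed

lemma integrable_cutoff_1: "integrable lborel (\<lambda>y. cutoff 1 y * weight \<theta> y)"
  using integrable_cutoff[of 1 "\<lambda>_. 1"] by simp

lemma cutoff_integral_pos: "0 < (\<integral>y. cutoff 1 y * weight \<theta> y \<partial>lborel)"
proof -
  have "0 < (1 / 2)\<^sup>2 * exp (- (\<bar>\<theta>\<bar> + 1)) * (\<integral>y. indicator {0..1 / 2 :: real} y \<partial>lborel)" by simp
  also have "\<dots> = (\<integral>y. (1 / 2)\<^sup>2 * exp (- (\<bar>\<theta>\<bar> + 1)) * indicator {0..1 / 2 :: real} y \<partial>lborel)" by simp
  also have "\<dots> \<le> (\<integral>y. cutoff 1 y * weight \<theta> y \<partial>lborel)"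
  proof (rule integral_mono)
    show "integrable lborel (\<lambda>y. cutoff 1 y * weight \<theta> y)" by (rule integrable_cutoff_1)
    fix y :: real
    show "(1 / 2)\<^sup>2 * exp (- (\<bar>\<theta>\<bar> + 1)) * indicator {0..1 / 2} y \<le> cutoff 1 y * weight \<theta> y"
    proof (cases "y \<in> {0..1 / 2}")
      case True
      then have y: "0 \<le> y" "y \<le> 1 / 2" by auto
      have "y\<^sup>2 \<le> (1 / 2)\<^sup>2" "y ^ 4 \<le> (1 / 2) ^ 4" using y by (intro power_mono; simp)+
      then have y2: "y\<^sup>2 \<le> 1 / 4" "y ^ 4 \<le> 1 / 16" by (simp_all add: power2_eq_square power4_eq_xxxx)
      have "\<theta> * y\<^sup>2 \<le> \<bar>\<theta>\<bar> * (1 / 4)" using y2 by (intro mult_mono) auto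
      then have "2 * potential \<theta> y \<le> \<bar>\<theta>\<bar> + 1" using y2 by (simp add: potential_def)
      then have "exp (- (\<bar>\<theta>\<bar> + 1)) \<le> weight \<theta> y" by (simp add: weight_def)
      moreover have "(1 / 2)\<^sup>2 \<le> cutoff 1 y"
        unfolding cutoff_def using y2 by (intro power_mono) auto
      ultimately have "(1 / 2)\<^sup>2 * exp (- (\<bar>\<theta>\<bar> + 1)) \<le> cutoff 1 y * weight \<theta> y"
        by (intro mult_mono cutoff_nonneg) auto
      then show ?thesis using True by simp
    qed (use cutoff_nonneg[of 1 y] weight_pos[of \<theta> y] in simp)
  next
    have "emeasure lborel {0..1 / 2 :: real} < \<infinity>"
      using ennreal_less_top[of "1 / 2 - 0"] by (subst emeasure_lborel_Icc) (simp, simp only: infinity_ennreal_def)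
    then show "integrable lborel (\<lambda>y. (1 / 2)\<^sup>2 * exp (- (\<bar>\<theta>\<bar> + 1)) * indicator {0..1 / 2 :: real} y)"
      by (intro integrable_mult_right integrable_real_indicator) auto
  qed
  finally show ?thesis .
qed

text \<open>Collects what the passage to the limit needs of expectations of functions of the scaled
  magnetization: positivity, normalization, bounded second moments and a vanishing Stein defect. The
  limit is identified without extracting subsequences.\<close>

locale stein_sequence =
  fixes \<theta> C :: real and E :: "nat \<Rightarrow> (real \<Rightarrow> real) \<Rightarrow> real"
  assumes E_add: "\<And>n f g. E n (\<lambda>y. f y + g y) = E n f + E n g"
    and E_cmult: "\<And>n c f. E n (\<lambda>y. c * f y) = c * E n f"
    and E_mono: "\<And>n f g. (\<And>y. f y \<le> g y) \<Longrightarrow> E n f \<le> E n g"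
    and E_one: "\<And>n. E n (\<lambda>_. 1) = 1"
    and E_square: "\<And>n. E n (\<lambda>y. y\<^sup>2) \<le> C"
    and E_stein: "\<And>f F F1 F2 B. (\<And>y. (f has_real_derivative F y) (at y)) \<Longrightarrow> (\<And>y. (F has_real_derivative F1 y) (at y)) \<Longrightarrow>
      (\<And>y. (F1 has_real_derivative F2 y) (at y)) \<Longrightarrow> 0 < B \<Longrightarrow> (\<And>y. \<bar>F y\<bar> \<le> B) \<Longrightarrow> (\<And>y. \<bar>F1 y\<bar> \<le> B) \<Longrightarrow>
      (\<And>y. \<bar>F2 y\<bar> \<le> B) \<Longrightarrow> (\<And>y. \<bar>y ^ 3 * F y\<bar> \<le> B) \<Longrightarrow>
      (\<lambda>n. E n (\<lambda>y. F1 y / 2 - (2 * \<theta> * y + 2 * y ^ 3) * F y)) \<longlonglongrightarrow> 0"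
begin

text \<open>The Stein equation \<open>F' / 2 - V' F = k\<close> is solved by \<open>F = 2 e\<^bsup>2V\<^esup> \<integral> k e\<^bsup>-2V\<^esup>\<close>, which has compact
  support because \<open>k\<close> has and \<open>\<integral> k e\<^bsup>-2V\<^esup> = 0\<close>.\<close>

lemma compact_test:
  assumes R: "0 < R" and k: "\<And>y. (k has_real_derivative k' y) (at y)" and k': "\<And>y. isCont k' y"
    and supp: "\<And>y. R \<le> \<bar>y\<bar> \<Longrightarrow> k y = 0" "\<And>y. R \<le> \<bar>y\<bar> \<Longrightarrow> k' y = 0"
    and int: "(\<integral>y. k y * weight \<theta> y \<partial>lborel) = 0"
  shows "(\<lambda>n. E n k) \<longlonglongrightarrow> 0"
proof -
  have kc: "isCont k y" for y using k by (rule DERIV_isCont)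
  obtain G0 where G0: "\<And>y. (G0 has_real_derivative k y * weight \<theta> y) (at y)"
    using continuous_antiderivative[of "\<lambda>y. k y * weight \<theta> y"] kc by (auto intro: continuous_mult)
  define G where "G y = G0 y - G0 (- R)" for y
  have G: "(G has_real_derivative k y * weight \<theta> y) (at y)" for y
    unfolding G_def by (auto intro!: derivative_eq_intros G0)
  have eq_const: "G x = G y" if "x \<le> y" "\<And>z. x \<le> z \<Longrightarrow> z \<le> y \<Longrightarrow> R \<le> \<bar>z\<bar>" for x y
  proof (cases "x = y")
    case False
    then have "x < y" using that by simp
    moreover have "continuous_on {x..y} G"
      by (intro continuous_at_imp_continuous_on ballI DERIV_isCont[OF G])
    moreover have "(G has_real_derivative 0) (at z)" if "x < z" "z < y" for z
      using G[of z] supp(1)[of z] \<open>\<And>z. x \<le> z \<Longrightarrow> z \<le> y \<Longrightarrow> R \<le> \<bar>z\<bar>\<close>[of z] that by simp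
    ultimately show ?thesis using DERIV_isconst_end[of x y G] by auto
  qed simp
  have "(\<integral>y. k y * weight \<theta> y * indicator {- R..R} y \<partial>lborel) = G R - G (- R)"
    using R G kc by (intro integral_FTC_Icc_real) (auto intro: continuous_mult)
  also have "(\<integral>y. k y * weight \<theta> y * indicator {- R..R} y \<partial>lborel) = (\<integral>y. k y * weight \<theta> y \<partial>lborel)"
  proof (intro Bochner_Integration.integral_cong refl)
    fix y
    show "k y * weight \<theta> y * indicator {- R..R} y = k y * weight \<theta> y"
      using supp(1)[of y] by (cases "R \<le> \<bar>y\<bar>") (auto simp: indicator_def)
  qed
  \<comment> \<open>Here the vanishing integral enters: the antiderivative, zero to the left of the
    support, returns to zero on the right.\<close>
  finally have GR: "G R = 0" using int by (simp add: G_def)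
  have G_out: "G y = 0" if y: "R \<le> \<bar>y\<bar>" for y
  proof (cases "0 \<le> y")
    case True
    then show ?thesis using eq_const[of R y] GR y by auto
  next
    case False
    then show ?thesis using eq_const[of y "- R"] y R by (auto simp: G_def)
  qed
  define F where "F y = 2 * exp (2 * potential \<theta> y) * G y" for y
  define V' where "V' y = 2 * \<theta> * y + 2 * y ^ 3" for y
  define F1 where "F1 y = 2 * V' y * F y + 2 * k y" for y
  define F2 where "F2 y = 2 * (2 * \<theta> + 6 * y\<^sup>2) * F y + 2 * V' y * F1 y + 2 * k' y" for y
  have pot: "(potential \<theta> has_real_derivative V' y) (at y)" for y
    unfolding potential_def[abs_def] V'_def by (auto intro!: derivative_eq_intros)
  have w: "exp (2 * potential \<theta> y) * weight \<theta> y = 1" for y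
    by (simp add: weight_def exp_add[symmetric])
  have F: "(F has_real_derivative F1 y) (at y)" for y
  proof -
    have "(F has_real_derivative 2 * (exp (2 * potential \<theta> y) * (2 * V' y)) * G y + 2 * exp (2 * potential \<theta> y) * (k y * weight \<theta> y)) (at y)"
      unfolding F_def[abs_def] by (auto intro!: derivative_eq_intros pot G)
    also have "2 * (exp (2 * potential \<theta> y) * (2 * V' y)) * G y + 2 * exp (2 * potential \<theta> y) * (k y * weight \<theta> y)
      = 2 * V' y * F y + 2 * k y * (exp (2 * potential \<theta> y) * weight \<theta> y)" by (simp add: F_def)
    finally show ?thesis by (simp add: w F1_def)
  qed
  have V'': "(V' has_real_derivative 2 * \<theta> + 6 * y\<^sup>2) (at y)" for y
    unfolding V'_def[abs_def] by (auto intro!: derivative_eq_intros)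
  have F1: "(F1 has_real_derivative F2 y) (at y)" for y
    unfolding F1_def[abs_def] F2_def by (auto intro!: derivative_eq_intros V'' F k) (simp add: F1_def)
  have cont: "isCont F y" "isCont F1 y" "isCont V' y" for y
    using DERIV_isCont[OF F] DERIV_isCont[OF F1] DERIV_isCont[OF V''] by auto
  have cF2: "isCont F2 y" for y
    unfolding F2_def[abs_def] using cont k' by (intro continuous_intros) auto
  have cF3: "isCont (\<lambda>y. y ^ 3 * F y) y" for y using cont by (intro continuous_intros)
  have out: "F y = 0" "F1 y = 0" "F2 y = 0" if "R \<le> \<bar>y\<bar>" for y
    using G_out[OF that] supp that by (simp_all add: F_def F1_def F2_def)
  obtain B0 where B0: "0 < B0" "\<And>y. \<bar>F y\<bar> \<le> B0" using compactly_supported_bounded[of F R] cont out by blast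
  obtain B1 where B1: "0 < B1" "\<And>y. \<bar>F1 y\<bar> \<le> B1" using compactly_supported_bounded[of F1 R] cont out by blast
  obtain B2 where B2: "0 < B2" "\<And>y. \<bar>F2 y\<bar> \<le> B2" using compactly_supported_bounded[of F2 R] cF2 out by blast
  obtain B3 where B3: "0 < B3" "\<And>y. \<bar>y ^ 3 * F y\<bar> \<le> B3"
    using compactly_supported_bounded[of "\<lambda>y. y ^ 3 * F y" R] cF3 out by auto
  obtain f where f: "\<And>y. (f has_real_derivative F y) (at y)"
    using continuous_antiderivative[of F] cont by blast
  have B: "0 < B0 + B1 + B2 + B3" "B0 \<le> B0 + B1 + B2 + B3" "B1 \<le> B0 + B1 + B2 + B3" "B2 \<le> B0 + B1 + B2 + B3" "B3 \<le> B0 + B1 + B2 + B3"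
    using B0 B1 B2 B3 by simp_all
  have "(\<lambda>n. E n (\<lambda>y. F1 y / 2 - (2 * \<theta> * y + 2 * y ^ 3) * F y)) \<longlonglongrightarrow> 0"
    using B by (intro E_stein[OF f F F1, of "B0 + B1 + B2 + B3"])
      (auto intro: order.trans[OF B0(2)] order.trans[OF B1(2)] order.trans[OF B2(2)] order.trans[OF B3(2)])
  moreover have "F1 y / 2 - (2 * \<theta> * y + 2 * y ^ 3) * F y = k y" for y
    by (simp add: F1_def V'_def field_simps)
  ultimately show ?thesis by simp
qed

definition J :: "(real \<Rightarrow> real) \<Rightarrow> real" where
  "J g = (\<integral>y. g y * weight \<theta> y \<partial>lborel)"

text \<open>A single unknown scalar per n, the mass of a fixed bump under E n relative to the
  weight; in the end it tends to the inverse of the partition function.\<close>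

definition ell :: "nat \<Rightarrow> real" where
  "ell n = E n (cutoff 1) / J (cutoff 1)"

lemma J_cutoff_pos: "0 < J (cutoff 1)"
  unfolding J_def by (rule cutoff_integral_pos)

lemma E_abs_diff: "\<bar>E n f - E n g\<bar> \<le> E n h" if "\<And>y. \<bar>f y - g y\<bar> \<le> h y"
proof -
  have "E n f \<le> E n (\<lambda>y. g y + h y)" "E n g \<le> E n (\<lambda>y. f y + h y)"
    using that by (auto intro!: E_mono simp: abs_le_iff algebra_simps)
  then show ?thesis by (simp add: E_add abs_le_iff)
qed

lemma ell_bounds: "0 \<le> ell n" "ell n \<le> 1 / J (cutoff 1)"
proof -
  have "E n (\<lambda>y. 0 * 1) \<le> E n (cutoff 1)" by (rule E_mono) (simp add: cutoff_nonneg)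
  then show "0 \<le> ell n" unfolding ell_def E_cmult using J_cutoff_pos by simp
  have "E n (cutoff 1) \<le> E n (\<lambda>_. 1)" by (rule E_mono) (rule cutoff_le_1)
  then show "ell n \<le> 1 / J (cutoff 1)" unfolding ell_def E_one using J_cutoff_pos by (intro divide_right_mono) auto
qed

text \<open>\<open>compact_test\<close> needs a vanishing integral. Subtracting a suitable multiple
  of the fixed bump provides it and ties every truncated test function to the same sequence
  \<open>ell\<close>.\<close>

lemma cutoff_test:
  assumes R: "1 \<le> R" and u: "\<And>y. (u has_real_derivative u' y) (at y)" "\<And>y. isCont u' y" and u1: "\<And>y. \<bar>u y\<bar> \<le> 1"
  shows "(\<lambda>n. E n (\<lambda>y. u y * cutoff R y) - J (\<lambda>y. u y * cutoff R y) * ell n) \<longlonglongrightarrow> 0"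
proof -
  define c where "c = J (\<lambda>y. u y * cutoff R y) / J (cutoff 1)"
  define k where "k y = u y * cutoff R y + - c * cutoff 1 y" for y
  have Rp: "0 < R" using R by simp
  have uc: "isCont u y" for y using u(1) by (rule DERIV_isCont)
  have cc: "isCont (cutoff r) y" if "r \<noteq> 0" for r y using DERIV_isCont[OF DERIV_cutoff[OF that]] .
  have int: "integrable lborel (\<lambda>y. u y * cutoff R y * weight \<theta> y)"
    using Rp uc u1 by (intro integrable_cutoff) auto
  have "(\<lambda>n. E n k) \<longlonglongrightarrow> 0"
  proof (rule compact_test[OF Rp])
    show "(k has_real_derivative u' y * cutoff R y + u y * cutoff' R y + - c * cutoff' 1 y) (at y)" for y
      unfolding k_def[abs_def] using Rp
      by (auto intro!: derivative_eq_intros u DERIV_cutoff)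
    show "isCont (\<lambda>y. u' y * cutoff R y + u y * cutoff' R y + - c * cutoff' 1 y) y" for y
      using u uc cc[of R] isCont_cutoff'[of R] isCont_cutoff'[of 1] Rp by (intro continuous_intros) auto
    show "k y = 0" "u' y * cutoff R y + u y * cutoff' R y + - c * cutoff' 1 y = 0" if "R \<le> \<bar>y\<bar>" for y
      using cutoff_outside[OF Rp that] cutoff_outside[of 1 y] that R by (simp_all add: k_def)
    have "(\<integral>y. k y * weight \<theta> y \<partial>lborel) = (\<integral>y. u y * cutoff R y * weight \<theta> y + - c * (cutoff 1 y * weight \<theta> y) \<partial>lborel)"
      by (simp add: k_def algebra_simps)
    also have "\<dots> = J (\<lambda>y. u y * cutoff R y) + - c * J (cutoff 1)"
      using int integrable_cutoff_1 by (simp add: J_def)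
    also have "\<dots> = 0" using J_cutoff_pos by (simp add: c_def)
    finally show "(\<integral>y. k y * weight \<theta> y \<partial>lborel) = 0" .
  qed
  moreover have "E n k = E n (\<lambda>y. u y * cutoff R y) - J (\<lambda>y. u y * cutoff R y) * ell n" for n
    unfolding k_def[abs_def] E_add E_cmult by (simp add: c_def ell_def)
  ultimately show ?thesis by simp
qed

text \<open>Removing the cutoff costs a second moment divided by R^2, both under E n, uniformly in
  n, and under the weight.\<close>

lemma bounded_test:
  assumes u: "\<And>y. (u has_real_derivative u' y) (at y)" "\<And>y. isCont u' y" and u1: "\<And>y. \<bar>u y\<bar> \<le> 1"
  shows "(\<lambda>n. E n u - J u * ell n) \<longlonglongrightarrow> 0"
proof (rule LIMSEQ_I)
  fix \<epsilon> :: real assume \<epsilon>: "0 < \<epsilon>"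
  define K where "K = 2 * C + 2 * J (\<lambda>y. y\<^sup>2) / J (cutoff 1)"
  have J2: "0 \<le> J (\<lambda>y. y\<^sup>2)" unfolding J_def using weight_pos[of \<theta>] by (intro integral_nonneg_AE AE_I2) (simp add: less_imp_le)
  have C0: "0 \<le> C" using E_square[of 0] E_mono[of "\<lambda>_. 0 * 1" "\<lambda>y. y\<^sup>2" 0] by (simp only: E_cmult) simp
  have K0: "0 \<le> K" unfolding K_def using C0 J2 J_cutoff_pos by simp
  \<comment> \<open>R \<le> R^2 turns this choice into K / R^2 < \<epsilon> / 2, leaving the other
    half of \<epsilon> for \<open>cutoff_test\<close>.\<close>
  define R where "R = 1 + 2 * K / \<epsilon>"
  have R1: "1 \<le> R" using K0 \<epsilon> by (simp add: R_def)
  have "2 * K / \<epsilon> < R" by (simp add: R_def)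
  also have "R \<le> R\<^sup>2" using R1 by (simp add: power2_eq_square)
  finally have KR: "K / R\<^sup>2 < \<epsilon> / 2" using \<epsilon> R1 by (simp add: field_simps)
  have uc: "isCont u y" for y using u(1) by (rule DERIV_isCont)
  have diff: "\<bar>u y - u y * cutoff R y\<bar> \<le> 2 / R\<^sup>2 * y\<^sup>2" for y
  proof -
    have "\<bar>u y\<bar> * \<bar>1 - cutoff R y\<bar> \<le> 1 * (2 / R\<^sup>2 * y\<^sup>2)"
      using u1 one_minus_cutoff[of R y] cutoff_le_1[of R y] by (intro mult_mono) auto
    then show ?thesis by (simp add: abs_mult[symmetric] right_diff_distrib)
  qed
  have 1: "\<bar>E n u - E n (\<lambda>y. u y * cutoff R y)\<bar> \<le> 2 / R\<^sup>2 * C" for n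
  proof -
    have "\<bar>E n u - E n (\<lambda>y. u y * cutoff R y)\<bar> \<le> E n (\<lambda>y. 2 / R\<^sup>2 * y\<^sup>2)" by (rule E_abs_diff) (rule diff)
    also have "\<dots> \<le> 2 / R\<^sup>2 * C" unfolding E_cmult by (intro mult_left_mono E_square) auto
    finally show ?thesis .
  qed
  have 2: "\<bar>J u - J (\<lambda>y. u y * cutoff R y)\<bar> \<le> 2 / R\<^sup>2 * J (\<lambda>y. y\<^sup>2)"
  proof -
    have i1: "integrable lborel (\<lambda>y. u y * weight \<theta> y)" using uc u1 by (rule integrable_bounded_weight)
    have i2: "integrable lborel (\<lambda>y. u y * cutoff R y * weight \<theta> y)"
      using R1 uc u1 by (intro integrable_cutoff) auto
    have "J u - J (\<lambda>y. u y * cutoff R y) = (\<integral>y. (u y - u y * cutoff R y) * weight \<theta> y \<partial>lborel)"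
      using i1 i2 by (simp add: J_def left_diff_distrib)
    also have "\<bar>\<dots>\<bar> \<le> (\<integral>y. \<bar>(u y - u y * cutoff R y) * weight \<theta> y\<bar> \<partial>lborel)"
      by (rule integral_abs_bound)
    also have "\<dots> \<le> (\<integral>y. 2 / R\<^sup>2 * (y\<^sup>2 * weight \<theta> y) \<partial>lborel)"
    proof (rule integral_mono)
      show "integrable lborel (\<lambda>y. \<bar>(u y - u y * cutoff R y) * weight \<theta> y\<bar>)"
        using i1 i2 by (intro integrable_abs) (simp add: left_diff_distrib)
      show "integrable lborel (\<lambda>y. 2 / R\<^sup>2 * (y\<^sup>2 * weight \<theta> y))" by (intro integrable_mult_right integrable_square_weight)
      show "\<bar>(u y - u y * cutoff R y) * weight \<theta> y\<bar> \<le> 2 / R\<^sup>2 * (y\<^sup>2 * weight \<theta> y)" for y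
        using mult_right_mono[OF diff[of y], of "weight \<theta> y"] weight_pos[of \<theta> y] by (simp add: abs_mult)
    qed
    also have "\<dots> = 2 / R\<^sup>2 * J (\<lambda>y. y\<^sup>2)" by (simp add: J_def)
    finally show ?thesis .
  qed
  obtain N where
    N: "\<And>n. N \<le> n \<Longrightarrow> \<bar>E n (\<lambda>y. u y * cutoff R y) - J (\<lambda>y. u y * cutoff R y) * ell n\<bar> < \<epsilon> / 2"
    using \<epsilon> LIMSEQ_D[OF cutoff_test[OF R1 u u1], of "\<epsilon> / 2"] unfolding real_norm_def diff_0_right by auto
  show "\<exists>N. \<forall>n\<ge>N. norm (E n u - J u * ell n - 0) < \<epsilon>"
  proof (intro exI allI impI)
    fix n assume "N \<le> n"
    have "\<bar>J u - J (\<lambda>y. u y * cutoff R y)\<bar> * ell n \<le> 2 / R\<^sup>2 * J (\<lambda>y. y\<^sup>2) * (1 / J (cutoff 1))"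
      using 2 ell_bounds[of n] J2 by (intro mult_mono) auto
    then have "\<bar>J u * ell n - J (\<lambda>y. u y * cutoff R y) * ell n\<bar> \<le> 2 / R\<^sup>2 * J (\<lambda>y. y\<^sup>2) * (1 / J (cutoff 1))"
      using ell_bounds(1)[of n] by (simp add: left_diff_distrib[symmetric] abs_mult)
    moreover have "K / R\<^sup>2 = 2 / R\<^sup>2 * C + 2 / R\<^sup>2 * J (\<lambda>y. y\<^sup>2) * (1 / J (cutoff 1))"
      by (simp add: K_def add_divide_distrib)
    ultimately have "\<bar>E n u - J u * ell n\<bar> < \<epsilon>"
      using 1[of n] N[OF \<open>N \<le> n\<close>] KR unfolding abs_le_iff abs_less_iff by linarith
    then show "norm (E n u - J u * ell n - 0) < \<epsilon>" by simp
  qed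
qed

lemma J_one: "J (\<lambda>_. 1) = partition_fn \<theta>"
  by (simp add: J_def partition_fn_def weight_def)

lemma partition_fn_pos: "0 < partition_fn \<theta>"
proof -
  have "J (cutoff 1) \<le> J (\<lambda>_. 1)" unfolding J_def
  proof (rule integral_mono)
    show "integrable lborel (\<lambda>y. cutoff 1 y * weight \<theta> y)" by (rule integrable_cutoff_1)
    show "integrable lborel (\<lambda>y. 1 * weight \<theta> y)" by (simp add: integrable_weight)
    show "cutoff 1 y * weight \<theta> y \<le> 1 * weight \<theta> y" for y
      using weight_pos[of \<theta> y] cutoff_le_1[of 1 y] by (intro mult_right_mono) auto
  qed
  then show ?thesis using J_cutoff_pos unfolding J_one by linarith
qed

text \<open>The constant function 1, whose expectation is known, calibrates
  \<open>ell\<close>.\<close>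

lemma limit:
  assumes u: "\<And>y. (u has_real_derivative u' y) (at y)" "\<And>y. isCont u' y" and u1: "\<And>y. \<bar>u y\<bar> \<le> 1"
  shows "(\<lambda>n. E n u) \<longlonglongrightarrow> J u / partition_fn \<theta>"
proof -
  have "(\<lambda>n. E n (\<lambda>_. 1) - J (\<lambda>_. 1) * ell n) \<longlonglongrightarrow> 0"
    by (rule bounded_test[where u'="\<lambda>_. 0"]) auto
  then have "(\<lambda>n. (1 - (1 - partition_fn \<theta> * ell n)) / partition_fn \<theta>) \<longlonglongrightarrow> (1 - 0) / partition_fn \<theta>"
    unfolding E_one J_one using partition_fn_pos by (intro tendsto_intros) auto
  then have ell: "ell \<longlonglongrightarrow> 1 / partition_fn \<theta>" using partition_fn_pos by simp
  have "(\<lambda>n. (E n u - J u * ell n) + J u * ell n) \<longlonglongrightarrow> 0 + J u * (1 / partition_fn \<theta>)"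
    by (intro tendsto_add bounded_test[OF u u1] tendsto_mult_left ell)
  then show ?thesis by simp
qed

end

section \<open>Convergence\<close>

context stationary_law begin

text \<open>After the discrete mean of H is subtracted, the rest is a mean-zero linear statistic
  with second moment of order n, and the prefactor n^(-3/4) makes it vanish.\<close>

lemma fluct_deviation:
  fixes H :: "real \<Rightarrow> real"
  assumes a: "a \<le> 1 / 526000" and B: "0 < B" "\<And>u. u \<in> {0..1} \<Longrightarrow> \<bar>H u\<bar> \<le> B"
  shows "ev (\<lambda>\<eta>. \<bar>fluct n H \<eta> - (\<Sum>x\<in>torus n. H (real_of_int x / real n)) / real n * scaled \<eta>\<bar>)
    \<le> (200 * B\<^sup>2 + 1) / rho"
proof -
  define h where "h = (\<Sum>x\<in>torus n. H (real_of_int x / real n)) / real n"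
  \<comment> \<open>Division by 2 B gives \<bar>\<phi>\<bar> \<le> 1; the value 0 off the torus
    serves because \<open>linear_bound\<close> wants this bound at every integer.\<close>
  define \<phi> where "\<phi> x = (if x \<in> torus n then (H (real_of_int x / real n) - h) / (2 * B) else 0)" for x
  define X where "X \<eta> = (\<Sum>x\<in>torus n. \<phi> x * pspin n \<eta> x)" for \<eta>
  have r0: "0 < rho" using rho(1) by simp
  have n: "real n = rho ^ 4" using rho(2) by simp
  have HB: "\<bar>H (real_of_int x / real n)\<bar> \<le> B" if "x \<in> torus n" for x
    using that by (intro B) (auto simp: torus_def)
  have "\<bar>\<Sum>x\<in>torus n. H (real_of_int x / real n)\<bar> \<le> (\<Sum>x\<in>torus n. B)"
    by (rule order.trans[OF sum_abs]) (intro sum_mono HB)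
  then have hB: "\<bar>h\<bar> \<le> B" by (simp add: h_def field_simps)
  have \<phi>1: "\<bar>\<phi> x\<bar> \<le> 1" for x
  proof (cases "x \<in> torus n")
    case True
    have "\<bar>H (real_of_int x / real n) - h\<bar> \<le> 2 * B" using HB[OF True] hB by linarith
    then show ?thesis using True B(1) by (simp add: \<phi>_def)
  qed (simp add: \<phi>_def)
  have \<phi>0: "(\<Sum>x\<in>torus n. \<phi> x) = 0"
  proof -
    have "(\<Sum>x\<in>torus n. \<phi> x) = (\<Sum>x\<in>torus n. (H (real_of_int x / real n) - h) / (2 * B))"
      by (intro sum.cong) (simp_all add: \<phi>_def)
    also have "\<dots> = (real n * h - real n * h) / (2 * B)"
      by (simp add: sum_divide_distrib[symmetric] sum_subtractf) (simp add: h_def n0')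
    finally show ?thesis by simp
  qed
  have powr: "real n powr (- 3 / 4) = 1 / rho ^ 3"
    by (simp add: rho_def powr_power powr_minus_divide)
  have fl: "fluct n H \<eta> - h * scaled \<eta> = B / rho ^ 3 * X \<eta>" for \<eta>
  proof -
    have "fluct n H \<eta> = 1 / rho ^ 3 * (\<Sum>x\<in>torus n. (2 * B * \<phi> x + h) * (spin \<eta> x / 2))"
      unfolding fluct_def powr using B(1)
      by (intro arg_cong2[where f="(*)"] refl sum.cong) (simp_all add: \<phi>_def spin_def field_simps)
    also have "(\<Sum>x\<in>torus n. (2 * B * \<phi> x + h) * (spin \<eta> x / 2)) = B * X \<eta> + h / 2 * (real n * mag n \<eta>)"
    proof -
      have "(\<Sum>x\<in>torus n. (2 * B * \<phi> x + h) * (spin \<eta> x / 2)) = (\<Sum>x\<in>torus n. B * (\<phi> x * pspin n \<eta> x) + h / 2 * spin \<eta> x)"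
        by (intro sum.cong) (simp_all add: pspin_torus field_simps)
      then show ?thesis
        by (simp only: X_def mag_def sum.distrib sum_distrib_left[symmetric]) (simp add: n0')
    qed
    finally show ?thesis using r0 by (simp add: scaled_def n field_simps power3_eq_cube power4_eq_xxxx)
  qed
  have X2: "ev (\<lambda>\<eta>. (X \<eta>)\<^sup>2) \<le> 200 * rho ^ 4"
  proof -
    have "ev (\<lambda>\<eta>. (X \<eta>)\<^sup>2) \<le> 100 * real n * (1 + energy)"
      unfolding X_def by (intro linear_bound \<phi>1 \<phi>0)
    also have "\<dots> \<le> 100 * real n * 2" using energy_le_1[OF a] by (intro mult_left_mono) auto
    finally show ?thesis by (simp add: n)
  qed
  have "ev (\<lambda>\<eta>. \<bar>fluct n H \<eta> - h * scaled \<eta>\<bar>) \<le> ev (\<lambda>\<eta>. B\<^sup>2 / rho ^ 5 * (X \<eta>)\<^sup>2 + 1 / rho)"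
  proof (rule ev_mono)
    fix \<eta>
    define z where "z = \<bar>B / rho ^ 3 * X \<eta>\<bar>"
    \<comment> \<open>Passes from first to second moments with weight rho: z \<le> rho z^2 + 1 /
      rho.\<close>
    have "0 \<le> (rho * z - 1)\<^sup>2 + (rho * z)\<^sup>2 + 1" by simp
    then have "rho * z \<le> rho\<^sup>2 * z\<^sup>2 + 1" by (simp add: power2_eq_square algebra_simps)
    then have "z \<le> (rho\<^sup>2 * z\<^sup>2 + 1) / rho" using r0 by (simp add: field_simps)
    also have "\<dots> = rho * z\<^sup>2 + 1 / rho" using r0 by (simp add: field_simps power2_eq_square)
    also have "rho * z\<^sup>2 = B\<^sup>2 / rho ^ 5 * (X \<eta>)\<^sup>2"
      using r0 by (simp add: z_def power_mult_distrib power_divide field_simps eval_nat_numeral)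
    finally show "\<bar>fluct n H \<eta> - h * scaled \<eta>\<bar> \<le> B\<^sup>2 / rho ^ 5 * (X \<eta>)\<^sup>2 + 1 / rho"
      by (simp add: fl z_def)
  qed
  also have "\<dots> = B\<^sup>2 / rho ^ 5 * ev (\<lambda>\<eta>. (X \<eta>)\<^sup>2) + 1 / rho" by (simp only: ev_add ev_cmult ev_const)
  also have "\<dots> \<le> B\<^sup>2 / rho ^ 5 * (200 * rho ^ 4) + 1 / rho"
    using r0 by (intro add_right_mono mult_left_mono X2) auto
  also have "\<dots> = (200 * B\<^sup>2 + 1) / rho" using r0 by (simp add: field_simps eval_nat_numeral)
  finally show ?thesis by (simp add: h_def)
qed

end

text \<open>For 4 \<theta>^2 \<le> n the quantity \<bar>\<theta>\<bar> / sqrt n is at most 1 / 2,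
  which keeps \<gamma> away from 0 and 1 uniformly in n. The condition n > \<theta>^2 alone would
  not.\<close>

lemma stationary_law_mu_ss:
  assumes a: "0 < a" and n: "5 \<le> n" "4 * \<theta>\<^sup>2 \<le> real n"
  shows "stationary_law n (pmf (mu_ss \<theta> a n)) \<theta> a"
proof -
  have n0: "0 < n" using n by simp
  have "\<bar>2 * \<theta>\<bar> \<le> sqrt (real n)" using n by (intro real_le_rsqrt) (simp add: power_mult_distrib)
  then have "\<bar>\<theta> / sqrt (real n)\<bar> \<le> 1 / 2" using n0 by (simp add: abs_mult field_simps)
  moreover have "1 / 4 \<le> (1 - t) / 2 \<and> (1 - t) / 2 \<le> 3 / 4" if "\<bar>t\<bar> \<le> 1 / 2" for t :: real
    using that by (auto simp: abs_le_iff field_simps)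
  ultimately have g: "1 / 4 \<le> gamma \<theta> n" "gamma \<theta> n \<le> 3 / 4" unfolding gamma_def by blast+
  then have g': "0 < gamma \<theta> n" "gamma \<theta> n < 1" by simp_all
  note mu = mu_ss_properties[OF n0 a g']
  have pl: "positive_law n (pmf (mu_ss \<theta> a n))"
    using n mu by unfold_locales (auto intro: sum_pmf_eq_1)
  show ?thesis
    using pl a g mu(2) unfolding stationary_law_def stationary_law_axioms_def is_stationary_def positive_law.ev_def[OF pl] by blast
qed

text \<open>A Lipschitz function deviates from its left endpoint rule by at most L / n^2 on each of
  the n cells.\<close>

lemma riemann_sum_tendsto:
  fixes H :: "real \<Rightarrow> real"
  assumes H: "\<And>x. (H has_real_derivative H' x) (at x)" and L: "\<And>x. x \<in> {0..1} \<Longrightarrow> \<bar>H' x\<bar> \<le> L"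
  shows "(\<lambda>n. (\<Sum>x\<in>torus n. H (real_of_int x / real n)) / real n) \<longlonglongrightarrow> integral {0..1} H"
proof -
  have cont: "continuous_on S H" for S
    by (intro continuous_at_imp_continuous_on ballI DERIV_isCont[OF H])
  have L0: "0 \<le> L" using L[of 0] by simp
  have lip: "\<bar>H x - H y\<bar> \<le> L * \<bar>x - y\<bar>" if "x \<in> {0..1}" "y \<in> {0..1}" for x y
    using field_differentiable_bound[of "{0..1}" H H' L x y] H L that
    by (auto intro: has_field_derivative_at_within)
  have step: "\<bar>integral {c..c + d} H - d * H c\<bar> \<le> L * d\<^sup>2" if "0 \<le> c" "0 \<le> d" "c + d \<le> 1" for c d
  proof -
    have "integral {c..c + d} H - d * H c = integral {c..c + d} (\<lambda>x. H x - H c)"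
      using that by (subst integral_diff) (auto intro: integrable_continuous_real cont)
    also have "norm \<dots> \<le> (L * d) * (c + d - c)"
    proof (rule integral_bound)
      fix t assume t: "t \<in> {c..c + d}"
      then have "\<bar>H t - H c\<bar> \<le> L * \<bar>t - c\<bar>" using that by (intro lip) auto
      also have "\<dots> \<le> L * d" using t L0 by (intro mult_left_mono) auto
      finally show "norm (H t - H c) \<le> L * d" by simp
    next
      show "continuous_on {c..c + d} (\<lambda>t. H t - H c)" by (intro continuous_intros cont)
    qed (use that in simp)
    finally show ?thesis by (simp add: power2_eq_square)
  qed
  have bound: "\<bar>integral {0..1} H - (\<Sum>x\<in>torus n. H (real_of_int x / real n)) / real n\<bar> \<le> L / real n" if n: "0 < n" for n
  proof -
    have "\<bar>integral {0..real k / real n} H - (\<Sum>j<k. H (real j / real n) / real n)\<bar> \<le> real k * (L * (1 / real n)\<^sup>2)" if "k \<le> n" for k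
      using that
    proof (induction k)
      case (Suc k)
      let ?c = "real k / real n" and ?d = "1 / real n"
      have e: "?c + ?d = real (Suc k) / real n" by (simp add: add_divide_distrib)
      have le: "?c + ?d \<le> 1" unfolding e using Suc.prems n by simp
      have "integral {0..?c} H + integral {?c..?c + ?d} H = integral {0..?c + ?d} H"
        by (rule Henstock_Kurzweil_Integration.integral_combine) (auto intro: integrable_continuous_real cont)
      moreover have "\<bar>integral {?c..?c + ?d} H - ?d * H ?c\<bar> \<le> L * ?d\<^sup>2" using le by (intro step) auto
      moreover have "\<bar>integral {0..?c} H - (\<Sum>j<k. H (real j / real n) / real n)\<bar> \<le> real k * (L * ?d\<^sup>2)"
        using Suc by simp
      moreover have "(\<Sum>j<Suc k. H (real j / real n) / real n) = (\<Sum>j<k. H (real j / real n) / real n) + ?d * H ?c" by simp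
      moreover have "real (Suc k) * (L * ?d\<^sup>2) = real k * (L * ?d\<^sup>2) + L * ?d\<^sup>2" by (simp add: algebra_simps)
      ultimately show ?case unfolding e[symmetric] abs_le_iff by linarith
    qed simp
    from this[of n] have "\<bar>integral {0..1} H - (\<Sum>j<n. H (real j / real n) / real n)\<bar> \<le> L / real n"
      using n by (simp add: power2_eq_square)
    moreover have "(\<Sum>x\<in>torus n. H (real_of_int x / real n)) = (\<Sum>j<n. H (real j / real n))"
      by (rule sum.reindex_bij_witness[where i=int and j=nat]) (auto simp: torus_def)
    ultimately show ?thesis by (simp add: sum_divide_distrib)
  qed
  show ?thesis
  proof (rule LIM_zero_cancel, rule Lim_null_comparison)
    show "\<forall>\<^sub>F n in sequentially. norm ((\<Sum>x\<in>torus n. H (real_of_int x / real n)) / real n - integral {0..1} H) \<le> L / real n"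
      using eventually_gt_at_top[of 0] by eventually_elim (use bound in \<open>simp add: abs_minus_commute\<close>)
    show "(\<lambda>n. L / real n) \<longlonglongrightarrow> 0" by (rule lim_const_over_n)
  qed
qed

section \<open>The limit law and the convergence of stationary means\<close>

lemma prob_space_alpha_star:
  assumes "0 < partition_fn \<theta>" shows "prob_space (alpha_star \<theta>)"
proof
  have "emeasure (alpha_star \<theta>) (space (alpha_star \<theta>)) = (\<integral>\<^sup>+ y. ennreal (weight \<theta> y / partition_fn \<theta>) \<partial>lborel)"
    unfolding alpha_star_def weight_def[symmetric] by (subst emeasure_density) auto
  also have "\<dots> = ennreal (\<integral>y. weight \<theta> y / partition_fn \<theta> \<partial>lborel)"
    using assms by (intro nn_integral_eq_integral) (auto simp: integrable_weight weight_pos less_imp_le)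
  also have "(\<integral>y. weight \<theta> y / partition_fn \<theta> \<partial>lborel) = 1"
    using assms by (simp add: partition_fn_def weight_def)
  finally show "emeasure (alpha_star \<theta>) (space (alpha_star \<theta>)) = 1" by simp
qed

lemma integral_alpha_star:
  fixes g :: "real \<Rightarrow> real"
  assumes Z: "0 < partition_fn \<theta>" and g: "g \<in> borel_measurable borel"
  shows "(\<integral>y. g y \<partial>alpha_star \<theta>) = (\<integral>y. g y * weight \<theta> y \<partial>lborel) / partition_fn \<theta>"
proof -
  have "(\<integral>y. g y \<partial>alpha_star \<theta>) = (\<integral>y. (weight \<theta> y / partition_fn \<theta>) *\<^sub>R g y \<partial>lborel)"
    unfolding alpha_star_def weight_def[symmetric] using g Z
    by (intro integral_density) (auto simp: weight_pos less_imp_le)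
  then show ?thesis by (simp add: mult.commute)
qed

text \<open>A finite sum that is defined for every n, also for the finitely many n where nothing is
  known about \<open>mu_ss\<close>.\<close>

definition ss_mean :: "real \<Rightarrow> real \<Rightarrow> nat \<Rightarrow> (config \<Rightarrow> real) \<Rightarrow> real" where
  "ss_mean \<theta> a n g = (\<Sum>\<eta>\<in>configs n. pmf (mu_ss \<theta> a n) \<eta> * g \<eta>)"

lemma sequence_limit:
  assumes a: "0 < a" "a \<le> 1 / 526000"
    and u: "\<And>y. (u has_real_derivative u' y) (at y)" "\<And>y. isCont u' y" "\<And>y. \<bar>u y\<bar> \<le> 1"
  defines "Y \<equiv> \<lambda>n \<eta>. real n powr (1 / 4) * mag n \<eta> / 2"
  shows "0 < partition_fn \<theta>"
    and "(\<lambda>n. ss_mean \<theta> a n (\<lambda>\<eta>. u (Y n \<eta>)))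
      \<longlonglongrightarrow> (\<integral>y. u y * weight \<theta> y \<partial>lborel) / partition_fn \<theta>"
proof -
  \<comment> \<open>\<open>stein_sequence\<close> makes demands on every index, so the finitely many
    bad n are shifted away; \<open>LIMSEQ_offset\<close> undoes the shift.\<close>
  define N where "N = max 5 (nat \<lceil>4 * \<theta>\<^sup>2\<rceil>)"
  define E where "E n g = ss_mean \<theta> a (n + N) (\<lambda>\<eta>. g (Y (n + N) \<eta>))" for n and g :: "real \<Rightarrow> real"
  have N5: "5 \<le> n + N" for n by (simp add: N_def)
  have N\<theta>: "4 * \<theta>\<^sup>2 \<le> real (n + N)" for n
  proof -
    have "4 * \<theta>\<^sup>2 \<le> real (nat \<lceil>4 * \<theta>\<^sup>2\<rceil>)" by (rule real_nat_ceiling_ge)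
    also have "\<dots> \<le> real (n + N)"
      unfolding of_nat_le_iff N_def by (rule trans_le_add2) (rule max.cobounded2)
    finally show ?thesis .
  qed
  note sl = stationary_law_mu_ss[OF a(1) N5 N\<theta>]
  have pl: "positive_law (n + N) (pmf (mu_ss \<theta> a (n + N)))" for n
    using sl by (rule stationary_law.axioms(1))
  have Y: "Y (n + N) = stationary_law.scaled (n + N)" for n
    unfolding Y_def by (simp add: fun_eq_iff stationary_law.scaled_def[OF sl] stationary_law.rho_def[OF sl])
  have E: "E n g = positive_law.ev (n + N) (pmf (mu_ss \<theta> a (n + N))) (\<lambda>\<eta>. g (stationary_law.scaled (n + N) \<eta>))" for n g
    unfolding E_def ss_mean_def Y positive_law.ev_def[OF pl] ..
  interpret stein_sequence \<theta> "150001 + 256 * \<theta>\<^sup>2" E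
  proof
    show "E n (\<lambda>y. f y + g y) = E n f + E n g" for n f g
      by (simp add: E_def ss_mean_def distrib_left sum.distrib)
    show "E n (\<lambda>y. c * f y) = c * E n f" for n c f
      by (simp add: E_def ss_mean_def sum_distrib_left mult_ac)
    show "E n f \<le> E n g" if "\<And>y. f y \<le> g y" for n f g
      unfolding E_def ss_mean_def using that by (intro sum_mono mult_left_mono) auto
    show "E n (\<lambda>_. 1) = 1" for n
      unfolding E_def ss_mean_def using positive_law.p_sum[OF pl, of n] by simp
    show "E n (\<lambda>y. y\<^sup>2) \<le> 150001 + 256 * \<theta>\<^sup>2" for n
      unfolding E by (rule stationary_law.scaled_second_moment[OF sl a(2)])
    fix f F F1 F2 :: "real \<Rightarrow> real" and B :: real
    assume H: "\<And>y. (f has_real_derivative F y) (at y)" "\<And>y. (F has_real_derivative F1 y) (at y)"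
      "\<And>y. (F1 has_real_derivative F2 y) (at y)" "0 < B" "\<And>y. \<bar>F y\<bar> \<le> B" "\<And>y. \<bar>F1 y\<bar> \<le> B"
      "\<And>y. \<bar>F2 y\<bar> \<le> B" "\<And>y. \<bar>y ^ 3 * F y\<bar> \<le> B"
    show "(\<lambda>n. E n (\<lambda>y. F1 y / 2 - (2 * \<theta> * y + 2 * y ^ 3) * F y)) \<longlonglongrightarrow> 0"
    proof (rule Lim_null_comparison)
      let ?K = "(6000 + 6 * \<bar>\<theta>\<bar> + 2 * (150001 + 256 * \<theta>\<^sup>2)) * B"
      show "\<forall>\<^sub>F n in sequentially. norm (E n (\<lambda>y. F1 y / 2 - (2 * \<theta> * y + 2 * y ^ 3) * F y)) \<le> ?K * real (n + N) powr (- (1 / 4))"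
        using stationary_law.stein_bound[OF sl a(2) H] unfolding E
        by (intro always_eventually allI) (simp add: stationary_law.rho_def[OF sl] powr_minus_divide)
      have "(\<lambda>n. real (n + N) powr (- (1 / 4))) \<longlonglongrightarrow> 0"
        by (intro tendsto_neg_powr filterlim_compose[OF filterlim_real_sequentially] filterlim_add_const_nat_at_top) simp
      then show "(\<lambda>n. ?K * real (n + N) powr (- (1 / 4))) \<longlonglongrightarrow> 0" by (rule tendsto_mult_right_zero)
    qed
  qed
  show "0 < partition_fn \<theta>" by (rule partition_fn_pos)
  have "(\<lambda>n. E n u) \<longlonglongrightarrow> J u / partition_fn \<theta>" by (rule limit[OF u])
  then show "(\<lambda>n. ss_mean \<theta> a n (\<lambda>\<eta>. u (Y n \<eta>)))
      \<longlonglongrightarrow> (\<integral>y. u y * weight \<theta> y \<partial>lborel) / partition_fn \<theta>"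
    unfolding E_def J_def by (rule LIMSEQ_offset)
qed

text \<open>Since u is 1-Lipschitz, replacing the field by its mean part costs an expected absolute
  difference. That has two sources, the mean-zero part of H and the Riemann sum error times the
  bounded first moment of the scaled magnetization.\<close>

lemma sequence_limit_fluct:
  assumes a: "0 < a" "a \<le> 1 / 526000" and H: "smooth_on_circle H"
    and u: "\<And>y. (u has_real_derivative u' y) (at y)" "\<And>y. isCont u' y" "\<And>y. \<bar>u y\<bar> \<le> 1" "\<And>y. \<bar>u' y\<bar> \<le> 1"
  shows "(\<lambda>n. ss_mean \<theta> a n (\<lambda>\<eta>. u (t * fluct n H \<eta>)))
    \<longlonglongrightarrow> (\<integral>y. u (t * (integral {0..1} H * y)) * weight \<theta> y \<partial>lborel) / partition_fn \<theta>"
proof -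
  define c where "c = t * integral {0..1} H"
  define Y where "Y n \<eta> = real n powr (1 / 4) * mag n \<eta> / 2" for n \<eta>
  define h where "h n = (\<Sum>x\<in>torus n. H (real_of_int x / real n)) / real n" for n
  let ?S = "ss_mean \<theta> a"
  have dH: "(H has_real_derivative deriv H x) (at x)" for x
    using H unfolding smooth_on_circle_def by (metis DERIV_deriv_iff_field_differentiable funpow_0)
  have ddH: "(deriv H has_real_derivative deriv (deriv H) x) (at x)" for x
  proof -
    have "(deriv ^^ 1) H field_differentiable at x" using H unfolding smooth_on_circle_def by blast
    then show ?thesis by (simp add: DERIV_deriv_iff_field_differentiable)
  qed
  have "compact (H ` {0..1})" "compact (deriv H ` {0..1})"
    by (intro compact_continuous_image continuous_at_imp_continuous_on compact_Icc ballI DERIV_isCont[OF dH] DERIV_isCont[OF ddH])+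
  then have "bounded (H ` {0..1})" "bounded (deriv H ` {0..1})" by (auto intro: compact_imp_bounded)
  then obtain B0 L where B0: "\<forall>x\<in>H ` {0..1}. norm x \<le> B0" and L: "\<forall>x\<in>deriv H ` {0..1}. norm x \<le> L"
    unfolding bounded_iff by blast
  define B where "B = max B0 1"
  have B: "0 < B" "\<And>x. x \<in> {0..1} \<Longrightarrow> \<bar>H x\<bar> \<le> B" using B0 by (auto simp: B_def le_max_iff_disj)
  have h: "h \<longlonglongrightarrow> integral {0..1} H"
    unfolding h_def[abs_def] using L by (intro riemann_sum_tendsto[where H'="deriv H" and L=L] dH) auto
  have uc: "((\<lambda>y. u (c * y)) has_real_derivative u' (c * y) * c) (at y)" for y
    by (rule DERIV_chain2[OF u(1)]) (auto intro!: derivative_eq_intros)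
  have u'c: "isCont (\<lambda>y. u' (c * y) * c) y" for y
    by (rule continuous_mult[OF isCont_o2[where f="\<lambda>y. c * y", OF _ u(2)] continuous_const]) simp
  have main: "(\<lambda>n. ?S n (\<lambda>\<eta>. u (c * Y n \<eta>))) \<longlonglongrightarrow> (\<integral>y. u (c * y) * weight \<theta> y \<partial>lborel) / partition_fn \<theta>"
    unfolding Y_def using uc u'c u(3) by (intro sequence_limit(2)[OF a]) auto
  have lip: "\<bar>u x - u y\<bar> \<le> \<bar>x - y\<bar>" for x y
    using field_differentiable_bound[of UNIV u u' 1 x y] u by (simp add: has_field_derivative_at_within)
  define K where "K = 200 * B\<^sup>2 + 1"
  define D where "D = 150002 + 256 * \<theta>\<^sup>2"
  have diff: "\<bar>?S n (\<lambda>\<eta>. u (t * fluct n H \<eta>)) - ?S n (\<lambda>\<eta>. u (c * Y n \<eta>))\<bar>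
     \<le> \<bar>t\<bar> * (K * real n powr (- (1 / 4)) + \<bar>h n - integral {0..1} H\<bar> * D)" if n: "5 \<le> n" "4 * \<theta>\<^sup>2 \<le> real n" for n
  proof -
    interpret stationary_law n "pmf (mu_ss \<theta> a n)" \<theta> a by (rule stationary_law_mu_ss[OF a(1) n])
    have Sev: "?S n = ev" by (simp add: ss_mean_def ev_def fun_eq_iff)
    have Ysc: "Y n = scaled" by (simp add: Y_def scaled_def rho_def fun_eq_iff)
    have 1: "ev (\<lambda>\<eta>. \<bar>fluct n H \<eta> - h n * scaled \<eta>\<bar>) \<le> K * real n powr (- (1 / 4))"
      using fluct_deviation[OF a(2) B] by (simp add: h_def K_def rho_def powr_minus_divide)
    have 2: "ev (\<lambda>\<eta>. \<bar>scaled \<eta>\<bar>) \<le> D"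
    proof -
      have "ev (\<lambda>\<eta>. \<bar>scaled \<eta>\<bar>) \<le> ev (\<lambda>\<eta>. (scaled \<eta>)\<^sup>2 + 1)"
      proof (rule ev_mono)
        fix \<eta>
        have "0 \<le> (\<bar>scaled \<eta>\<bar> - 1)\<^sup>2 + (scaled \<eta>)\<^sup>2 + 1" by simp
        then show "\<bar>scaled \<eta>\<bar> \<le> (scaled \<eta>)\<^sup>2 + 1" by (simp add: power2_eq_square algebra_simps)
      qed
      also have "\<dots> \<le> D" using scaled_second_moment[OF a(2)] by (simp add: ev_add ev_const D_def)
      finally show ?thesis .
    qed
    have "\<bar>ev (\<lambda>\<eta>. u (t * fluct n H \<eta>)) - ev (\<lambda>\<eta>. u (c * scaled \<eta>))\<bar>
      = \<bar>ev (\<lambda>\<eta>. u (t * fluct n H \<eta>) - u (c * scaled \<eta>))\<bar>" by (simp add: ev_diff)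
    also have "\<dots> \<le> ev (\<lambda>\<eta>. \<bar>u (t * fluct n H \<eta>) - u (c * scaled \<eta>)\<bar>)" by (rule abs_ev_le)
    also have "\<dots> \<le> ev (\<lambda>\<eta>. \<bar>t\<bar> * (\<bar>fluct n H \<eta> - h n * scaled \<eta>\<bar> + \<bar>h n - integral {0..1} H\<bar> * \<bar>scaled \<eta>\<bar>))"
    proof (rule ev_mono)
      fix \<eta>
      have "t * fluct n H \<eta> - c * scaled \<eta> = t * ((fluct n H \<eta> - h n * scaled \<eta>) + (h n - integral {0..1} H) * scaled \<eta>)"
        by (simp add: c_def algebra_simps)
      then have "\<bar>u (t * fluct n H \<eta>) - u (c * scaled \<eta>)\<bar> \<le> \<bar>t\<bar> * \<bar>(fluct n H \<eta> - h n * scaled \<eta>) + (h n - integral {0..1} H) * scaled \<eta>\<bar>"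
        using lip[of "t * fluct n H \<eta>" "c * scaled \<eta>"] by (simp only: abs_mult)
      also have "\<dots> \<le> \<bar>t\<bar> * (\<bar>fluct n H \<eta> - h n * scaled \<eta>\<bar> + \<bar>h n - integral {0..1} H\<bar> * \<bar>scaled \<eta>\<bar>)"
        by (intro mult_left_mono order.trans[OF abs_triangle_ineq]) (simp_all only: abs_mult abs_ge_zero order.refl)
      finally show "\<bar>u (t * fluct n H \<eta>) - u (c * scaled \<eta>)\<bar>
        \<le> \<bar>t\<bar> * (\<bar>fluct n H \<eta> - h n * scaled \<eta>\<bar> + \<bar>h n - integral {0..1} H\<bar> * \<bar>scaled \<eta>\<bar>)" .
    qed
    also have "\<dots> = \<bar>t\<bar> * (ev (\<lambda>\<eta>. \<bar>fluct n H \<eta> - h n * scaled \<eta>\<bar>) + \<bar>h n - integral {0..1} H\<bar> * ev (\<lambda>\<eta>. \<bar>scaled \<eta>\<bar>))"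
      by (simp only: ev_cmult ev_add)
    also have "\<dots> \<le> \<bar>t\<bar> * (K * real n powr (- (1 / 4)) + \<bar>h n - integral {0..1} H\<bar> * D)"
      by (intro mult_left_mono add_mono 1 2) auto
    finally show ?thesis unfolding Sev Ysc .
  qed
  have "(\<lambda>n. ?S n (\<lambda>\<eta>. u (t * fluct n H \<eta>)) - ?S n (\<lambda>\<eta>. u (c * Y n \<eta>))) \<longlonglongrightarrow> 0"
  proof (rule Lim_null_comparison)
    have "eventually (\<lambda>n. 5 \<le> n \<and> nat \<lceil>4 * \<theta>\<^sup>2\<rceil> \<le> n) sequentially"
      by (intro eventually_conj eventually_ge_at_top)
    then show "\<forall>\<^sub>F n in sequentially. norm (?S n (\<lambda>\<eta>. u (t * fluct n H \<eta>)) - ?S n (\<lambda>\<eta>. u (c * Y n \<eta>)))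
      \<le> \<bar>t\<bar> * (K * real n powr (- (1 / 4)) + \<bar>h n - integral {0..1} H\<bar> * D)"
      by eventually_elim (use diff in \<open>simp add: nat_le_iff ceiling_le_iff\<close>)
    have "(\<lambda>n. real n powr (- (1 / 4))) \<longlonglongrightarrow> 0"
      by (intro tendsto_neg_powr filterlim_real_sequentially) simp
    moreover have "(\<lambda>n. \<bar>h n - integral {0..1} H\<bar>) \<longlonglongrightarrow> 0"
      using h by (intro tendsto_rabs_zero LIM_zero)
    ultimately have "(\<lambda>n. \<bar>t\<bar> * (K * real n powr (- (1 / 4)) + \<bar>h n - integral {0..1} H\<bar> * D)) \<longlonglongrightarrow> \<bar>t\<bar> * (K * 0 + 0 * D)"
      by (intro tendsto_intros)
    then show "(\<lambda>n. \<bar>t\<bar> * (K * real n powr (- (1 / 4)) + \<bar>h n - integral {0..1} H\<bar> * D)) \<longlonglongrightarrow> 0" by simp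
  qed
  from tendsto_add[OF this main] show ?thesis
    by (simp add: c_def mult.assoc)
qed

theorem corollary2p4:
  fixes \<theta> :: real
  shows "\<exists>a\<^sub>0>0. \<forall>a. 0 < a \<and> a < a\<^sub>0 \<longrightarrow>
    (\<forall>H. smooth_on_circle H \<longrightarrow>
      weak_conv_m
        (\<lambda>n. distr (measure_pmf (mu_ss \<theta> a n)) borel (fluct n H))
        (distr (alpha_star \<theta>) borel (\<lambda>y. integral {0..1} H * y)))"
\<comment> \<open>The threshold is 1 / (2 * 263000), from \<open>energy_le_1\<close> and the
  constant in \<open>ev_drift_le\<close>.\<close>
proof (intro exI[of _ "1 / 526000"] conjI allI impI)
  fix a :: real and H assume "0 < a \<and> a < 1 / 526000" and H: "smooth_on_circle H"
  then have a: "0 < a" "a \<le> 1 / 526000" by auto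
  let ?h = "integral {0..1} H"
  let ?M = "\<lambda>n. distr (measure_pmf (mu_ss \<theta> a n)) borel (fluct n H)"
  let ?M' = "distr (alpha_star \<theta>) borel (\<lambda>y. ?h * y)"
  \<comment> \<open>Any admissible test function yields this conclusion of
    \<open>sequence_limit\<close>; zero is the simplest.\<close>
  have Z: "0 < partition_fn \<theta>"
    by (rule sequence_limit(1)[OF a, of "\<lambda>_. 0" "\<lambda>_. 0"]) auto
  interpret alpha: prob_space "alpha_star \<theta>" by (rule prob_space_alpha_star[OF Z])
  have meas: "(\<lambda>y. ?h * y) \<in> borel_measurable (alpha_star \<theta>)" by (simp add: alpha_star_def)
  show "weak_conv_m ?M ?M'"
  \<comment> \<open>Real and imaginary parts of the characteristic function are means of cosine and
    sine, which together with their derivatives are bounded by 1, as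
    \<open>sequence_limit_fluct\<close> requires.\<close>
  proof (rule levy_continuity)
    show "real_distribution (?M n)" for n by (intro prob_space.real_distribution_distr measure_pmf.prob_space_axioms) simp
    show "real_distribution ?M'" by (intro alpha.real_distribution_distr meas)
    fix t
    have lim: "(\<lambda>n. ss_mean \<theta> a n (\<lambda>\<eta>. u (t * fluct n H \<eta>)))
      \<longlonglongrightarrow> (\<integral>y. u (t * (?h * y)) \<partial>alpha_star \<theta>)"
      if "\<And>y. (u has_real_derivative u' y) (at y)" "\<And>y. isCont u' y" "\<And>y. \<bar>u y\<bar> \<le> 1" "\<And>y. \<bar>u' y\<bar> \<le> 1" for u u'
    proof -
      have "u \<in> borel_measurable borel"
        by (intro borel_measurable_continuous_onI continuous_at_imp_continuous_on ballI DERIV_isCont[OF that(1)])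
      then show ?thesis
        using sequence_limit_fluct[OF a H that] by (subst integral_alpha_star[OF Z]) auto
    qed
    have cos: "(\<lambda>n. ss_mean \<theta> a n (\<lambda>\<eta>. cos (t * fluct n H \<eta>))) \<longlonglongrightarrow> (\<integral>y. cos (t * (?h * y)) \<partial>alpha_star \<theta>)"
      by (rule lim[OF DERIV_cos]) auto
    have sin: "(\<lambda>n. ss_mean \<theta> a n (\<lambda>\<eta>. sin (t * fluct n H \<eta>))) \<longlonglongrightarrow> (\<integral>y. sin (t * (?h * y)) \<partial>alpha_star \<theta>)"
      by (rule lim[OF DERIV_sin]) auto
    have "char ?M' t = (CLINT y|alpha_star \<theta>. iexp (t * (?h * y)))"
      unfolding char_def using meas by (subst integral_distr) auto
    also have "\<dots> = Complex (\<integral>y. cos (t * (?h * y)) \<partial>alpha_star \<theta>) (\<integral>y. sin (t * (?h * y)) \<partial>alpha_star \<theta>)"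
    proof -
      have "integrable (alpha_star \<theta>) (\<lambda>y. iexp (t * (?h * y)))"
        by (intro alpha.integrable_iexp) (auto simp: alpha_star_def)
      from integral_Re[OF this] integral_Im[OF this] show ?thesis
        by (simp add: complex_eq_iff Re_exp Im_exp)
    qed
    finally have char': "char ?M' t = \<dots>" .
    \<comment> \<open>Only eventually, since the support of \<open>mu_ss\<close> is known only for
      large n.\<close>
    have "eventually (\<lambda>n. char (?M n) t = Complex (ss_mean \<theta> a n (\<lambda>\<eta>. cos (t * fluct n H \<eta>)))
        (ss_mean \<theta> a n (\<lambda>\<eta>. sin (t * fluct n H \<eta>)))) sequentially"
      using eventually_ge_at_top[of 5] eventually_ge_at_top[of "nat \<lceil>4 * \<theta>\<^sup>2\<rceil>"]
    proof eventually_elim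
      case (elim n)
      then have "4 * \<theta>\<^sup>2 \<le> real n" by (simp add: nat_le_iff ceiling_le_iff)
      interpret stationary_law n "pmf (mu_ss \<theta> a n)" \<theta> a
        using elim by (intro stationary_law_mu_ss a \<open>4 * \<theta>\<^sup>2 \<le> real n\<close>)
      have set: "set_pmf (mu_ss \<theta> a n) \<subseteq> configs n"
        by (rule mu_ss_properties(1)[OF n0 a(1) gamma01])
      have "char (?M n) t = (CLINT \<eta>|measure_pmf (mu_ss \<theta> a n). iexp (t * fluct n H \<eta>))"
        unfolding char_def by (subst integral_distr) auto
      also have "\<dots> = (\<Sum>\<eta>\<in>configs n. pmf (mu_ss \<theta> a n) \<eta> *\<^sub>R iexp (t * fluct n H \<eta>))"
        using set by (intro integral_measure_pmf) auto
      also have "\<dots> = Complex (ss_mean \<theta> a n (\<lambda>\<eta>. cos (t * fluct n H \<eta>)))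
        (ss_mean \<theta> a n (\<lambda>\<eta>. sin (t * fluct n H \<eta>)))"
        by (simp add: ss_mean_def complex_eq_iff Re_exp Im_exp)
      finally show ?case .
    qed
    then show "(\<lambda>n. char (?M n) t) \<longlonglongrightarrow> char ?M' t"
      unfolding char' by (subst tendsto_cong, assumption) (intro tendsto_Complex cos sin)
  qed
qed simp

end
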